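(* Define integers $a(n)$, $n\ge 0$, by \[ \sum_{n=0}^{\infty}a(n)q^n=\frac{(q;q)_{\infty}}{(-q;q)_{\infty}} \left( \frac{(q^2;q^2)_{\infty}}{(-q^2;q^2)_{\infty}}\right )^2 . \] Then for positive integers $n$: \begin{itemize} \item $a(n)=-4H(4n)$ if $n\equiv 1,2,5,6 \pmod 8$; \item $a(n)=6H(4n)=24H(n)$ if $n\equiv 3\pmod 8$; \item $a(n)=0$ if $n\equiv 7\pmod 8$; \item $a(n)=r_3(n)=r_3(n/4)$ if $n\equiv 0\pmod 4$. \end{itemize}
   Context: For $|q|<1$, $(x;q)_\infty=\prod_{k\ge 0}(1-xq^k)$. $r_3(n)$ denotes the number of triples $(x,y,z)\in\mathbb{Z}^3$ with $x^2+y^2+z^2=n$. $H(N)$ is the Hurwitz class number: $H(N)=0$ if $N\equiv 1,2\pmod 4$; $H(0)=-1/12$; and for $N>0$ with $N\equiv 0,3\pmod 4$, $H(N)$ is the number of $\mathrm{SL}_2(\mathbb{Z})$-equivalence classes of (not necessarily primitive) positive definite integral binary quadratic forms $ax^2+bxy+cy^2$ of discriminant $b^2-4ac=-N$, where classes of forms equivalent to $a(x^2+y^2)$ are counted with weight $1/2$ and those equivalent to $a(x^2+xy+y^2)$ with weight $1/3$. *)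

theory Defs
  imports "HOL-Analysis.Analysis"
begin

definition qpochhammer_inf :: "complex \<Rightarrow> complex \<Rightarrow> complex" where
  "qpochhammer_inf x q = (\<Prod>k. 1 - x * q ^ k)"

definition r3 :: "nat \<Rightarrow> nat" where
  "r3 n = card {(x::int, y::int, z::int). x\<^sup>2 + y\<^sup>2 + z\<^sup>2 = int n}"

text \<open>The triple \<open>(a, b, c)\<close> stands for the integral binary quadratic form
  \<open>a x\<^sup>2 + b x y + c y\<^sup>2\<close>, not necessarily primitive.\<close>

type_synonym bqf = "int \<times> int \<times> int"

fun bqf_eval :: "bqf \<Rightarrow> int \<Rightarrow> int \<Rightarrow> int" where
  "bqf_eval (a, b, c) x y = a * x\<^sup>2 + b * x * y + c * y\<^sup>2"

fun bqf_discr :: "bqf \<Rightarrow> int" where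
  "bqf_discr (a, b, c) = b\<^sup>2 - 4 * a * c"

definition bqf_posdef :: "bqf \<Rightarrow> bool" where
  "bqf_posdef f \<longleftrightarrow> (\<forall>x y. (x, y) \<noteq> (0, 0) \<longrightarrow> bqf_eval f x y > 0)"

definition bqf_SL2_equiv :: "bqf \<Rightarrow> bqf \<Rightarrow> bool" where
  "bqf_SL2_equiv f g \<longleftrightarrow>
     (\<exists>\<alpha> \<beta> \<gamma> \<delta>. \<alpha> * \<delta> - \<beta> * \<gamma> = 1 \<and>
        (\<forall>x y. bqf_eval g x y = bqf_eval f (\<alpha> * x + \<beta> * y) (\<gamma> * x + \<delta> * y)))"

definition posdef_forms :: "nat \<Rightarrow> bqf set" where
  "posdef_forms N = {f. bqf_posdef f \<and> bqf_discr f = - int N}"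

definition form_classes :: "nat \<Rightarrow> bqf set set" where
  "form_classes N = posdef_forms N //
     {(f, g). f \<in> posdef_forms N \<and> g \<in> posdef_forms N \<and> bqf_SL2_equiv f g}"

definition class_weight :: "bqf set \<Rightarrow> rat" where
  "class_weight C =
     (if \<exists>a. (a, 0, a) \<in> C then 1 / 2
      else if \<exists>a. (a, a, a) \<in> C then 1 / 3
      else 1)"

definition hurwitz_class_number :: "nat \<Rightarrow> rat" where
  "hurwitz_class_number N =
     (if N mod 4 = 1 \<or> N mod 4 = 2 then 0
      else if N = 0 then - 1 / 12
      else (\<Sum>C\<in>form_classes N. class_weight C))"

end

theory Submission
  imports Defs
begin

text \<open>By the triple product the generating function is \<open>\<phi>(-q) \<phi>(-q\<^sup>2)\<^sup>2\<close> with
  \<open>\<phi>(q) = \<Sum> q^(n\<^sup>2)\<close>, so \<open>a(n)\<close> is a signed count of representations by three squares, and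
  parity turns it into \<open>r3(n)\<close> or \<open>- r3(n) / 3\<close>. Class numbers enter because positive
  definite forms of discriminant \<open>- N\<close> with an obtuse superbase (Selling reduction) correspond to
  triples \<open>A, B, C \<ge> 0\<close> of equal parity with \<open>AB + BC + CA = N\<close>. The bridge is the identity
  \<open>\<phi>(-q)^3 = 1 - 6 \<Sum> (-1)^(a+b) q^(ab) - 4 \<Sum> (-1)^(a+b+c) q^(ab+bc+ca)\<close> over positive integers.
  Its right-hand side is the constant term of \<open>F(z) g(z)\<close>, where \<open>g(qz) = - g(z)\<close> with pole \<open>z = 1\<close> and
  \<open>z F(z) = q F(z / q\<^sup>2)\<close> with pole \<open>z = -1\<close>. The poles of each factor are zeros of the other, so
  \<open>F g\<close> is a multiple of \<open>\<Sum> q^(n\<^sup>2) z^n\<close>; residues at the two poles and the triple product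
  give the multiple as \<open>\<phi>(-q)^3\<close>.\<close>

section \<open>Convolution of two-sided sequences\<close>

text \<open>The function theory is replaced by arithmetic of Laurent coefficients for real
  \<open>0 < q < 1\<close>. Multiplication becomes \<open>conv\<close>, a functional equation
  becomes a first-order recurrence, a zero becomes the vanishing of a sum that is odd under a
  reflection of the index, and the residue at a pole on the unit circle becomes the difference of
  the limits of the suitably signed coefficients at plus and minus infinity. The price is
  convergence: \<open>F\<close> and \<open>g\<close> expand only in an annulus, and some of the
  zeros lie on circles that carry poles. Real \<open>q\<close> suffice because values on (0,1)
  determine a power series. Class weights never enter the triple sums: six times the weight of a
  class is the number of its obtuse forms plus the number of those with all parameters positive, the
  same combination of nonnegative and positive triples that produces the coefficients 6 and 4. If
  \<open>n\<close> is 1 or 2 modulo 4, all signs agree and the two sides match at once; if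
  \<open>n\<close> is 3 modulo 8 they do not, and triples of different parity types have to be
  compared by bijections.\<close>

lemma summable_on_abs_real: "(f :: _ \<Rightarrow> real) summable_on A \<Longrightarrow> (\<lambda>x. \<bar>f x\<bar>) summable_on A"
  using summable_on_iff_abs_summable_on_real[of f A] by simp

lemma summable_on_if_abs_le:
  assumes "g summable_on A" and "\<And>x. x \<in> A \<Longrightarrow> \<bar>f x :: real\<bar> \<le> g x"
  shows "f summable_on A"
proof -
  have "(\<lambda>x. norm (f x)) summable_on A"
    by (rule Infinite_Sum.abs_summable_on_comparison_test'[OF assms(1)]) (use assms(2) in simp)
  then show ?thesis by (rule abs_summable_summable)
qed

lemma summable_on_int_geometric:
  fixes r C :: real
  assumes "0 \<le> r" "r < 1" and "\<And>n. \<bar>f n\<bar> \<le> C * r ^ nat \<bar>n\<bar>"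
  shows "(f :: int \<Rightarrow> real) summable_on UNIV"
proof -
  have g: "(\<lambda>n. r ^ n) summable_on (UNIV :: nat set)"
    using assms by (intro norm_summable_imp_summable_on) simp
  have "(\<lambda>n. r ^ nat \<bar>n\<bar>) summable_on (range int)"
    using g by (subst summable_on_reindex) (auto simp: o_def)
  moreover have "(\<lambda>n. r ^ nat \<bar>n\<bar>) summable_on (range (\<lambda>n. - int n))"
    using g by (subst summable_on_reindex) (auto simp: o_def inj_on_def)
  ultimately have "(\<lambda>n. r ^ nat \<bar>n\<bar>) summable_on (range int \<union> range (\<lambda>n. - int n))"
    by (rule summable_on_union)
  moreover have "range int \<union> range (\<lambda>n. - int n) = UNIV"
    by (auto simp: image_iff) (metis int_cases2)
  ultimately have "(\<lambda>n. C * r ^ nat \<bar>n\<bar>) summable_on UNIV"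
    by (intro summable_on_cmult_right) simp
  then show ?thesis
    by (rule summable_on_if_abs_le) (use assms in simp)
qed

lemma summable_on_int_shift: "(\<lambda>n::int. f (n + k)) summable_on UNIV \<longleftrightarrow> f summable_on UNIV"
  by (rule summable_on_reindex_bij_witness[of _ "\<lambda>n. n - k" "\<lambda>n. n + k"]) auto

lemma summable_on_int_reflect: "(\<lambda>n::int. f (k - n)) summable_on UNIV \<longleftrightarrow> f summable_on UNIV"
  by (rule summable_on_reindex_bij_witness[of _ "\<lambda>n. k - n" "\<lambda>n. k - n"]) auto

lemma infsum_int_shift: "infsum (\<lambda>n::int. f (n + k)) UNIV = infsum f UNIV"
  by (rule infsum_reindex_bij_witness[of _ "\<lambda>n. n - k" "\<lambda>n. n + k"]) auto

lemma infsum_int_reflect: "infsum (\<lambda>n::int. f (k - n)) UNIV = infsum f UNIV"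
  by (rule infsum_reindex_bij_witness[of _ "\<lambda>n. k - n" "\<lambda>n. k - n"]) auto

lemma infsum_int_odd:
  fixes f :: "int \<Rightarrow> real"
  assumes "\<And>n. f (k - n) = - f n"
  shows "infsum f UNIV = 0"
proof -
  have "infsum f UNIV = infsum (\<lambda>n. - f n) UNIV"
    using infsum_int_reflect[of f k] assms by simp
  then show ?thesis by (simp add: infsum_uminus)
qed

text \<open>If \<open>u\<close> has limits at both ends, its generating function has at most a
  simple pole at z = 1. The differences are the coefficients after multiplication by 1 - z, so
  \<open>L - L'\<close> is the residue up to normalisation.\<close>

lemma infsum_int_telescope:
  fixes u :: "int \<Rightarrow> real"
  assumes "(\<lambda>n. u n - u (n - 1)) summable_on UNIV"
    and "(\<lambda>n. u (int n)) \<longlonglongrightarrow> L" "(\<lambda>n. u (- int n)) \<longlonglongrightarrow> L'"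
  shows "infsum (\<lambda>n. u n - u (n - 1)) UNIV = L - L'"
proof -
  let ?d = "\<lambda>n. u n - u (n - 1)"
  have tele: "(\<Sum>k = - int n + 1..int n. ?d k) = u (int n) - u (- int n)" for n
  proof (induction n)
    case (Suc n)
    have "{- int (Suc n) + 1..int (Suc n)} = insert (int n + 1) (insert (- int n) {- int n + 1..int n})"
      by auto
    then have "(\<Sum>k = - int (Suc n) + 1..int (Suc n). ?d k)
        = ?d (int n + 1) + (?d (- int n) + (\<Sum>k = - int n + 1..int n. ?d k))"
      by simp
    moreover have "u (- int n - 1) = u (- int (Suc n))" "u (int n + 1 - 1) = u (int n)"
      "u (int n + 1) = u (int (Suc n))"
      by (rule arg_cong[of _ _ u], simp)+
    ultimately show ?case using Suc by linarith
  qed simp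
  \<comment> \<open>An infinite sum is a limit over all finite sets, and these intervals exhaust the
    integers. They start at \<open>- int n + 1\<close> so that the sum collapses to
    \<open>u (int n) - u (- int n)\<close>.\<close>
  have "filterlim (\<lambda>n. {- int n + 1..int n}) (finite_subsets_at_top UNIV) sequentially"
    unfolding filterlim_finite_subsets_at_top
  proof (intro allI impI)
    fix X :: "int set" assume X: "finite X \<and> X \<subseteq> UNIV"
    define m where "m = nat (Max (insert 0 (abs ` X))) + 1"
    have "\<bar>x\<bar> < int m" if "x \<in> X" for x
    proof -
      have "\<bar>x\<bar> \<le> Max (insert 0 (abs ` X))" by (rule Max_ge) (use X that in auto)
      then show ?thesis using abs_ge_zero[of x] unfolding m_def by linarith
    qed
    then have "X \<subseteq> {- int n + 1..int n}" if "n \<ge> m" for n using that by fastforce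
    then show "\<forall>\<^sub>F n in sequentially. finite {- int n + 1..int n} \<and> X \<subseteq> {- int n + 1..int n}
       \<and> {- int n + 1..int n} \<subseteq> UNIV"
      by (auto simp: eventually_sequentially)
  qed
  moreover have "(sum ?d \<longlongrightarrow> infsum ?d UNIV) (finite_subsets_at_top UNIV)"
    using assms(1) by (metis has_sum_def has_sum_infsum)
  ultimately have "(\<lambda>n. sum ?d {- int n + 1..int n}) \<longlonglongrightarrow> infsum ?d UNIV"
    by (rule filterlim_compose[rotated])
  moreover have "(\<lambda>n. sum ?d {- int n + 1..int n}) \<longlonglongrightarrow> L - L'"
    unfolding tele by (intro tendsto_intros assms)
  ultimately show ?thesis by (rule LIMSEQ_unique)
qed

section \<open>Double sums and convolutions\<close>

lemma summable_on_Times_mult: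
  fixes u v :: "_ \<Rightarrow> real"
  assumes "u summable_on A" "v summable_on B"
  shows "(\<lambda>(n, k). u n * v k) summable_on A \<times> B"
proof -
  have "(\<lambda>(n, k). \<bar>u n\<bar> * \<bar>v k\<bar>) summable_on A \<times> B"
  proof (rule summable_on_SigmaI)
    show "((\<lambda>k. case (n, k) of (n, k) \<Rightarrow> \<bar>u n\<bar> * \<bar>v k\<bar>) has_sum \<bar>u n\<bar> * infsum (\<lambda>k. \<bar>v k\<bar>) B) B" for n
      using summable_on_abs_real[OF assms(2)] by (auto intro!: has_sum_cmult_right has_sum_infsum)
    show "(\<lambda>n. \<bar>u n\<bar> * infsum (\<lambda>k. \<bar>v k\<bar>) B) summable_on A"
      using summable_on_abs_real[OF assms(1)] by (auto intro!: summable_on_cmult_left)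
  qed auto
  then show ?thesis
    by (rule summable_on_if_abs_le) (auto simp: abs_mult)
qed

lemma infsum_Times_mult:
  fixes u v :: "_ \<Rightarrow> real"
  assumes "u summable_on A" "v summable_on B"
  shows "infsum (\<lambda>(n, k). u n * v k) (A \<times> B) = infsum u A * infsum v B"
  using infsum_Sigma_banach[OF summable_on_Times_mult[OF assms]]
  by (simp add: infsum_cmult_right' infsum_cmult_left')

definition conv :: "(int \<Rightarrow> real) \<Rightarrow> (int \<Rightarrow> real) \<Rightarrow> int \<Rightarrow> real" where
  "conv u v N = (\<Sum>\<^sub>\<infinity>n. u n * v (N - n))"

lemma summable_on_conv_pair:
  fixes u v :: "int \<Rightarrow> real"
  assumes "u summable_on UNIV" "v summable_on UNIV"
  shows "(\<lambda>(N, n). u n * v (N - n)) summable_on UNIV \<times> UNIV"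
  using summable_on_Times_mult[OF assms]
  by (subst summable_on_reindex_bij_witness[of _ "\<lambda>(n, k). (n + k, n)" "\<lambda>(N, n). (n, N - n)"
        _ "\<lambda>(n, k). u n * v k"]) auto

text \<open>Evaluation of a product of Laurent series at z = 1: the substitution of
  \<open>(n + k, n)\<close> for \<open>(n, k)\<close> carries the product of the two sums to the sum
  of \<open>conv\<close>.\<close>

lemma summable_on_conv:
  assumes "u summable_on UNIV" "v summable_on UNIV"
  shows "conv u v summable_on UNIV" "infsum (conv u v) UNIV = infsum u UNIV * infsum v UNIV"
proof -
  note s = summable_on_conv_pair[OF assms]
  from summable_on_Sigma_banach[OF s]
  show "conv u v summable_on UNIV" by (simp add: conv_def[abs_def])
  have "infsum (conv u v) UNIV = infsum (\<lambda>(N, n). u n * v (N - n)) (UNIV \<times> UNIV)"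
    using infsum_Sigma_banach[OF s] by (simp add: conv_def[abs_def])
  also have "\<dots> = infsum (\<lambda>(n, k). u n * v k) (UNIV \<times> UNIV)"
    by (rule infsum_reindex_bij_witness[of _ "\<lambda>(n, k). (n + k, n)" "\<lambda>(N, n). (n, N - n)"]) auto
  finally show "infsum (conv u v) UNIV = infsum u UNIV * infsum v UNIV"
    by (simp only: infsum_Times_mult[OF assms])
qed

text \<open>Boundedness of \<open>w\<close> dominates the double sum by a constant times the
  summable family of pairs, which permits the exchange of the two summations.\<close>

lemma conv_assoc:
  assumes "u summable_on UNIV" "v summable_on UNIV" and w: "\<And>n. \<bar>w n\<bar> \<le> B"
  shows "conv (conv u v) w M = conv u (conv v w) M"
proof -
  have "(\<lambda>x. \<bar>B\<bar> * \<bar>case x of (N, n) \<Rightarrow> u n * v (N - n)\<bar>) summable_on UNIV \<times> UNIV"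
    by (intro summable_on_cmult_right summable_on_abs_real summable_on_conv_pair assms)
  then have s: "(\<lambda>(N, n). u n * v (N - n) * w (M - N)) summable_on UNIV \<times> UNIV"
  proof (rule summable_on_if_abs_le)
    fix x :: "int \<times> int"
    have "\<bar>w (M - fst x)\<bar> \<le> \<bar>B\<bar>" using w[of "M - fst x"] by simp
    then show "\<bar>case x of (N, n) \<Rightarrow> u n * v (N - n) * w (M - N)\<bar> \<le>
        \<bar>B\<bar> * \<bar>case x of (N, n) \<Rightarrow> u n * v (N - n)\<bar>"
      by (auto simp: case_prod_unfold abs_mult mult.commute[of "\<bar>B\<bar>"] intro!: mult_left_mono)
  qed
  have "conv (conv u v) w M = (\<Sum>\<^sub>\<infinity>N. \<Sum>\<^sub>\<infinity>n. u n * v (N - n) * w (M - N))"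
    by (simp add: conv_def infsum_cmult_left')
  also have "\<dots> = (\<Sum>\<^sub>\<infinity>n. \<Sum>\<^sub>\<infinity>N. u n * v (N - n) * w (M - N))"
    by (rule infsum_swap_banach[OF s])
  also have "\<dots> = (\<Sum>\<^sub>\<infinity>n. \<Sum>\<^sub>\<infinity>k. u n * v k * w (M - n - k))"
  proof (rule infsum_cong)
    fix n
    show "(\<Sum>\<^sub>\<infinity>N. u n * v (N - n) * w (M - N)) = (\<Sum>\<^sub>\<infinity>k. u n * v k * w (M - n - k))"
      by (rule infsum_reindex_bij_witness[of _ "\<lambda>k. k + n" "\<lambda>N. N - n"]) (auto simp: algebra_simps)
  qed
  also have "\<dots> = conv u (conv v w) M"
    by (simp add: conv_def infsum_cmult_right' mult.assoc)
  finally show ?thesis .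
qed

section \<open>The product of an Appell series and a quotient of theta series\<close>

text \<open>Laurent coefficients, valid in \<open>q < |z| < 1\<close>, of the functions \<open>g\<close> and \<open>F\<close> above:
  \<open>g(z) = (1 + z) / (1 - z) + \<dots>\<close> is odd under \<open>z \<mapsto> 1/z\<close>, and so is \<open>F(z) = (1 - z) / (1 + z) + \<dots>\<close>. These
  symmetries are \<open>g_reflect\<close> and \<open>F_reflect\<close>.\<close>

definition g_seq :: "real \<Rightarrow> int \<Rightarrow> real" where
  "g_seq q n = 2 / (1 + q powi n)"

definition tri_theta :: "real \<Rightarrow> int \<Rightarrow> real" where
  "tri_theta q n = q powi (n * (n - 1) div 2)"

text \<open>By the triple product these are the coefficients of j(z), the product of (q;q), (z;q)
  and (q/z;q), whose simple zeros are the powers of \<open>q\<close>; \<open>tri_theta\<close>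
  belongs to j(-z).\<close>

definition alt_tri_theta :: "real \<Rightarrow> int \<Rightarrow> real" where
  "alt_tri_theta q n = (- 1) powi n * tri_theta q n"

definition inv_theta_sum :: "real \<Rightarrow> nat \<Rightarrow> real" where
  "inv_theta_sum q m = (\<Sum>k = - int m..int m. (- 1) powi k * q powi (- (k\<^sup>2)))"

definition F_seq :: "real \<Rightarrow> int \<Rightarrow> real" where
  "F_seq q n = (if n \<ge> 0 then q powi (n\<^sup>2) * inv_theta_sum q (nat n)
                else - (q powi (n\<^sup>2) * inv_theta_sum q (nat (- n - 1))))"

lemma powi_minus_one_odd_even: "(- 1 :: real) powi n = (if even n then 1 else - 1)"
  by (simp add: power_int_minus_left)

lemma inv_theta_sum_Suc:
  "inv_theta_sum q (Suc m) = inv_theta_sum q m + 2 * (- 1) powi (int m + 1) * q powi (- ((int m + 1)\<^sup>2))"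
proof -
  have "{- int (Suc m)..int (Suc m)} = insert (int m + 1) (insert (- (int m + 1)) {- int m..int m})"
    by auto
  moreover have "(- (int m + 1))\<^sup>2 = (int m + 1)\<^sup>2" by (rule power2_minus)
  ultimately show ?thesis
    unfolding inv_theta_sum_def by (simp add: powi_minus_one_odd_even del: of_nat_Suc)
qed

section \<open>Recurrences, reflections and bounds for the coefficients of \<open>F\<close> and
  \<open>g\<close>\<close>

context
  fixes q :: real
  assumes q: "0 < q" "q < 1"
begin

lemma powi_mult: "q powi m * q powi n = q powi (m + n)"
  using q by (simp add: power_int_add)

lemma tri_theta_Suc: "tri_theta q (n + 1) = q powi n * tri_theta q n"
proof -
  have "(n + 1) * (n + 1 - 1) = n * (n - 1) + n * 2" by (simp add: algebra_simps)
  then have "(n + 1) * (n + 1 - 1) div 2 = n + n * (n - 1) div 2"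
    by (simp add: algebra_simps)
  then show ?thesis by (simp add: tri_theta_def powi_mult)
qed

lemma tri_theta_reflect: "tri_theta q (1 - n) = tri_theta q n"
  by (simp add: tri_theta_def algebra_simps)

lemma alt_tri_theta_reflect: "alt_tri_theta q (1 - n) = - alt_tri_theta q n"
  by (simp add: alt_tri_theta_def tri_theta_reflect powi_minus_one_odd_even)

lemma tri_theta_pos: "tri_theta q n > 0"
  using q by (simp add: tri_theta_def)

lemma abs_alt_tri_theta: "\<bar>alt_tri_theta q n\<bar> = tri_theta q n"
  using tri_theta_pos[of n] by (simp add: alt_tri_theta_def abs_mult powi_minus_one_odd_even)

lemma powi_antimono: "m \<le> n \<Longrightarrow> q powi n \<le> q powi m"
  using q by (intro power_int_decreasing) auto

lemma tri_theta_bound: "tri_theta q n \<le> 1 / q * q ^ nat \<bar>n\<bar>"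
proof -
  have "2 * (\<bar>n\<bar> - 1) \<le> n * (n - 1)"
  proof (cases "n \<ge> 1")
    case True
    have "0 \<le> (n - 1) * (n - 2)"
      using True by (cases "n = 1") (auto intro: mult_nonneg_nonneg)
    then show ?thesis using True by (simp add: algebra_simps)
  next
    case False
    have "0 \<le> (- n) * (1 - n) - 2 * (- n - 1)"
    proof (cases "n = 0 \<or> n = - 1")
      case False
      with \<open>\<not> n \<ge> 1\<close> have "0 \<le> (- n - 2) * (- n + 1)" by (intro mult_nonneg_nonneg) auto
      then show ?thesis by (simp add: algebra_simps)
    qed auto
    then show ?thesis using False by (simp add: algebra_simps)
  qed
  then have "\<bar>n\<bar> - 1 \<le> n * (n - 1) div 2"
    using zdiv_mono1[of "2 * (\<bar>n\<bar> - 1)" "n * (n - 1)" 2] by simp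
  then have "tri_theta q n \<le> q powi (\<bar>n\<bar> - 1)"
    unfolding tri_theta_def by (rule powi_antimono)
  also have "\<dots> = 1 / q * q ^ nat \<bar>n\<bar>"
  proof -
    have "q powi (\<bar>n\<bar> - 1) = q powi \<bar>n\<bar> / q powi 1" using q by (intro power_int_diff) auto
    then show ?thesis by (simp add: power_int_def)
  qed
  finally show ?thesis .
qed

lemma summable_tri_theta: "tri_theta q summable_on UNIV"
  using tri_theta_bound tri_theta_pos q
  by (intro summable_on_int_geometric[of q _ "1 / q"]) (auto simp: abs_of_pos)

lemma summable_alt_tri_theta: "alt_tri_theta q summable_on UNIV"
  using tri_theta_bound q
  by (intro summable_on_int_geometric[of q _ "1 / q"]) (auto simp: abs_alt_tri_theta)

lemma F_reflect: "F_seq q n + F_seq q (- n) = 2 * (- 1) powi n"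
proof -
  have pos: "F_seq q n + F_seq q (- n) = 2 * (- 1) powi n" if "n > 0" for n
  proof -
    define m where "m = nat (n - 1)"
    have n: "n = int m + 1" using that by (simp add: m_def)
    have "nat n = Suc m" "nat (- (- n) - 1) = m" using n by auto
    then have "F_seq q n + F_seq q (- n) = q powi (n\<^sup>2) * (inv_theta_sum q (Suc m) - inv_theta_sum q m)"
      using that by (simp add: F_seq_def algebra_simps)
    also have "\<dots> = 2 * (- 1) powi n * (q powi (n\<^sup>2) * q powi (- (n\<^sup>2)))"
      unfolding inv_theta_sum_Suc n by simp
    finally show ?thesis by (simp add: powi_mult)
  qed
  consider "n > 0" | "n = 0" | "- n > 0" by linarith
  then show ?thesis
  proof cases
    case 2
    then show ?thesis by (simp add: F_seq_def inv_theta_sum_def)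
  next
    case 3
    from pos[OF this] show ?thesis by (simp add: powi_minus_one_odd_even)
  qed (use pos in auto)
qed

text \<open>As functions, F(z) and q z F(q^2 z) agree, but their expansions belong to different
  annuli; the term \<open>2 * (- 1) powi n\<close> is the contribution of the pole at -1 between
  them. Divided by \<open>q powi (n\<^sup>2)\<close> the recurrence telescopes, which is the origin
  of the closed form \<open>F_seq\<close>; its free constant is fixed by
  \<open>F_reflect\<close>.\<close>

lemma F_rec: "F_seq q n = q powi (2 * n - 1) * F_seq q (n - 1) + 2 * (- 1) powi n"
proof -
  have pos: "F_seq q n = q powi (2 * n - 1) * F_seq q (n - 1) + 2 * (- 1) powi n" if "n > 0" for n
  proof -
    define m where "m = nat (n - 1)"
    have n: "n = int m + 1" using that by (simp add: m_def)
    have "nat n = Suc m" "nat (n - 1) = m" using n by auto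
    moreover have "q powi (2 * n - 1) * q powi ((n - 1)\<^sup>2) = q powi (n\<^sup>2)"
      unfolding powi_mult by (simp add: power2_eq_square algebra_simps)
    moreover have "q powi (n\<^sup>2) * q powi (- (n\<^sup>2)) = 1" unfolding powi_mult by simp
    moreover have "F_seq q n = q powi (n\<^sup>2) * inv_theta_sum q m
        + 2 * (- 1) powi n * (q powi (n\<^sup>2) * q powi (- (n\<^sup>2)))"
      using that \<open>nat n = Suc m\<close> by (simp add: F_seq_def inv_theta_sum_Suc algebra_simps n)
    ultimately show ?thesis
      using that by (simp add: F_seq_def mult.assoc[symmetric])
  qed
  show ?thesis
  proof (cases "n > 0")
    case False
    have "1 - n > 0" using False by simp
    note r = pos[OF this]
    have "F_seq q (n - 1) = - (q powi (1 - 2 * n)) * F_seq q (- n)"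
      using r F_reflect[of "n - 1"] by (simp add: powi_minus_one_odd_even)
    then have "q powi (2 * n - 1) * F_seq q (n - 1) = - (q powi (2 * n - 1) * q powi (1 - 2 * n)) * F_seq q (- n)"
      by simp
    also have "\<dots> = - F_seq q (- n)" unfolding powi_mult by simp
    finally show ?thesis using F_reflect[of n] by simp
  qed (rule pos)
qed

text \<open>The bound is the fixed point of \<open>B = q * B + 2\<close>, so the recurrence
  preserves it.\<close>

lemma abs_F_seq_le: "n \<ge> 0 \<Longrightarrow> \<bar>F_seq q n\<bar> \<le> 2 / (1 - q)"
proof (induction n rule: int_ge_induct)
  case base
  have "F_seq q 0 = 1" using F_reflect[of 0] by simp
  then show ?case using q by (simp add: field_simps)
next
  case (step n)
  have "\<bar>q powi (2 * (n + 1) - 1) * F_seq q n\<bar> \<le> q * (2 / (1 - q))"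
    unfolding abs_mult
  proof (rule mult_mono)
    show "\<bar>q powi (2 * (n + 1) - 1)\<bar> \<le> q"
      using powi_antimono[of 1 "2 * (n + 1) - 1"] q step.hyps by simp
  qed (use step q in auto)
  then have "\<bar>F_seq q (n + 1)\<bar> \<le> q * (2 / (1 - q)) + 2"
    using F_rec[of "n + 1"] by (simp add: powi_minus_one_odd_even split: if_splits)
  also have "\<dots> = 2 / (1 - q)" using q by (simp add: field_simps)
  finally show ?case .
qed

lemma F_neg: "F_seq q (- n) = - (q powi (2 * n - 1)) * F_seq q (n - 1)"
  using F_reflect[of n] F_rec[of n] by simp

lemma abs_F_seq_neg_le: "n < 0 \<Longrightarrow> \<bar>F_seq q n\<bar> \<le> 2 / (1 - q) * q powi (- 2 * n - 1)"
proof -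
  assume "n < 0"
  have "\<bar>F_seq q n\<bar> = \<bar>F_seq q (- n - 1)\<bar> * q powi (- 2 * n - 1)"
    using F_neg[of "- n"] q by (simp add: abs_mult mult.commute)
  also have "\<dots> \<le> 2 / (1 - q) * q powi (- 2 * n - 1)"
    using \<open>n < 0\<close> q by (intro mult_right_mono abs_F_seq_le) auto
  finally show ?thesis .
qed

lemma g_reflect: "g_seq q n + g_seq q (- n) = 2"
proof -
  have x: "x > 0 \<Longrightarrow> 2 / (1 + x) + 2 / (1 + inverse x) = 2" for x :: real
    by (simp add: divide_simps) (simp add: algebra_simps)
  show ?thesis using x[of "q powi n"] q by (simp add: g_seq_def power_int_minus)
qed

lemma g_bounds: "0 < g_seq q n" "g_seq q n \<le> 2"
proof -
  have "q powi n > 0" using q by simp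
  then show "0 < g_seq q n" "g_seq q n \<le> 2" by (auto simp: g_seq_def field_simps intro!: add_pos_pos)
qed

lemma g_neg_le: "g_seq q n \<le> 2 * q powi (- n)"
proof -
  have "q powi n > 0" using q by simp
  then show ?thesis by (simp add: g_seq_def power_int_minus field_simps)
qed

lemma g_mult: "g_seq q n * (1 + q powi n) = 2"
proof -
  have "q powi n > 0" using q by simp
  then have "1 + q powi n \<noteq> 0" by linarith
  then have "2 / (1 + q powi n) * (1 + q powi n) = 2"
    using nonzero_eq_divide_eq[of "1 + q powi n" "2 / (1 + q powi n)" 2] by blast
  then show ?thesis by (simp only: g_seq_def)
qed

end

section \<open>Algebra of \<open>conv\<close> and first-order recurrences\<close>

lemma conv_comm: "conv u v N = conv v u N"
  unfolding conv_def
  by (rule infsum_reindex_bij_witness[of _ "\<lambda>n. N - n" "\<lambda>n. N - n"]) auto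

lemma infsum_diff_real:
  fixes f g :: "_ \<Rightarrow> real"
  assumes "f summable_on A" "g summable_on A"
  shows "infsum (\<lambda>x. f x - g x) A = infsum f A - infsum g A"
  using infsum_add[of f A "\<lambda>x. - g x"] assms by (simp add: infsum_uminus summable_on_uminus)

lemma conv_cmult_left: "conv (\<lambda>N. c * u N) v M = c * conv u v M"
  unfolding conv_def infsum_cmult_right'[symmetric] by (simp add: mult.assoc)

lemma conv_cmult_right: "conv u (\<lambda>N. c * v N) M = c * conv u v M"
  unfolding conv_def infsum_cmult_right'[symmetric] by (simp add: mult.left_commute)

text \<open>The substitution of s z for z respects products. It serves with \<open>s = - 1\<close>,
  which moves the point -1 to 1, and with \<open>s = sqrt q\<close>, which moves the unit circle
  into the annulus of convergence.\<close>

lemma conv_weighted: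
  assumes "s \<noteq> 0"
  shows "conv (\<lambda>n. u n * s powi n) (\<lambda>n. v n * s powi n) N = conv u v N * s powi N"
proof -
  have "s powi n * s powi (N - n) = s powi N" for n
    using assms by (simp flip: power_int_add)
  then show ?thesis
    unfolding conv_def infsum_cmult_left'[symmetric]
    by (intro infsum_cong) (simp add: algebra_simps)
qed

text \<open>Nonzero multipliers let the recurrence run in both directions. This identifies a
  function from its functional equation up to a constant factor.\<close>

lemma first_order_recurrence_unique:
  fixes h t c :: "int \<Rightarrow> real"
  assumes "\<And>N. h (N + 1) = c N * h N" "\<And>N. t (N + 1) = c N * t N" "\<And>N. c N \<noteq> 0" "t 0 = 1"
  shows "h N = t N * h 0"
proof (induction N rule: int_induct[of _ 0])
  case (step2 i)
  have "h i = c (i - 1) * h (i - 1)" "t i = c (i - 1) * t (i - 1)"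
    using assms(1,2)[of "i - 1"] by auto
  with step2 have "c (i - 1) * h (i - 1) = c (i - 1) * (t (i - 1) * h 0)" by simp
  then show ?case by (rule mult_left_cancel[OF assms(3), THEN iffD1])
qed (use assms in auto)

lemma summable_on_mult_bounded:
  fixes u v :: "_ \<Rightarrow> real"
  assumes "u summable_on A" "\<And>n. \<bar>v n\<bar> \<le> B"
  shows "(\<lambda>n. u n * v n) summable_on A"
proof (rule summable_on_if_abs_le)
  show "(\<lambda>n. \<bar>u n\<bar> * B) summable_on A"
    by (intro summable_on_cmult_left summable_on_abs_real assms)
qed (use assms in \<open>auto simp: abs_mult intro!: mult_left_mono\<close>)

text \<open>Coefficients of \<open>j(z) / (1 - z)\<close>, where \<open>j\<close> has coefficients \<open>alt_tri_theta\<close> and vanishes at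
  \<open>z = 1\<close>. They extract residues: \<open>j u = (j / (1 - z)) ((1 - z) u)\<close>.\<close>

definition tri_partial :: "real \<Rightarrow> int \<Rightarrow> real" where
  "tri_partial q n = (\<Sum>\<^sub>\<infinity>k::nat. alt_tri_theta q (n - int k))"

section \<open>Division by 1 - z and the product of j with \<open>g\<close>\<close>

context
  fixes q :: real
  assumes q: "0 < q" "q < 1"
begin

lemma summable_alt_tail: "(\<lambda>k::nat. alt_tri_theta q (n - int k)) summable_on UNIV"
proof -
  have "(\<lambda>k::int. alt_tri_theta q (n - k)) summable_on range int"
    by (rule summable_on_subset_banach[OF summable_on_int_reflect[THEN iffD2, OF summable_alt_tri_theta[OF q]]])
      simp
  then show ?thesis by (subst (asm) summable_on_reindex) (auto simp: o_def)
qed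

lemma tri_partial_diff: "tri_partial q n - tri_partial q (n - 1) = alt_tri_theta q n"
proof -
  have U: "(UNIV :: nat set) = insert 0 (range Suc)" using not0_implies_Suc by (fastforce simp: image_iff)
  have "tri_partial q n = alt_tri_theta q n + (\<Sum>\<^sub>\<infinity>k\<in>range Suc. alt_tri_theta q (n - int k))"
    unfolding tri_partial_def
    by (subst U, subst infsum_insert)
      (auto intro!: summable_on_subset_banach[OF summable_alt_tail])
  also have "(\<Sum>\<^sub>\<infinity>k\<in>range Suc. alt_tri_theta q (n - int k)) = tri_partial q (n - 1)"
    unfolding tri_partial_def by (subst infsum_reindex) (auto simp: o_def algebra_simps)
  finally show ?thesis by simp
qed

text \<open>Since j(1/z) = - j(z)/z, the quotient j(z)/(1 - z) is invariant under inversion of z.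
  This transports the tail estimate from \<open>n \<le> 0\<close>, where it is plain, to positive
  \<open>n\<close>.\<close>

lemma tri_partial_even: "tri_partial q (- n) = tri_partial q n"
proof -
  have "tri_partial q (- int n) = tri_partial q (int n)" for n
  proof (induction n)
    case (Suc n)
    have "alt_tri_theta q (- int n) = - alt_tri_theta q (int n + 1)"
      using alt_tri_theta_reflect[OF q, of "int n + 1"] by simp
    moreover have "- int n - 1 = - int (Suc n)" "int n + 1 = int (Suc n)" by auto
    moreover have "tri_partial q (int n + 1 - 1) = tri_partial q (int n)"
      by simp
    ultimately show ?case
      using tri_partial_diff[of "- int n"] tri_partial_diff[of "int n + 1"] Suc
      by (simp only:)
  qed simp
  then show ?thesis by (metis int_cases2 minus_minus)
qed

lemma tri_partial_bound: "\<bar>tri_partial q n\<bar> \<le> 1 / q / (1 - q) * q ^ nat \<bar>n\<bar>"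
proof -
  have neg: "\<bar>tri_partial q n\<bar> \<le> 1 / q / (1 - q) * q ^ nat \<bar>n\<bar>" if "n \<le> 0" for n
  proof -
    have geo: "((\<lambda>k::nat. 1 / q * q ^ nat \<bar>n\<bar> * q ^ k) has_sum 1 / q * q ^ nat \<bar>n\<bar> * (1 / (1 - q))) UNIV"
      using q by (intro has_sum_cmult_right norm_summable_imp_has_sum geometric_sums) auto
    have le: "\<bar>alt_tri_theta q (n - int k)\<bar> \<le> 1 / q * q ^ nat \<bar>n\<bar> * q ^ k" for k
    proof -
      have "nat \<bar>n - int k\<bar> = nat \<bar>n\<bar> + k" using that by simp
      then show ?thesis
        using tri_theta_bound[OF q, of "n - int k"] by (simp add: abs_alt_tri_theta[OF q] power_add)
    qed
    have "\<bar>tri_partial q n\<bar> \<le> (\<Sum>\<^sub>\<infinity>k::nat. \<bar>alt_tri_theta q (n - int k)\<bar>)"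
      unfolding tri_partial_def
      using norm_infsum_bound[of "\<lambda>k. alt_tri_theta q (n - int k)" UNIV] summable_on_abs_real[OF summable_alt_tail]
      by simp
    also have "\<dots> \<le> (\<Sum>\<^sub>\<infinity>k::nat. 1 / q * q ^ nat \<bar>n\<bar> * q ^ k)"
      by (rule infsum_mono) (use summable_on_abs_real[OF summable_alt_tail] has_sum_imp_summable[OF geo] le in auto)
    also have "\<dots> = 1 / q / (1 - q) * q ^ nat \<bar>n\<bar>" using infsumI[OF geo] by simp
    finally show ?thesis .
  qed
  show ?thesis using neg[of n] neg[of "- n"] by (cases "n \<le> 0") (auto simp: tri_partial_even)
qed

lemma summable_tri_partial: "tri_partial q summable_on UNIV"
  by (rule summable_on_int_geometric[of q, OF _ _ tri_partial_bound]) (use q in auto)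

lemma conv_tri_partial_diff:
  assumes "\<And>n. \<bar>u n\<bar> \<le> B"
  shows "conv (tri_partial q) (\<lambda>n. u n - u (n - 1)) N = conv (alt_tri_theta q) u N"
proof -
  have s: "(\<lambda>m. tri_partial q (m - k) * u (N - m)) summable_on UNIV" for k N
    using assms summable_tri_partial summable_on_int_shift[of "tri_partial q" "- k"]
    by (intro summable_on_mult_bounded) auto
  have s2: "(\<lambda>m. tri_partial q m * u (N - m - 1)) summable_on UNIV"
    using s[of 0 "N - 1"] by (simp add: algebra_simps)
  have "conv (tri_partial q) (\<lambda>n. u n - u (n - 1)) N
      = (\<Sum>\<^sub>\<infinity>m. tri_partial q m * u (N - m) - tri_partial q m * u (N - m - 1))"
    by (simp add: conv_def algebra_simps)
  also have "\<dots> = (\<Sum>\<^sub>\<infinity>m. tri_partial q m * u (N - m)) - (\<Sum>\<^sub>\<infinity>m. tri_partial q m * u (N - m - 1))"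
    using s[of 0] s2 by (intro infsum_diff_real) simp_all
  also have "(\<Sum>\<^sub>\<infinity>m. tri_partial q m * u (N - m - 1)) = (\<Sum>\<^sub>\<infinity>m. tri_partial q (m - 1) * u (N - m))"
    by (rule infsum_reindex_bij_witness[of _ "\<lambda>m. m - 1" "\<lambda>m. m + 1"]) (auto simp: algebra_simps)
  also have "(\<Sum>\<^sub>\<infinity>m. tri_partial q m * u (N - m)) - \<dots>
      = (\<Sum>\<^sub>\<infinity>m. tri_partial q m * u (N - m) - tri_partial q (m - 1) * u (N - m))"
    using s[of 0] s[of 1] by (intro infsum_diff_real[symmetric]) simp_all
  also have "\<dots> = conv (alt_tri_theta q) u N"
    unfolding conv_def by (intro infsum_cong) (simp flip: tri_partial_diff add: algebra_simps)
  finally show ?thesis .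
qed

text \<open>The value at z = 1 of j times a function with a simple pole there: the zero of j cancels
  the pole and leaves j/(1 - z) at 1 times \<open>L - L'\<close>.\<close>

lemma infsum_conv_alt_tri_theta:
  assumes "\<And>n. \<bar>u n\<bar> \<le> B" "(\<lambda>n. u n - u (n - 1)) summable_on UNIV"
    "(\<lambda>n. u (int n)) \<longlonglongrightarrow> L" "(\<lambda>n. u (- int n)) \<longlonglongrightarrow> L'"
  shows "infsum (conv (alt_tri_theta q) u) UNIV = infsum (tri_partial q) UNIV * (L - L')"
proof -
  have "conv (tri_partial q) (\<lambda>n. u n - u (n - 1)) = conv (alt_tri_theta q) u"
    by (rule ext, rule conv_tri_partial_diff[OF assms(1)])
  then show ?thesis
    using summable_on_conv(2)[OF summable_tri_partial assms(2)] infsum_int_telescope[OF assms(2-4)] by simp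
qed

lemma tendsto_powi_int: "(\<lambda>n. q powi int n) \<longlonglongrightarrow> 0"
  using q by (simp add: LIMSEQ_power_zero)

lemma g_limits: "(\<lambda>n. g_seq q (- int n)) \<longlonglongrightarrow> 0" "(\<lambda>n. g_seq q (int n)) \<longlonglongrightarrow> 2"
proof -
  have "(\<lambda>n. 2 * q powi int n) \<longlonglongrightarrow> 2 * 0"
    by (intro tendsto_intros tendsto_powi_int)
  then have u: "(\<lambda>n. 2 * q powi int n) \<longlonglongrightarrow> 0" by simp
  show l: "(\<lambda>n. g_seq q (- int n)) \<longlonglongrightarrow> 0"
    by (rule tendsto_sandwich[OF _ _ tendsto_const u])
      (use g_bounds[OF q] g_neg_le[OF q, of "- int _"] in \<open>auto intro!: eventuallyI simp: less_imp_le\<close>)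
  have "(\<lambda>n. 2 - g_seq q (- int n)) \<longlonglongrightarrow> 2 - 0"
    by (intro tendsto_intros l)
  moreover have "g_seq q (int n) = 2 - g_seq q (- int n)" for n using g_reflect[OF q, of "int n"] by simp
  ultimately show "(\<lambda>n. g_seq q (int n)) \<longlonglongrightarrow> 2" by simp
qed

lemma q_powi_nat: "n \<ge> 0 \<Longrightarrow> q powi n = q ^ nat n"
  by (simp add: power_int_def)

lemma g_neg_le': "n \<le> 0 \<Longrightarrow> g_seq q n \<le> 2 * q ^ nat \<bar>n\<bar>"
  using g_neg_le[OF q, of n] q_powi_nat[of "- n"] by simp

lemma summable_g_diff: "(\<lambda>n. g_seq q n - g_seq q (n - 1)) summable_on UNIV"
proof (rule summable_on_int_geometric[of q _ "4 / q"])
  fix n :: int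
  show "\<bar>g_seq q n - g_seq q (n - 1)\<bar> \<le> 4 / q * q ^ nat \<bar>n\<bar>"
  proof (cases "n \<le> 0")
    case True
    have "nat \<bar>n - 1\<bar> = Suc (nat \<bar>n\<bar>)" using True by simp
    then have "g_seq q (n - 1) \<le> 2 * q * q ^ nat \<bar>n\<bar>" using g_neg_le'[of "n - 1"] True by simp
    also have "\<dots> \<le> 2 * q ^ nat \<bar>n\<bar>" using q by (simp add: mult_left_le_one_le)
    finally have "\<bar>g_seq q n - g_seq q (n - 1)\<bar> \<le> 2 * q ^ nat \<bar>n\<bar>"
      using g_neg_le'[of n] True g_bounds[OF q, of n] g_bounds[OF q, of "n - 1"] by linarith
    also have "\<dots> \<le> 4 / q * q ^ nat \<bar>n\<bar>" using q by (intro mult_right_mono) (auto simp: field_simps)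
    finally show ?thesis .
  next
    case False
    have "g_seq q n - g_seq q (n - 1) = g_seq q (1 - n) - g_seq q (- n)"
      using g_reflect[OF q, of n] g_reflect[OF q, of "n - 1"] by simp
    moreover have "nat \<bar>n\<bar> = Suc (nat \<bar>1 - n\<bar>)" using False by simp
    moreover have "g_seq q (- n) \<le> 2 * q ^ nat \<bar>n\<bar>" using g_neg_le'[of "- n"] False by simp
    moreover have "g_seq q (1 - n) \<le> 2 * q ^ nat \<bar>1 - n\<bar>" using g_neg_le'[of "1 - n"] False by simp
    moreover have "q ^ Suc (nat \<bar>1 - n\<bar>) \<le> q ^ nat \<bar>1 - n\<bar>" using q by (intro power_decreasing) auto
    ultimately have "\<bar>g_seq q n - g_seq q (n - 1)\<bar> \<le> 2 * q ^ nat \<bar>1 - n\<bar>"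
      using g_bounds[OF q, of "1 - n"] g_bounds[OF q, of "- n"] by (simp only:) linarith
    also have "\<dots> \<le> 4 / q * q ^ nat \<bar>n\<bar>"
      using q unfolding \<open>nat \<bar>n\<bar> = Suc (nat \<bar>1 - n\<bar>)\<close> by simp
    finally show ?thesis .
  qed
qed (use q in auto)

text \<open>The zeros of j sit at the poles of \<open>g\<close>, so the product is regular. It obeys
  the functional equation of j(-z), which fixes it up to a constant.\<close>

lemma conv_alt_tri_theta_g:
  "conv (alt_tri_theta q) (g_seq q) N = tri_theta q N * conv (alt_tri_theta q) (g_seq q) 0"
proof (rule first_order_recurrence_unique[where c = "\<lambda>N. q powi N"])
  fix N
  let ?j = "alt_tri_theta q" and ?g = "g_seq q"
  have j1: "?j (m + 1) = - (q powi m) * ?j m" for m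
    by (simp add: alt_tri_theta_def tri_theta_Suc[OF q] powi_minus_one_odd_even)
  have sg: "\<bar>g_seq q (N - m)\<bar> \<le> 2" for m using g_bounds[OF q, of "N - m"] by simp
  have "conv ?j ?g (N + 1) = (\<Sum>\<^sub>\<infinity>m. ?j (m + 1) * ?g (N - m))"
    unfolding conv_def
    by (rule infsum_reindex_bij_witness[of _ "\<lambda>m. m + 1" "\<lambda>m. m - 1"]) (auto simp: algebra_simps)
  moreover have "q powi N * conv ?j ?g N = (\<Sum>\<^sub>\<infinity>m. q powi N * (?j m * ?g (N - m)))"
    by (simp add: conv_def infsum_cmult_right')
  moreover have "(\<Sum>\<^sub>\<infinity>m. ?j (m + 1) * ?g (N - m)) - (\<Sum>\<^sub>\<infinity>m. q powi N * (?j m * ?g (N - m)))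
      = (\<Sum>\<^sub>\<infinity>m. ?j (m + 1) * ?g (N - m) - q powi N * (?j m * ?g (N - m)))"
    by (intro infsum_diff_real[symmetric] summable_on_cmult_right summable_on_mult_bounded[of _ _ _ 2] sg
        summable_alt_tri_theta[OF q] summable_on_int_shift[THEN iffD2, OF summable_alt_tri_theta[OF q]])
  \<comment> \<open>The recurrence of j supplies the factor \<open>1 + q powi (N - m)\<close> that
    clears the denominator of \<open>g\<close>. What is left sums to a multiple of j(1) = 0.\<close>
  moreover have "?j (m + 1) * ?g (N - m) - q powi N * (?j m * ?g (N - m)) = 2 * ?j (m + 1)" for m
  proof -
    have "?j (m + 1) * ?g (N - m) - q powi N * (?j m * ?g (N - m))
       = - (q powi m * ?j m) * (?g (N - m) * (1 + q powi (N - m)))"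
      unfolding j1 using powi_mult[OF q, of m "N - m", symmetric] by (simp add: algebra_simps)
    then show ?thesis by (simp add: g_mult[OF q] j1)
  qed
  moreover have "(\<Sum>\<^sub>\<infinity>m. 2 * ?j (m + 1)) = 0"
    using infsum_int_odd[of "alt_tri_theta q" 1] alt_tri_theta_reflect[OF q]
      infsum_int_shift[of "alt_tri_theta q" 1]
    by (simp add: infsum_cmult_right')
  ultimately show "conv ?j ?g (N + 1) = q powi N * conv ?j ?g N" by simp
qed (use q in \<open>auto simp: tri_theta_Suc[OF q]\<close>, simp add: tri_theta_def)

text \<open>Two evaluations of j g at z = 1: the residue of \<open>g\<close> gives the factor
  \<open>2 - 0\<close>, while the right-hand side of \<open>conv_alt_tri_theta_g\<close> becomes the
  unknown constant times j(-1).\<close>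

lemma g_constant:
  "conv (alt_tri_theta q) (g_seq q) 0 * infsum (tri_theta q) UNIV = 2 * infsum (tri_partial q) UNIV"
proof -
  have "infsum (conv (alt_tri_theta q) (g_seq q)) UNIV = infsum (tri_partial q) UNIV * (2 - 0)"
    using g_bounds[OF q]
    by (intro infsum_conv_alt_tri_theta[of _ 2] summable_g_diff g_limits) (simp add: abs_of_pos)
  moreover have "infsum (conv (alt_tri_theta q) (g_seq q)) UNIV
      = infsum (\<lambda>N. tri_theta q N * conv (alt_tri_theta q) (g_seq q) 0) UNIV"
    using conv_alt_tri_theta_g by (intro infsum_cong) blast
  ultimately show ?thesis by (simp add: infsum_cmult_left' mult.commute)
qed

end

definition D_seq :: "real \<Rightarrow> int \<Rightarrow> real" where
  "D_seq q = conv (F_seq q) (g_seq q)"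

text \<open>The sums of \<open>balance_seq\<close> and of \<open>F_seq q n * q powi n\<close> vanish: these are the zeros of \<open>F\<close> and \<open>g\<close>
  at \<open>z = 1\<close>, \<open>z = q\<close> and \<open>z = -1\<close>, regularised where a pole lies on the circle of summation.\<close>

definition balance_seq :: "real \<Rightarrow> int \<Rightarrow> int \<Rightarrow> real" where
  "balance_seq q K n = F_seq q n - (- 1) powi n * g_seq q (n - K)"

section \<open>The product F g as a multiple of the theta series\<close>

context
  fixes q :: real
  assumes q: "0 < q" "q < 1"
begin

lemma F_decay: "n \<le> 0 \<Longrightarrow> \<bar>F_seq q n\<bar> \<le> 2 / (1 - q) * q ^ nat \<bar>n\<bar>"
proof (cases "n = 0")
  case False
  assume "n \<le> 0"
  with False have "\<bar>F_seq q n\<bar> \<le> 2 / (1 - q) * q powi (- 2 * n - 1)"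
    by (intro abs_F_seq_neg_le[OF q]) simp
  also have "\<dots> \<le> 2 / (1 - q) * q powi \<bar>n\<bar>"
    using False \<open>n \<le> 0\<close> q by (intro mult_left_mono powi_antimono[OF q]) auto
  finally show ?thesis by (simp add: power_int_def)
qed (use abs_F_seq_le[OF q, of 0] in simp)

lemma F_bounded: "\<bar>F_seq q n\<bar> \<le> 2 / (1 - q)"
proof (cases "n \<ge> 0")
  case False
  then have "\<bar>F_seq q n\<bar> \<le> 2 / (1 - q) * q ^ nat \<bar>n\<bar>" by (intro F_decay) simp
  also have "\<dots> \<le> 2 / (1 - q) * 1" using q by (intro mult_left_mono power_le_one) auto
  finally show ?thesis by simp
qed (rule abs_F_seq_le[OF q])

text \<open>\<open>F_seq\<close> decays towards minus infinity and is merely bounded towards plus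
  infinity, so \<open>u\<close> is asked for the opposite behaviour.\<close>

lemma summable_F_mult:
  assumes "\<And>n. n \<le> 0 \<Longrightarrow> \<bar>u n\<bar> \<le> C" "\<And>n. n \<ge> 0 \<Longrightarrow> \<bar>u n\<bar> \<le> C * q ^ nat \<bar>n\<bar>"
  shows "(\<lambda>n. F_seq q n * u n) summable_on UNIV"
proof (rule summable_on_int_geometric[of q])
  fix n :: int
  have "C \<ge> 0" using assms(1)[of 0] by simp
  show "\<bar>F_seq q n * u n\<bar> \<le> 2 / (1 - q) * C * q ^ nat \<bar>n\<bar>"
  proof (cases "n \<le> 0")
    case True
    have "\<bar>F_seq q n * u n\<bar> \<le> 2 / (1 - q) * q ^ nat \<bar>n\<bar> * C"
      unfolding abs_mult using True F_decay assms(1) q by (intro mult_mono) auto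
    then show ?thesis by (simp add: mult_ac)
  next
    case False
    have "\<bar>F_seq q n * u n\<bar> \<le> 2 / (1 - q) * (C * q ^ nat \<bar>n\<bar>)"
      unfolding abs_mult using False F_bounded assms(2)[of n] q by (intro mult_mono) auto
    then show ?thesis by (simp add: mult_ac)
  qed
qed (use q in auto)

lemma g_decay_right: "g_seq q (N - n) \<le> 2 * q powi (- \<bar>N\<bar>) * q ^ nat \<bar>n\<bar>" if "n \<ge> 0"
proof -
  have "g_seq q (N - n) \<le> 2 * q powi (n - N)" using g_neg_le[OF q, of "N - n"] by simp
  also have "q powi (n - N) \<le> q powi (n + - \<bar>N\<bar>)"
    by (rule powi_antimono[OF q]) simp
  also have "\<dots> = q powi (- \<bar>N\<bar>) * q ^ nat \<bar>n\<bar>"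
    using that unfolding powi_mult[OF q, symmetric] by (simp add: power_int_def)
  finally show ?thesis by simp
qed

lemma one_le_powi_neg: "1 \<le> q powi (- \<bar>N\<bar>)"
  using powi_antimono[OF q, of "- \<bar>N\<bar>" 0] by simp

lemma summable_F_g: "(\<lambda>n. F_seq q n * g_seq q (N - n)) summable_on UNIV"
proof (rule summable_F_mult)
  fix n
  show "\<bar>g_seq q (N - n)\<bar> \<le> 2 * q powi (- \<bar>N\<bar>)"
    using g_bounds[OF q, of "N - n"] one_le_powi_neg[of N] by linarith
  show "n \<ge> 0 \<Longrightarrow> \<bar>g_seq q (N - n)\<bar> \<le> 2 * q powi (- \<bar>N\<bar>) * q ^ nat \<bar>n\<bar>"
    using g_bounds[OF q, of "N - n"] g_decay_right[of n N] by simp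
qed

text \<open>For large positive \<open>n\<close> the defining expression is a difference of two terms
  close to \<open>2 * (- 1) powi n\<close>; in this form each term is small.\<close>

lemma balance_alt: "balance_seq q K n = - F_seq q (- n) + (- 1) powi n * g_seq q (K - n)"
  using F_reflect[OF q, of n] g_reflect[OF q, of "K - n"]
  by (auto simp: balance_seq_def powi_minus_one_odd_even)

lemma summable_balance: "balance_seq q K summable_on UNIV"
proof (rule summable_on_int_geometric[of q])
  fix n
  let ?C = "2 / (1 - q) + 2 * q powi (- \<bar>K\<bar>)"
  show "\<bar>balance_seq q K n\<bar> \<le> ?C * q ^ nat \<bar>n\<bar>"
  proof (cases "n \<le> 0")
    case True
    have "g_seq q (n - K) \<le> 2 * q powi (- \<bar>K\<bar>) * q ^ nat \<bar>n\<bar>"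
      using g_decay_right[of "- n" "- K"] True by simp
    with F_decay[OF True] g_bounds[OF q, of "n - K"] show ?thesis
      by (auto simp: balance_seq_def powi_minus_one_odd_even distrib_right abs_le_iff)
  next
    case False
    then have "\<bar>F_seq q (- n)\<bar> \<le> 2 / (1 - q) * q ^ nat \<bar>n\<bar>" using F_decay[of "- n"] by simp
    with g_decay_right[of n K] False g_bounds[OF q, of "K - n"] show ?thesis
      by (auto simp: balance_alt powi_minus_one_odd_even distrib_right abs_le_iff)
  qed
qed (use q in auto)

lemma infsum_balance: "infsum (balance_seq q K) UNIV = 0"
proof -
  \<comment> \<open>At \<open>K = 0\<close> the failures of \<open>F_seq\<close> and of the signed
    \<open>g_seq\<close> to be odd are both \<open>2 * (- 1) powi n\<close> and cancel.\<close>
  have "infsum (balance_seq q 0) UNIV = 0"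
    by (rule infsum_int_odd[of _ 0])
      (use balance_alt[of 0] in \<open>simp add: balance_seq_def powi_minus_one_odd_even\<close>)
  moreover have "infsum (balance_seq q K) UNIV = infsum (balance_seq q (K - 1)) UNIV" for K
  proof -
    \<comment> \<open>A change of \<open>K\<close> affects only the part with \<open>g_seq\<close>,
      and the difference is odd under reflection about (2K - 1)/2, which also flips the sign
      \<open>(- 1) powi n\<close>.\<close>
    have "infsum (\<lambda>n. balance_seq q K n - balance_seq q (K - 1) n) UNIV = 0"
    proof (rule infsum_int_odd)
      fix n
      have "g_seq q (K - 1 - n) = 2 - g_seq q (n - K + 1)" "g_seq q (K - n) = 2 - g_seq q (n - K)"
        using g_reflect[OF q, of "K - 1 - n"] g_reflect[OF q, of "K - n"] by (simp_all add: algebra_simps)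
      then show "balance_seq q K (2 * K - 1 - n) - balance_seq q (K - 1) (2 * K - 1 - n)
          = - (balance_seq q K n - balance_seq q (K - 1) n)"
        by (simp add: balance_seq_def powi_minus_one_odd_even algebra_simps)
    qed
    then show ?thesis
      using infsum_diff_real[OF summable_balance summable_balance, of K "K - 1"] by simp
  qed
  ultimately show ?thesis
    by (induction K rule: int_induct[of _ 0]) (metis add_diff_cancel_right')+
qed

text \<open>This is F(q) = 0: the functional equation gives F(q) = F(1/q), and inversion gives
  F(1/q) = - F(q).\<close>

lemma infsum_powi_F: "(\<Sum>\<^sub>\<infinity>n. F_seq q n * q powi n) = 0"
proof (rule infsum_int_odd)
  fix n
  have "F_seq q (- 1 - n) = - (q powi (2 * n + 1) * F_seq q n)"
    using F_neg[OF q, of "n + 1"] by (simp add: algebra_simps)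
  moreover have "q powi (2 * n + 1) * q powi (- 1 - n) = q powi n"
    unfolding powi_mult[OF q] by (simp add: algebra_simps)
  ultimately show "F_seq q (- 1 - n) * q powi (- 1 - n) = - (F_seq q n * q powi n)"
    by (simp add: mult_ac)
qed

lemma summable_powi_F: "(\<lambda>n. F_seq q n * q powi n) summable_on UNIV"
proof (rule summable_on_int_geometric[of q])
  fix n :: int
  show "\<bar>F_seq q n * q powi n\<bar> \<le> 2 / (1 - q) / q * q ^ nat \<bar>n\<bar>"
  proof (cases "n < 0")
    case True
    have "q powi (- 2 * n - 1) * q powi n = q powi (\<bar>n\<bar> - 1)"
      unfolding powi_mult[OF q] using True by (intro arg_cong[of _ _ "(powi) q"]) simp
    also have "\<dots> = q ^ nat \<bar>n\<bar> / q"
      using power_int_diff[of q "\<bar>n\<bar>" 1] q by (simp add: power_int_def)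
    finally have "2 / (1 - q) * (q powi (- 2 * n - 1) * q powi n) = 2 / (1 - q) / q * q ^ nat \<bar>n\<bar>"
      by simp
    then show ?thesis
      using mult_right_mono[OF abs_F_seq_neg_le[OF q True], of "q powi n"] q
      by (simp add: abs_mult mult.assoc)
  next
    case False
    have "\<bar>F_seq q n * q powi n\<bar> \<le> 2 / (1 - q) * q ^ nat \<bar>n\<bar>"
      using False q mult_right_mono[OF F_bounded, of "q ^ nat \<bar>n\<bar>" n]
      by (simp add: abs_mult power_int_def)
    also have "\<dots> \<le> 2 / (1 - q) / q * q ^ nat \<bar>n\<bar>"
      using q by (intro mult_right_mono) (auto simp: pos_le_divide_eq mult_left_le)
    finally show ?thesis .
  qed
qed (use q in auto)

text \<open>F g has the functional equation of the theta series. In coefficients, the poles would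
  leave an inhomogeneous term; it consists of two sums that vanish by \<open>infsum_balance\<close>
  and \<open>infsum_powi_F\<close>, that is, because each pole meets a zero.\<close>

lemma D_rec: "D_seq q (N + 1) = q powi (2 * N + 1) * D_seq q N"
proof -
  let ?F = "F_seq q" and ?g = "g_seq q" and ?c = "q powi (2 * N + 1)"
  \<comment> \<open>\<open>F_rec\<close> removes \<open>F (n + 1)\<close> and \<open>g_mult\<close>
    replaces \<open>G * (1 + Q)\<close> by 2, so all products of \<open>F\<close> with
    \<open>g\<close> cancel and only terms linear in one of them survive.\<close>
  have summand: "?F (n + 1) * ?g (N - n) - ?c * (?F n * ?g (N - n))
      = 2 * (balance_seq q (N + 1) (n + 1) - q powi (N + 1) * (?F n * q powi n))" for n
  proof -
    define G where "G = ?g (N - n)"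
    define Q where "Q = q powi (N - n)"
    define P where "P = q powi (2 * n + 1)"
    define e :: real where "e = (- 1) powi n"
    have G: "G * (1 + Q) = 2" unfolding G_def Q_def by (rule g_mult[OF q])
    have g': "?g (n - N) = 2 - G" using g_reflect[OF q, of "N - n"] by (simp add: G_def)
    have F': "?F (n + 1) = P * ?F n - 2 * e"
      using F_rec[OF q, of "n + 1"] by (simp add: P_def e_def powi_minus_one_odd_even algebra_simps)
    have c: "?c = Q * Q * P"
      unfolding Q_def P_def powi_mult[OF q] by (simp add: algebra_simps)
    have d: "q powi (N + 1) * q powi n = Q * P"
      unfolding Q_def P_def powi_mult[OF q] by (simp add: algebra_simps)
    have e': "(- 1) powi (n + 1) = - e" by (simp add: e_def powi_minus_one_odd_even)
    have "balance_seq q (N + 1) (n + 1) - q powi (N + 1) * (?F n * q powi n)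
        = ?F (n + 1) + e * (2 - G) - Q * P * ?F n"
      using d by (simp add: balance_seq_def e' g' mult_ac)
    moreover have "(?F (n + 1) - Q * Q * P * ?F n) * G = 2 * (?F (n + 1) + e * (2 - G) - Q * P * ?F n)"
    proof -
      have "(P * ?F n - 2 * e - Q * Q * P * ?F n) * G = P * ?F n * (1 - Q) * (G * (1 + Q)) - 2 * e * G"
        by (simp add: algebra_simps)
      then show ?thesis unfolding F' G by (simp add: algebra_simps)
    qed
    moreover have "?F (n + 1) * ?g (N - n) - ?c * (?F n * ?g (N - n)) = (?F (n + 1) - Q * Q * P * ?F n) * G"
      unfolding c G_def by (simp add: algebra_simps)
    ultimately show ?thesis by (simp only:)
  qed
  have sb: "(\<lambda>n. balance_seq q (N + 1) (n + 1)) summable_on UNIV"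
    by (rule summable_on_int_shift[THEN iffD2, OF summable_balance])
  have "(\<lambda>n. ?F (n + 1) * ?g (N + 1 - (n + 1))) summable_on UNIV"
    by (rule summable_on_int_shift[THEN iffD2, OF summable_F_g])
  then have s1: "(\<lambda>n. ?F (n + 1) * ?g (N - n)) summable_on UNIV" by simp
  have "D_seq q (N + 1) = (\<Sum>\<^sub>\<infinity>n. ?F (n + 1) * ?g (N - n))"
    unfolding conv_def D_seq_def
    by (rule infsum_reindex_bij_witness[of _ "\<lambda>m. m + 1" "\<lambda>m. m - 1"]) (auto simp: algebra_simps)
  moreover have "?c * D_seq q N = (\<Sum>\<^sub>\<infinity>n. ?c * (?F n * ?g (N - n)))"
    by (simp add: conv_def D_seq_def infsum_cmult_right')
  moreover have "(\<Sum>\<^sub>\<infinity>n. ?F (n + 1) * ?g (N - n)) - (\<Sum>\<^sub>\<infinity>n. ?c * (?F n * ?g (N - n)))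
      = (\<Sum>\<^sub>\<infinity>n. ?F (n + 1) * ?g (N - n) - ?c * (?F n * ?g (N - n)))"
    by (intro infsum_diff_real[symmetric] s1 summable_on_cmult_right summable_F_g)
  moreover have "\<dots> = 2 * ((\<Sum>\<^sub>\<infinity>n. balance_seq q (N + 1) (n + 1)) - q powi (N + 1) * (\<Sum>\<^sub>\<infinity>n. ?F n * q powi n))"
    unfolding summand infsum_cmult_right'
    by (subst infsum_diff_real[OF sb summable_on_cmult_right[OF summable_powi_F]])
      (simp add: infsum_cmult_right')
  moreover have "(\<Sum>\<^sub>\<infinity>n. balance_seq q (N + 1) (n + 1)) = 0"
    using infsum_int_shift[of "balance_seq q (N + 1)" 1] infsum_balance by simp
  ultimately show ?thesis by (simp add: infsum_powi_F)
qed

lemma D_eq: "D_seq q N = q powi (N\<^sup>2) * D_seq q 0"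
proof (rule first_order_recurrence_unique[where c = "\<lambda>N. q powi (2 * N + 1)"])
  show "q powi ((N + 1)\<^sup>2) = q powi (2 * N + 1) * q powi (N\<^sup>2)" for N
    unfolding powi_mult[OF q] by (simp add: power2_eq_square algebra_simps)
qed (use D_rec q in auto)

end

section \<open>The multiple determined by residues\<close>

lemma abs_le_square_int: "\<bar>n::int\<bar> \<le> n\<^sup>2"
  using mult_left_mono[of 1 "\<bar>n\<bar>" "\<bar>n\<bar>"] by (cases "n = 0") (auto simp: power2_eq_square)

definition square_theta :: "real \<Rightarrow> int \<Rightarrow> real" where
  "square_theta q n = q powi (n\<^sup>2)"

lemma alt_tri_theta_twist: "alt_tri_theta q n = tri_theta q n * (- 1) powi n"
  by (simp add: alt_tri_theta_def)

lemma alt_tri_theta_untwist: "tri_theta q n = alt_tri_theta q n * (- 1) powi n"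
  by (simp add: alt_tri_theta_def powi_minus_one_odd_even)

context
  fixes q :: real
  assumes q: "0 < q" "q < 1"
begin

lemma summable_square_theta: "square_theta q summable_on UNIV"
proof (rule summable_on_int_geometric[of q])
  fix n :: int
  have "q powi (n\<^sup>2) \<le> q powi \<bar>n\<bar>" by (rule powi_antimono[OF q abs_le_square_int])
  then show "\<bar>square_theta q n\<bar> \<le> 1 * q ^ nat \<bar>n\<bar>"
    using q by (simp add: square_theta_def power_int_def)
qed (use q in auto)

lemma summable_alt_square_theta: "(\<lambda>n. square_theta q n * (- 1) powi n) summable_on UNIV"
  by (rule summable_on_if_abs_le[OF summable_square_theta])
    (use q in \<open>auto simp: square_theta_def powi_minus_one_odd_even\<close>)

text \<open>The sign moves the pole of \<open>F\<close> from -1 to 1, and the two limits give it the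
  same residue as the pole of \<open>g\<close>.\<close>

lemma F_alt_limits:
  "(\<lambda>n. F_seq q (- int n) * (- 1) powi (- int n)) \<longlonglongrightarrow> 0"
  "(\<lambda>n. F_seq q (int n) * (- 1) powi (int n)) \<longlonglongrightarrow> 2"
proof -
  have "(\<lambda>n. 2 / (1 - q) * q ^ n) \<longlonglongrightarrow> 2 / (1 - q) * 0"
    using q by (intro tendsto_intros LIMSEQ_power_zero) auto
  then have u: "(\<lambda>n. 2 / (1 - q) * q ^ n) \<longlonglongrightarrow> 0" by simp
  show l: "(\<lambda>n. F_seq q (- int n) * (- 1) powi (- int n)) \<longlonglongrightarrow> 0"
  proof (rule Lim_null_comparison[OF _ u], intro eventuallyI)
    fix n
    show "norm (F_seq q (- int n) * (- 1) powi (- int n)) \<le> 2 / (1 - q) * q ^ n"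
      using F_decay[OF q, of "- int n"] by (simp add: abs_mult powi_minus_one_odd_even)
  qed
  have "(\<lambda>n. 2 - F_seq q (- int n) * (- 1) powi (- int n)) \<longlonglongrightarrow> 2 - 0"
    by (intro tendsto_intros l)
  moreover have "F_seq q (int n) * (- 1) powi (int n) = 2 - F_seq q (- int n) * (- 1) powi (- int n)" for n
    using F_reflect[OF q, of "int n"] by (auto simp: powi_minus_one_odd_even)
  ultimately show "(\<lambda>n. F_seq q (int n) * (- 1) powi (int n)) \<longlonglongrightarrow> 2" by simp
qed

lemma summable_F_alt_diff:
  "(\<lambda>n. F_seq q n * (- 1) powi n - F_seq q (n - 1) * (- 1) powi (n - 1)) summable_on UNIV"
proof (rule summable_on_int_geometric[of q _ "4 / (1 - q) / q"])
  fix n :: int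
  let ?B = "2 / (1 - q)"
  have e: "\<bar>F_seq q n * (- 1) powi n - F_seq q (n - 1) * (- 1) powi (n - 1)\<bar> = \<bar>F_seq q n + F_seq q (n - 1)\<bar>"
    by (auto simp: powi_minus_one_odd_even)
  have B: "?B \<le> ?B / q" "0 < ?B" using q by (auto simp: pos_le_divide_eq mult_left_le)
  have "\<bar>F_seq q n + F_seq q (n - 1)\<bar> \<le> 2 * ?B / q * q ^ nat \<bar>n\<bar>"
  proof (cases "n \<le> 0")
    case True
    have "q ^ nat \<bar>n - 1\<bar> \<le> q ^ nat \<bar>n\<bar>" using q True by (intro power_decreasing) auto
    then have "?B * q ^ nat \<bar>n - 1\<bar> \<le> ?B * q ^ nat \<bar>n\<bar>" using B by (intro mult_left_mono) auto
    then have "\<bar>F_seq q n + F_seq q (n - 1)\<bar> \<le> ?B * q ^ nat \<bar>n\<bar> + ?B * q ^ nat \<bar>n\<bar>"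
      using F_decay[OF q, of n] F_decay[OF q, of "n - 1"] True by linarith
    also have "?B * q ^ nat \<bar>n\<bar> \<le> ?B / q * q ^ nat \<bar>n\<bar>"
      using B q by (intro mult_right_mono) auto
    finally show ?thesis by (simp add: algebra_simps)
  next
    case False
    have nn: "nat \<bar>n\<bar> = Suc (nat \<bar>1 - n\<bar>)" using False by simp
    have "F_seq q n + F_seq q (n - 1) = - (F_seq q (- n) + F_seq q (1 - n))"
      using F_reflect[OF q, of n] F_reflect[OF q, of "n - 1"]
      by (cases "even n") (auto simp: powi_minus_one_odd_even)
    then have "\<bar>F_seq q n + F_seq q (n - 1)\<bar> = \<bar>F_seq q (- n) + F_seq q (1 - n)\<bar>"
      by (simp only: abs_minus_cancel)
    also have "\<dots> \<le> ?B * q ^ nat \<bar>n\<bar> + ?B * q ^ nat \<bar>1 - n\<bar>"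
      using F_decay[OF q, of "- n"] F_decay[OF q, of "1 - n"] False by simp
    also have "?B * q ^ nat \<bar>n\<bar> \<le> ?B / q * q ^ nat \<bar>n\<bar>"
      using B q by (intro mult_right_mono) auto
    also have "?B * q ^ nat \<bar>1 - n\<bar> = ?B / q * q ^ nat \<bar>n\<bar>" using q unfolding nn by simp
    finally show ?thesis by (simp add: algebra_simps)
  qed
  then show "\<bar>F_seq q n * (- 1) powi n - F_seq q (n - 1) * (- 1) powi (n - 1)\<bar> \<le> 4 / (1 - q) / q * q ^ nat \<bar>n\<bar>"
    unfolding e by simp
qed (use q in auto)

lemma conv_D_alt_tri_theta:
  "conv (D_seq q) (alt_tri_theta q) M = conv (F_seq q) (conv (g_seq q) (alt_tri_theta q)) M"
proof -
  \<comment> \<open>Evaluating at \<open>|z| = sqrt q\<close>, inside the annulus, makes all three series absolutely summable.\<close>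
  define s where "s = sqrt q"
  have s: "0 < s" "s < 1" "s ^ 2 = q" using q by (auto simp: s_def real_less_lsqrt)
  let ?W = "\<lambda>u n. u n * s powi n"
  have ss: "q ^ n = s ^ n * s ^ n" for n
    unfolding s(3)[symmetric] by (simp add: power2_eq_square power_mult_distrib)
  have abs_W: "\<bar>?W u n\<bar> = \<bar>u n\<bar> * s powi n" for u :: "int \<Rightarrow> real" and n using s by (simp add: abs_mult)
  have decay: "?W u summable_on UNIV" if u: "\<And>n. n \<le> 0 \<Longrightarrow> \<bar>u n\<bar> \<le> C * q ^ nat \<bar>n\<bar>" "\<And>n. \<bar>u n\<bar> \<le> C" for u C
  proof (rule summable_on_int_geometric[of s])
    fix n :: int
    show "\<bar>?W u n\<bar> \<le> C * s ^ nat \<bar>n\<bar>"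
    proof (cases "n \<le> 0")
      case True
      have "s ^ nat \<bar>n\<bar> * s powi n = 1"
        using True s by (cases "n = 0") (auto simp: power_int_def field_simps)
      then have "C * q ^ nat \<bar>n\<bar> * s powi n = C * s ^ nat \<bar>n\<bar>"
        unfolding ss by (simp add: mult.assoc)
      moreover have "\<bar>u n\<bar> * s powi n \<le> C * q ^ nat \<bar>n\<bar> * s powi n"
        using s by (intro mult_right_mono u(1)[OF True]) auto
      ultimately show ?thesis unfolding abs_W by (simp only:)
    next
      case False
      then have "s powi n = s ^ nat \<bar>n\<bar>" by (simp add: power_int_def)
      then show ?thesis
        using mult_right_mono[OF u(2)[of n], of "s powi n"] s unfolding abs_W by simp
    qed
  qed (use s in auto)
  have sF: "?W (F_seq q) summable_on UNIV"
    by (rule decay[of _ "2 / (1 - q)"]) (use F_decay[OF q] F_bounded[OF q] in auto)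
  have sg: "?W (g_seq q) summable_on UNIV"
    by (rule decay[of _ 2]) (use g_neg_le'[OF q] g_bounds[OF q] in \<open>auto simp: abs_of_pos\<close>)
  have bj: "\<bar>?W (alt_tri_theta q) n\<bar> \<le> 1 / q" for n
  proof -
    have "s powi n * q ^ nat \<bar>n\<bar> \<le> 1"
    proof (cases "n \<le> 0")
      case True
      have "s powi n * s ^ nat \<bar>n\<bar> = 1"
        using True s by (cases "n = 0") (auto simp: power_int_def field_simps)
      then have "s powi n * q ^ nat \<bar>n\<bar> = s ^ nat \<bar>n\<bar>"
        unfolding ss by (simp add: mult.assoc[symmetric])
      then show ?thesis using s by (simp add: power_le_one)
    next
      case False
      then have "s powi n * q ^ nat \<bar>n\<bar> = s ^ nat \<bar>n\<bar> * q ^ nat \<bar>n\<bar>" by (simp add: power_int_def)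
      also have "\<dots> \<le> 1" using s q by (intro mult_le_one power_le_one) auto
      finally show ?thesis .
    qed
    then have "1 / q * (s powi n * q ^ nat \<bar>n\<bar>) \<le> 1 / q * 1"
      using q by (intro mult_left_mono) auto
    moreover have "\<bar>?W (alt_tri_theta q) n\<bar> \<le> 1 / q * q ^ nat \<bar>n\<bar> * s powi n"
      unfolding abs_W abs_alt_tri_theta[OF q] using s by (intro mult_right_mono tri_theta_bound[OF q]) auto
    ultimately show ?thesis by (simp add: mult_ac)
  qed
  have W: "conv (?W u) (?W v) = ?W (conv u v)" for u v
    by (rule ext, rule conv_weighted) (use s in simp)
  have "conv (D_seq q) (alt_tri_theta q) M * s powi M
      = conv (conv (?W (F_seq q)) (?W (g_seq q))) (?W (alt_tri_theta q)) M"
    by (simp only: D_seq_def W)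
  also have "\<dots> = conv (?W (F_seq q)) (conv (?W (g_seq q)) (?W (alt_tri_theta q))) M"
    by (rule conv_assoc[OF sF sg bj])
  also have "\<dots> = conv (F_seq q) (conv (g_seq q) (alt_tri_theta q)) M * s powi M"
    by (simp only: W)
  finally show ?thesis using s(1) by simp
qed

text \<open>The product of F g with j is evaluated at -1 twice: as \<open>D_seq q 0\<close> times
  the alternating theta value times j(-1), and, with g j = k j(-z), as k F(z) j(-z), where the zero
  of j cancels the pole of \<open>F\<close>. Eliminating k by \<open>g_constant\<close> brings in
  the second factor j(-1).\<close>

lemma D_zero_relation:
  "D_seq q 0 * infsum (\<lambda>n. square_theta q n * (- 1) powi n) UNIV * (infsum (tri_theta q) UNIV)\<^sup>2
     = 4 * (infsum (tri_partial q) UNIV)\<^sup>2"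
proof -
  let ?j = "alt_tri_theta q" and ?k = "conv (alt_tri_theta q) (g_seq q) 0"
  let ?t = "\<lambda>u n. u n * (- 1) powi n"
  have D: "D_seq q = (\<lambda>N. D_seq q 0 * square_theta q N)"
    by (rule ext, subst D_eq[OF q]) (simp add: square_theta_def)
  have gj: "conv (g_seq q) ?j = (\<lambda>N. ?k * tri_theta q N)"
    by (rule ext, subst conv_comm, subst conv_alt_tri_theta_g[OF q]) simp
  have "?t (conv (D_seq q) ?j) M = ?k * conv ?j (?t (F_seq q)) M" for M
  proof -
    have "?t (conv (D_seq q) ?j) M = ?k * ?t (conv (F_seq q) (tri_theta q)) M"
      unfolding conv_D_alt_tri_theta gj
      by (simp add: conv_cmult_right)
    also have "?t (conv (F_seq q) (tri_theta q)) M = conv (?t (F_seq q)) ?j M"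
      by (subst conv_weighted[symmetric]) (simp_all add: alt_tri_theta_twist[abs_def])
    finally show ?thesis by (simp add: conv_comm)
  qed
  then have "infsum (?t (conv (D_seq q) ?j)) UNIV = ?k * infsum (conv ?j (?t (F_seq q))) UNIV"
    by (simp add: infsum_cmult_right')
  also have "infsum (conv ?j (?t (F_seq q))) UNIV = infsum (tri_partial q) UNIV * (2 - 0)"
    using F_bounded[OF q]
    by (intro infsum_conv_alt_tri_theta[OF q, of _ "2 / (1 - q)"] summable_F_alt_diff F_alt_limits)
      (auto simp: abs_mult powi_minus_one_odd_even)
  finally have r: "infsum (?t (conv (D_seq q) ?j)) UNIV = 2 * ?k * infsum (tri_partial q) UNIV" by simp
  note s = summable_alt_square_theta
  have "?t (conv (D_seq q) ?j) M = D_seq q 0 * conv (?t (square_theta q)) (tri_theta q) M" for M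
  proof -
    have "conv (D_seq q) ?j M = D_seq q 0 * conv (square_theta q) ?j M"
      by (subst D) (simp add: conv_cmult_left)
    moreover have "?t (conv (square_theta q) ?j) M = conv (?t (square_theta q)) (tri_theta q) M"
      by (subst conv_weighted[symmetric]) (simp_all add: alt_tri_theta_untwist[abs_def])
    ultimately show ?thesis by simp
  qed
  then have "infsum (?t (conv (D_seq q) ?j)) UNIV
      = D_seq q 0 * (infsum (?t (square_theta q)) UNIV * infsum (tri_theta q) UNIV)"
    by (simp add: infsum_cmult_right' summable_on_conv(2)[OF s summable_tri_theta[OF q]])
  with r have "D_seq q 0 * (infsum (?t (square_theta q)) UNIV * infsum (tri_theta q) UNIV)
      = 2 * ?k * infsum (tri_partial q) UNIV" by simp
  then have "D_seq q 0 * infsum (?t (square_theta q)) UNIV * (infsum (tri_theta q) UNIV)\<^sup>2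
      = 2 * infsum (tri_partial q) UNIV * (?k * infsum (tri_theta q) UNIV)"
    by (simp add: power2_eq_square mult_ac)
  then show ?thesis
    unfolding g_constant[OF q] by (simp add: power2_eq_square)
qed

end

section \<open>The Jacobi triple product\<close>

definition qfac :: "real \<Rightarrow> nat \<Rightarrow> real" where
  "qfac q m = (\<Prod>k<m. 1 - q * q ^ k)"

definition qbinom :: "real \<Rightarrow> nat \<Rightarrow> nat \<Rightarrow> real" where
  "qbinom q m i = qfac q m / (qfac q i * qfac q (m - i))"

text \<open>Indexed from the middle of row \<open>2 * n\<close>, so that every fixed
  \<open>j\<close> has a limit as \<open>n\<close> grows.\<close>

definition cqbinom :: "real \<Rightarrow> nat \<Rightarrow> int \<Rightarrow> real" where
  "cqbinom q n j = (if \<bar>j\<bar> \<le> int n then qbinom q (2 * n) (nat (int n + j)) else 0)"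

definition qprod :: "real \<Rightarrow> real \<Rightarrow> real" where
  "qprod x q = (\<Prod>k. 1 - x * q ^ k)"

lemma infsum_int_split:
  fixes f :: "int \<Rightarrow> real"
  assumes "f summable_on UNIV"
  shows "(\<lambda>k. f (int k) + f (- int k - 1)) sums infsum f UNIV"
proof -
  have A: "((\<lambda>k. f (int k)) has_sum infsum f (range int)) UNIV"
    using has_sum_infsum[OF summable_on_subset_banach[OF assms subset_UNIV, of "range int"]]
    by (subst (asm) has_sum_reindex) (auto simp: o_def)
  have B: "((\<lambda>k::nat. f (- int k - 1)) has_sum infsum f (range (\<lambda>k. - int k - 1))) UNIV"
    using has_sum_infsum[OF summable_on_subset_banach[OF assms subset_UNIV, of "range (\<lambda>k. - int k - 1)"]]
    by (subst (asm) has_sum_reindex) (auto simp: o_def inj_on_def)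
  have "range int \<union> range (\<lambda>k. - int k - 1) = UNIV"
  proof (intro set_eqI iffI UNIV_I)
    fix x :: int
    show "x \<in> range int \<union> range (\<lambda>k. - int k - 1)"
    proof (cases "x \<ge> 0")
      case False
      then have "x = - int (nat (- x - 1)) - 1" by simp
      then show ?thesis by blast
    qed (auto intro: range_eqI[of _ _ "nat x"])
  qed
  moreover have "infsum f (range int \<union> range (\<lambda>k. - int k - 1))
      = infsum f (range int) + infsum f (range (\<lambda>k. - int k - 1))"
    by (intro infsum_Un_disjoint summable_on_subset_banach[OF assms]) auto
  ultimately have "infsum f UNIV = infsum f (range int) + infsum f (range (\<lambda>k. - int k - 1))" by simp
  with has_sum_imp_sums[OF has_sum_add[OF A B]] show ?thesis by simp
qed

section \<open>The q-binomial theorem and its limit\<close>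

context
  fixes q :: real
  assumes q: "0 < q" "q < 1"
begin

lemma qpow_bounds: "0 < q * q ^ k" "q * q ^ k < 1"
  using q power_Suc_less_one[of q k] by auto

lemma qfac_pos: "qfac q m > 0"
  unfolding qfac_def using qpow_bounds by (intro prod_pos) auto

lemma qfac_Suc: "qfac q (Suc m) = qfac q m * (1 - q ^ Suc m)"
  by (simp add: qfac_def)

lemma qbinom_Suc:
  assumes "1 \<le> i" "i \<le> m"
  shows "qbinom q (Suc m) i = qbinom q m i + q ^ (Suc m - i) * qbinom q m (i - 1)"
proof -
  obtain a where i: "i = Suc a" using assms by (cases i) auto
  obtain b where m: "m = i + b" using assms le_Suc_ex by blast
  have e: "Suc m - i = Suc b" "m - i = b" "m - a = Suc b" using m i by auto
  define A B M x y where "A = qfac q a" "B = qfac q b" "M = qfac q m" "x = q ^ Suc a" "y = q ^ Suc b"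
  have nz: "A \<noteq> 0" "B \<noteq> 0" "1 - x \<noteq> 0" "1 - y \<noteq> 0"
    using qfac_pos[of a] qfac_pos[of b] qpow_bounds[of a] qpow_bounds[of b] by (auto simp: A_B_M_x_y_def)
  have "q ^ Suc m = x * y" by (simp add: A_B_M_x_y_def m i power_add[symmetric])
  then have "qbinom q (Suc m) i = M * (1 - x * y) / (A * (1 - x) * (B * (1 - y)))"
    unfolding qbinom_def e unfolding i qfac_Suc by (simp add: A_B_M_x_y_def)
  moreover have "qbinom q m i = M / (A * (1 - x) * B)"
    unfolding qbinom_def e unfolding i qfac_Suc by (simp add: A_B_M_x_y_def)
  moreover have "qbinom q m (i - 1) = M / (A * (B * (1 - y)))"
    unfolding qbinom_def i diff_Suc_1 e qfac_Suc by (simp add: A_B_M_x_y_def)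
  \<comment> \<open>Over the common denominator this reads
    \<open>1 - x * y = (1 - y) + y * (1 - x)\<close>.\<close>
  moreover have "M * (1 - x * y) / (A * (1 - x) * (B * (1 - y)))
      = M / (A * (1 - x) * B) + y * (M / (A * (B * (1 - y))))"
    using nz by (simp add: divide_simps) (simp add: algebra_simps)
  ultimately show ?thesis using e by (simp add: A_B_M_x_y_def)
qed

lemma qbinom_edge: "qbinom q m 0 = 1" "qbinom q m m = 1"
  using less_imp_neq[OF qfac_pos[of m]] by (auto simp: qbinom_def) (auto simp: qfac_def)

lemma choose_two_Suc: "Suc i * i div 2 = i * (i - 1) div 2 + (i :: nat)"
  by (cases i) (auto simp: algebra_simps)

lemma q_binomial_theorem:
  "(\<Prod>k<m. 1 - x * q ^ k) = (\<Sum>i\<le>m. qbinom q m i * (- 1) ^ i * q ^ (i * (i - 1) div 2) * x ^ i)"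
proof (induction m)
  case 0
  then show ?case by (simp add: qbinom_edge)
next
  case (Suc m)
  let ?t = "\<lambda>m i. qbinom q m i * (- 1) ^ i * q ^ (i * (i - 1) div 2) * x ^ i"
  have "(\<Prod>k<Suc m. 1 - x * q ^ k) = (\<Sum>i\<le>m. ?t m i) - (\<Sum>i\<le>m. x * q ^ m * ?t m i)"
    unfolding sum_distrib_left[symmetric] Suc[symmetric] by (simp add: algebra_simps)
  also have "(\<Sum>i\<le>m. ?t m i) = ?t m 0 + (\<Sum>i=1..m. ?t m i)"
    by (simp add: atMost_atLeast0 sum.atLeast_Suc_atMost)
  also have "(\<Sum>i\<le>m. x * q ^ m * ?t m i) = (\<Sum>i<m. x * q ^ m * ?t m i) + x * q ^ m * ?t m m"
    by (simp add: lessThan_Suc_atMost[symmetric])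
  also have "x * q ^ m * ?t m m = - ?t (Suc m) (Suc m)"
    unfolding qbinom_edge diff_Suc_1 choose_two_Suc by (simp add: power_add)
  also have "(\<Sum>i<m. x * q ^ m * ?t m i) = (\<Sum>i=1..m. x * q ^ m * ?t m (i - 1))"
    by (rule sum.reindex_bij_witness[of _ "\<lambda>i. i - 1" Suc]) auto
  also have "?t m 0 + (\<Sum>i=1..m. ?t m i)
      - ((\<Sum>i=1..m. x * q ^ m * ?t m (i - 1)) + - ?t (Suc m) (Suc m))
      = ?t m 0 + (\<Sum>i=1..m. ?t m i - x * q ^ m * ?t m (i - 1)) + ?t (Suc m) (Suc m)"
    by (simp add: sum_subtractf)
  also have "(\<Sum>i=1..m. ?t m i - x * q ^ m * ?t m (i - 1)) = (\<Sum>i=1..m. ?t (Suc m) i)"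
  proof (rule sum.cong)
    fix i assume i: "i \<in> {1..m}"
    then obtain a where a: "i = Suc a" by (cases i) auto
    have "q ^ m * q ^ (a * (a - 1) div 2) = q ^ (Suc m - i) * q ^ (i * (i - 1) div 2)"
      using i unfolding a diff_Suc_1 choose_two_Suc by (simp add: power_add[symmetric])
    then show "?t m i - x * q ^ m * ?t m (i - 1) = ?t (Suc m) i"
      using i by (subst qbinom_Suc) (auto simp: a algebra_simps)
  qed simp
  also have "?t m 0 = ?t (Suc m) 0" by (simp add: qbinom_edge)
  finally show ?case
    by (simp add: atMost_atLeast0 sum.atLeast_Suc_atMost del: mult_Suc mult_Suc_right)
qed

text \<open>The q-binomial theorem with \<open>2 * n\<close> factors and
  \<open>x = z * q powi (- int n)\<close>. The upper half of the factors is the product over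
  \<open>1 - z * q ^ k\<close>; from each factor of the lower half a monomial is pulled out to leave
  \<open>1 - q * q ^ k / z\<close>, and \<open>K n\<close> collects these monomials.\<close>

lemma finite_jacobi_triple_product:
  assumes "z \<noteq> 0"
  shows "(\<Prod>k<n. 1 - z * q ^ k) * (\<Prod>k<n. 1 - q * q ^ k / z)
     = (\<Sum>j = - int n..int n. cqbinom q n j * (alt_tri_theta q j * z powi j))"
proof -
  define x where "x = z * q powi (- int n)"
  define K where "K = (\<lambda>n. (- z) powi int n * q powi (- (int n * (int n + 1) div 2)))"
  have K0: "K n \<noteq> 0" using assms q by (simp add: K_def)
  have two: "2 * (m * (m + 1) div 2) = m * (m + 1)" "2 * (m * (m - 1) div 2) = m * (m - 1)" for m :: int
    by (auto intro: dvd_mult_div_cancel)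
  have P: "(\<Prod>k<m. 1 - z * q powi (- int (Suc k))) = K m * (\<Prod>k<m. 1 - q * q ^ k / z)" for m
  proof (induction m)
    case (Suc m)
    have "int (Suc m) * (int (Suc m) + 1) div 2 = int m * (int m + 1) div 2 + int (Suc m)"
      using two(1)[of "int m"] two(1)[of "int (Suc m)"] by (simp add: algebra_simps)
    then have "q powi (- (int (Suc m) * (int (Suc m) + 1) div 2))
        = q powi (- (int m * (int m + 1) div 2)) * q powi (- int (Suc m))"
      unfolding powi_mult[OF q] by simp
    then have "K (Suc m) = K m * (- z * q powi (- int (Suc m)))"
      unfolding K_def by (simp only: power_int_of_nat power_Suc mult_ac)
    moreover have "1 - z * q powi (- int (Suc m)) = - z * q powi (- int (Suc m)) * (1 - q * q ^ m / z)"
    proof -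
      have "q powi (- int (Suc m)) * (q * q ^ m) = 1"
        using powi_mult[OF q, of "- int (Suc m)" "int (Suc m)"] by (simp only: power_int_of_nat power_Suc) simp
      moreover have "1 - z * X = - z * X * (1 - Y / z)" if "X * Y = 1" for X Y
        using that assms by (simp add: field_simps)
      ultimately show ?thesis by blast
    qed
    ultimately show ?case using Suc by simp
  qed (simp add: K_def)
  have split: "(\<Prod>k<n + m. f k) = (\<Prod>k<n. f k) * (\<Prod>k<m. f (n + k))" for f :: "nat \<Rightarrow> real" and m
    by (induction m) (simp_all add: mult_ac)
  have "(\<Prod>k<2 * n. 1 - x * q ^ k) = (\<Prod>k<n. 1 - x * q ^ k) * (\<Prod>k<n. 1 - x * q ^ (n + k))"
    using split[of "\<lambda>k. 1 - x * q ^ k" n] by (simp add: mult_2)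
  also have "(\<Prod>k<n. 1 - x * q ^ (n + k)) = (\<Prod>k<n. 1 - z * q ^ k)"
    using q by (simp add: x_def power_int_minus power_add field_simps)
  also have "(\<Prod>k<n. 1 - x * q ^ k) = (\<Prod>k<n. 1 - x * q ^ (n - Suc k))"
    by (rule prod.nat_diff_reindex[symmetric])
  also have "\<dots> = (\<Prod>k<n. 1 - z * q powi (- int (Suc k)))"
  proof (rule prod.cong)
    fix k assume "k \<in> {..<n}"
    then have "q powi (- int n) * q ^ (n - Suc k) = q powi (- int (Suc k))"
    proof -
      have "- int n + int (n - Suc k) = - int (Suc k)" using \<open>k \<in> {..<n}\<close> by simp
      then show ?thesis
        using powi_mult[OF q, of "- int n" "int (n - Suc k)"] by (simp only: power_int_of_nat)
    qed
    then show "1 - x * q ^ (n - Suc k) = 1 - z * q powi (- int (Suc k))"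
      by (simp add: x_def mult.assoc del: of_nat_Suc)
  qed simp
  finally have L: "(\<Prod>k<2 * n. 1 - x * q ^ k)
      = K n * ((\<Prod>k<n. 1 - z * q ^ k) * (\<Prod>k<n. 1 - q * q ^ k / z))"
    unfolding P by (simp add: mult_ac)
  have "(\<Prod>k<2 * n. 1 - x * q ^ k)
      = (\<Sum>i\<le>2 * n. qbinom q (2 * n) i * (- 1) ^ i * q ^ (i * (i - 1) div 2) * x ^ i)"
    by (rule q_binomial_theorem)
  also have "\<dots> = (\<Sum>j = - int n..int n. K n * (cqbinom q n j * (alt_tri_theta q j * z powi j)))"
  proof (rule sum.reindex_bij_witness[of _ "\<lambda>j. nat (int n + j)" "\<lambda>i. int i - int n"])
    fix i assume i: "i \<in> {..2 * n}"
    define j where "j = int i - int n"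
    have ij: "int i = int n + j" by (simp add: j_def)
    have "int (i * (i - 1) div 2) = (int n + j) * (int n + j - 1) div 2"
      unfolding ij[symmetric] by (cases i) (simp_all add: zdiv_int algebra_simps)
    then have e: "int (i * (i - 1) div 2) + (- int n) * (int n + j)
        = - (int n * (int n + 1) div 2) + j * (j - 1) div 2"
      using two(1)[of "int n"] two(2)[of j] two(2)[of "int n + j"] by (simp add: algebra_simps)
    have "q ^ (i * (i - 1) div 2) * (q powi (- int n)) ^ i
        = q powi (int (i * (i - 1) div 2) + (- int n) * (int n + j))"
      unfolding powi_mult[OF q, symmetric] power_int_mult ij[symmetric] by (simp only: power_int_of_nat)
    also have "\<dots> = q powi (- (int n * (int n + 1) div 2)) * tri_theta q j"
      unfolding e powi_mult[OF q, symmetric] tri_theta_def ..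
    finally have Q: "q ^ (i * (i - 1) div 2) * (q powi (- int n)) ^ i
        = q powi (- (int n * (int n + 1) div 2)) * tri_theta q j" .
    have "(- 1) ^ i * z ^ i = (- z) powi int i" by (simp add: power_mult_distrib[symmetric])
    also have "\<dots> = (- z) powi int n * ((- 1) powi j * z powi j)"
      unfolding ij using assms by (simp add: power_int_add power_int_mult_distrib[symmetric])
    finally have Z: "(- 1) ^ i * z ^ i = (- z) powi int n * ((- 1) powi j * z powi j)" .
    have c: "cqbinom q n j = qbinom q (2 * n) i" using i by (simp add: cqbinom_def j_def)
    have eq: "qbinom q (2 * n) i * (- 1) ^ i * q ^ (i * (i - 1) div 2) * x ^ i
        = qbinom q (2 * n) i * ((- 1) ^ i * z ^ i) * (q ^ (i * (i - 1) div 2) * (q powi (- int n)) ^ i)"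
      by (simp only: x_def power_mult_distrib mult_ac)
    show "K n * (cqbinom q n (int i - int n) * (alt_tri_theta q (int i - int n) * z powi (int i - int n)))
        = qbinom q (2 * n) i * (- 1) ^ i * q ^ (i * (i - 1) div 2) * x ^ i"
      unfolding eq Q Z j_def[symmetric] c by (simp add: K_def alt_tri_theta_def mult_ac)
  qed auto
  finally show ?thesis
    unfolding L sum_distrib_left[symmetric] using K0 by simp
qed

lemma qprod_LIMSEQ: "(\<lambda>n. \<Prod>k<n. 1 - x * q ^ k) \<longlonglongrightarrow> qprod x q"
  and qprod_convergent: "convergent_prod (\<lambda>k. 1 - x * q ^ k)"
proof -
  have "summable (\<lambda>k. norm (- x * q ^ k))"
    using q by (simp add: abs_mult summable_mult)
  then have "abs_convergent_prod (\<lambda>k. 1 + - x * q ^ k)"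
    by (intro summable_imp_abs_convergent_prod) simp
  then show c: "convergent_prod (\<lambda>k. 1 - x * q ^ k)"
    using abs_convergent_prod_imp_convergent_prod by fastforce
  show "(\<lambda>n. \<Prod>k<n. 1 - x * q ^ k) \<longlonglongrightarrow> qprod x q"
    using convergent_prod_LIMSEQ[OF c] unfolding qprod_def LIMSEQ_lessThan_iff_atMost .
qed

lemma qprod_pos: assumes "x < 1" shows "qprod x q > 0"
proof -
  have lt: "x * q ^ k < 1" for k
  proof (cases "x \<le> 0")
    case True
    then have "x * q ^ k \<le> 0" using q by (simp add: mult_nonpos_nonneg)
    then show ?thesis by simp
  next
    case False
    then have "x * q ^ k \<le> x * 1" using q by (intro mult_left_mono power_le_one) auto
    then show ?thesis using assms by simp
  qed
  then have "1 - x * q ^ k \<noteq> 0" for k by (metis eq_iff_diff_eq_0 less_irrefl)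
  then have "qprod x q \<noteq> 0"
    unfolding qprod_def by (rule prodinf_nonzero[OF qprod_convergent])
  moreover have "qprod x q \<ge> 0"
    by (rule LIMSEQ_le_const[OF qprod_LIMSEQ]) (intro exI allI impI prod_nonneg, use lt in \<open>simp add: less_imp_le\<close>)
  ultimately show ?thesis by simp
qed

lemma qfac_LIMSEQ: "qfac q \<longlonglongrightarrow> qprod q q"
  using qprod_LIMSEQ[of q] by (simp add: qfac_def[abs_def])

lemma qfac_bounds: "qfac q m \<le> 1" "qprod q q \<le> qfac q m"
proof -
  show "qfac q m \<le> 1"
    unfolding qfac_def using qpow_bounds by (intro prod_le_1) (auto simp: less_imp_le)
  have "qfac q (Suc n) \<le> qfac q n" for n
    using qfac_pos[of n] qpow_bounds[of n] by (simp add: qfac_Suc mult_left_le)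
  then have "decseq (qfac q)" by (intro decseq_SucI)
  then show "qprod q q \<le> qfac q m" by (rule decseq_ge[OF _ qfac_LIMSEQ])
qed

lemma cqbinom_bound: "\<bar>cqbinom q n j\<bar> \<le> 1 / (qprod q q)\<^sup>2"
proof (cases "\<bar>j\<bar> \<le> int n")
  case True
  have E: "qprod q q > 0" using q by (intro qprod_pos)
  have "cqbinom q n j \<le> 1 / (qprod q q * qprod q q)"
    unfolding cqbinom_def qbinom_def using True E qfac_bounds qfac_pos
    by (auto intro!: frac_le mult_mono simp: less_imp_le)
  moreover have "cqbinom q n j \<ge> 0"
    unfolding cqbinom_def qbinom_def using qfac_pos by (auto simp: less_imp_le)
  ultimately show ?thesis by (simp add: power2_eq_square)
qed (simp add: cqbinom_def)

lemma cqbinom_LIMSEQ: "(\<lambda>n. cqbinom q n j) \<longlonglongrightarrow> 1 / qprod q q"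
proof -
  have E: "qprod q q \<noteq> 0" using qprod_pos[of q] q by simp
  have L: "(\<lambda>n. qfac q (nat (int n + j))) \<longlonglongrightarrow> qprod q q" for j
  proof (rule filterlim_compose[OF qfac_LIMSEQ])
    show "filterlim (\<lambda>n. nat (int n + j)) at_top sequentially"
      unfolding filterlim_at_top eventually_sequentially
    proof (intro allI exI impI)
      fix Z n assume "nat (int Z + \<bar>j\<bar>) \<le> n"
      then show "Z \<le> nat (int n + j)" by linarith
    qed
  qed
  have "(\<lambda>n. qfac q (2 * n) / (qfac q (nat (int n + j)) * qfac q (nat (int n - j))))
      \<longlonglongrightarrow> qprod q q / (qprod q q * qprod q q)"
  proof (intro tendsto_intros)
    show "(\<lambda>n. qfac q (nat (int n + j))) \<longlonglongrightarrow> qprod q q" "(\<lambda>n. qfac q (nat (int n - j))) \<longlonglongrightarrow> qprod q q"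
      using L[of j] L[of "- j"] by simp_all
    show "(\<lambda>n. qfac q (2 * n)) \<longlonglongrightarrow> qprod q q"
      using LIMSEQ_subseq_LIMSEQ[OF qfac_LIMSEQ, of "\<lambda>n. 2 * n"] by (simp add: strict_mono_def o_def)
  qed (use E in auto)
  moreover have "\<forall>\<^sub>F n in sequentially. qfac q (2 * n) / (qfac q (nat (int n + j)) * qfac q (nat (int n - j)))
      = cqbinom q n j"
    unfolding eventually_sequentially
  proof (intro exI allI impI)
    fix n assume "n \<ge> nat \<bar>j\<bar>"
    then have "\<bar>j\<bar> \<le> int n" "2 * n - nat (int n + j) = nat (int n - j)" by auto
    then show "qfac q (2 * n) / (qfac q (nat (int n + j)) * qfac q (nat (int n - j))) = cqbinom q n j"
      by (simp add: cqbinom_def qbinom_def)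
  qed
  ultimately show ?thesis using E by (simp add: tendsto_cong)
qed

text \<open>The coefficients are bounded uniformly in \<open>n\<close> and \<open>j\<close>, so
  Tannery's theorem takes the limit termwise. Pairing \<open>k\<close> with \<open>- k - 1\<close>
  turns the sum over the integers into a series.\<close>

lemma cqbinom_tannery:
  assumes b: "b summable_on UNIV"
  shows "(\<lambda>n. \<Sum>j = - int n..int n. cqbinom q n j * b j) \<longlonglongrightarrow> infsum b UNIV / qprod q q"
proof -
  let ?C = "1 / (qprod q q)\<^sup>2"
  have s: "(\<lambda>j. cqbinom q n j * b j) summable_on UNIV" for n
    using summable_on_mult_bounded[OF b, of "cqbinom q n" ?C] cqbinom_bound[of n]
    by (simp add: mult.commute)
  have fin: "infsum (\<lambda>j. cqbinom q n j * b j) UNIV = (\<Sum>j = - int n..int n. cqbinom q n j * b j)" for n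
  proof -
    have "infsum (\<lambda>j. cqbinom q n j * b j) UNIV = infsum (\<lambda>j. cqbinom q n j * b j) {- int n..int n}"
      by (rule infsum_cong_neutral) (auto simp: cqbinom_def)
    then show ?thesis by simp
  qed
  let ?a = "\<lambda>k n. cqbinom q n (int k) * b (int k) + cqbinom q n (- int k - 1) * b (- int k - 1)"
  let ?M = "\<lambda>k. ?C * (\<bar>b (int k)\<bar> + \<bar>b (- int k - 1)\<bar>)"
  have "((\<lambda>n. suminf (\<lambda>k. ?a k n)) \<longlonglongrightarrow>
      suminf (\<lambda>k. 1 / qprod q q * b (int k) + 1 / qprod q q * b (- int k - 1)))"
  proof (rule tannerys_theorem[THEN conjunct2, THEN conjunct2])
    show "(?a k \<longlongrightarrow> 1 / qprod q q * b (int k) + 1 / qprod q q * b (- int k - 1)) sequentially" for k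
      by (intro tendsto_intros cqbinom_LIMSEQ)
    show "\<forall>\<^sub>F (k, n) in at_top \<times>\<^sub>F sequentially. norm (?a k n) \<le> ?M k"
    proof (rule always_eventually, clarify)
      fix k n
      have "norm (?a k n) \<le> \<bar>cqbinom q n (int k)\<bar> * \<bar>b (int k)\<bar> + \<bar>cqbinom q n (- int k - 1)\<bar> * \<bar>b (- int k - 1)\<bar>"
        unfolding abs_mult[symmetric] real_norm_def by (rule abs_triangle_ineq)
      also have "\<dots> \<le> ?C * \<bar>b (int k)\<bar> + ?C * \<bar>b (- int k - 1)\<bar>"
        by (intro add_mono mult_right_mono cqbinom_bound) auto
      finally show "norm (?a k n) \<le> ?M k" by (simp add: distrib_left)
    qed
    show "summable ?M"
      using sums_summable[OF infsum_int_split[OF summable_on_abs_real[OF b]]] by (intro summable_mult)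
  qed simp
  moreover have "suminf (\<lambda>k. ?a k n) = (\<Sum>j = - int n..int n. cqbinom q n j * b j)" for n
    using sums_unique[OF infsum_int_split[OF s[of n]]] fin[of n] by simp
  moreover have "suminf (\<lambda>k. 1 / qprod q q * b (int k) + 1 / qprod q q * b (- int k - 1)) = infsum b UNIV / qprod q q"
    using sums_unique[OF sums_mult[OF infsum_int_split[OF b], of "1 / qprod q q"]] by (simp add: distrib_left)
  ultimately show ?thesis by simp
qed

lemma jacobi_triple_product:
  assumes "z \<noteq> 0" "(\<lambda>j. alt_tri_theta q j * z powi j) summable_on UNIV"
  shows "infsum (\<lambda>j. alt_tri_theta q j * z powi j) UNIV = qprod q q * qprod z q * qprod (q / z) q"
proof -
  have "(\<lambda>n. (\<Prod>k<n. 1 - z * q ^ k) * (\<Prod>k<n. 1 - (q / z) * q ^ k)) \<longlonglongrightarrow> qprod z q * qprod (q / z) q"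
    by (intro tendsto_intros qprod_LIMSEQ)
  moreover have "(\<lambda>n. (\<Prod>k<n. 1 - z * q ^ k) * (\<Prod>k<n. 1 - (q / z) * q ^ k))
      \<longlonglongrightarrow> infsum (\<lambda>j. alt_tri_theta q j * z powi j) UNIV / qprod q q"
    using cqbinom_tannery[OF assms(2)] finite_jacobi_triple_product[OF assms(1)] by simp
  ultimately have "infsum (\<lambda>j. alt_tri_theta q j * z powi j) UNIV / qprod q q = qprod z q * qprod (q / z) q"
    by (rule LIMSEQ_unique[rotated])
  then show ?thesis using qprod_pos[of q] q by (simp add: field_simps)
qed

end

section \<open>Special values: Jacobi's cube identity and Gauss' theta product\<close>

lemma summable_on_int_arith_geometric:
  assumes "0 \<le> (r::real)" "r < 1"
  shows "(\<lambda>n::int. \<bar>real_of_int n\<bar> * r ^ nat \<bar>n\<bar>) summable_on UNIV"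
proof -
  \<comment> \<open>One half of the decay, \<open>s ^ n\<close>, absorbs the linear factor; the
    other half stays geometric.\<close>
  define s where "s = sqrt r"
  have s: "0 \<le> s" "s < 1" "s ^ 2 = r" using assms by (auto simp: s_def real_less_lsqrt)
  have "(\<lambda>n. real n * s ^ n) \<longlonglongrightarrow> 0"
    using s by (intro powser_times_n_limit_0) auto
  then have "Bseq (\<lambda>n. real n * s ^ n)" by (rule convergent_imp_Bseq[OF convergentI])
  then obtain C where C: "C > 0" "\<And>n. norm (real n * s ^ n) \<le> C" unfolding Bseq_def by auto
  show ?thesis
  proof (rule summable_on_int_geometric[of s])
    fix n :: int
    have "real (nat \<bar>n\<bar>) * s ^ nat \<bar>n\<bar> \<le> C" using C(2)[of "nat \<bar>n\<bar>"] s by (simp add: abs_mult)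
    then have "\<bar>real_of_int n\<bar> * s ^ nat \<bar>n\<bar> * s ^ nat \<bar>n\<bar> \<le> C * s ^ nat \<bar>n\<bar>"
      using s by (intro mult_right_mono) auto
    moreover have "r ^ nat \<bar>n\<bar> = s ^ nat \<bar>n\<bar> * s ^ nat \<bar>n\<bar>"
      unfolding s(3)[symmetric] by (simp add: power2_eq_square power_mult_distrib)
    ultimately show "\<bar>\<bar>real_of_int n\<bar> * r ^ nat \<bar>n\<bar>\<bar> \<le> C * s ^ nat \<bar>n\<bar>"
      using assms by (simp add: abs_mult mult.assoc)
  qed (use s in auto)
qed

context
  fixes q :: real
  assumes q: "0 < q" "q < 1"
begin

lemma qprod_minus_one: "qprod (- 1) q = 2 * qprod (- q) q"
proof (rule LIMSEQ_unique)
  show "(\<lambda>n. \<Prod>k<Suc n. 1 - (- 1) * q ^ k) \<longlonglongrightarrow> qprod (- 1) q"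
    by (rule LIMSEQ_Suc[OF qprod_LIMSEQ[OF q]])
  have "(\<lambda>n. 2 * (\<Prod>k<n. 1 - (- q) * q ^ k)) \<longlonglongrightarrow> 2 * qprod (- q) q"
    by (intro tendsto_intros qprod_LIMSEQ[OF q])
  then show "(\<lambda>n. \<Prod>k<Suc n. 1 - (- 1) * q ^ k) \<longlonglongrightarrow> 2 * qprod (- q) q"
    by (simp only: prod.lessThan_Suc_shift) simp
qed

lemma infsum_tri_theta: "infsum (tri_theta q) UNIV = 2 * qprod q q * (qprod (- q) q)\<^sup>2"
proof -
  have e: "(\<lambda>j. alt_tri_theta q j * (- 1) powi j) = tri_theta q"
    using alt_tri_theta_untwist[of q] by auto
  have "infsum (\<lambda>j. alt_tri_theta q j * (- 1) powi j) UNIV = qprod q q * qprod (- 1) q * qprod (q / (- 1)) q"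
    by (intro jacobi_triple_product[OF q]) (simp_all add: e summable_tri_theta[OF q])
  then show ?thesis unfolding e by (simp add: qprod_minus_one power2_eq_square)
qed

text \<open>The factor with \<open>k = 0\<close> is \<open>1 - z\<close>, so by Caratheodory's
  criterion the derivative at 1 is minus the remaining product there. Differentiating the finite
  identity avoids differentiating an infinite sum.\<close>

lemma derivative_finite_triple_product:
  "(\<Sum>j = - int n..int n. cqbinom q n j * (alt_tri_theta q j * real_of_int j))
     = - ((\<Prod>k\<in>{1..<n}. 1 - q ^ k) * (\<Prod>k<n. 1 - q * q ^ k))" if "n > 0"
proof (rule DERIV_unique)
  define H where "H = (\<lambda>z::real. (\<Prod>k\<in>{1..<n}. 1 - z * q ^ k) * (\<Prod>k<n. 1 - q * q ^ k / z))"
  let ?L = "\<lambda>z::real. (\<Prod>k<n. 1 - z * q ^ k) * (\<Prod>k<n. 1 - q * q ^ k / z)"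
  let ?R = "\<lambda>z::real. \<Sum>j = - int n..int n. cqbinom q n j * (alt_tri_theta q j * z powi j)"
  have "((\<lambda>z. \<Sum>j = - int n..int n. cqbinom q n j * (alt_tri_theta q j * z powi j))
      has_real_derivative (\<Sum>j = - int n..int n. cqbinom q n j * (alt_tri_theta q j * (of_int j * 1 powi (j - 1) * 1)))) (at 1)"
    by (intro DERIV_sum DERIV_cmult DERIV_power_int DERIV_ident) auto
  then show "(?R has_real_derivative (\<Sum>j = - int n..int n. cqbinom q n j * (alt_tri_theta q j * real_of_int j))) (at 1)"
    by simp
  have H: "isCont H 1" unfolding H_def by (intro continuous_intros) auto
  have LH: "?L z = (1 - z) * H z" for z
  proof -
    have "{..<n} = insert 0 {1..<n}" using that by auto
    then show ?thesis by (simp add: H_def mult.assoc)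
  qed
  have "(?L has_real_derivative - H 1) (at 1)"
    unfolding LH CARAT_DERIV by (rule exI[of _ "\<lambda>z. - H z"]) (use H in \<open>auto simp: algebra_simps\<close>)
  moreover have "eventually (\<lambda>z. ?L z = ?R z) (nhds (1 :: real))"
  proof -
    have "eventually (\<lambda>z::real. z \<noteq> 0) (nhds 1)" by (rule t1_space_nhds) simp
    then show ?thesis by eventually_elim (rule finite_jacobi_triple_product[OF q])
  qed
  ultimately have "(?R has_real_derivative - H 1) (at 1)"
    using DERIV_cong_ev[of 1 1 ?L ?R "- H 1" "- H 1"] by simp
  then show "(?R has_real_derivative - ((\<Prod>k\<in>{1..<n}. 1 - q ^ k) * (\<Prod>k<n. 1 - q * q ^ k))) (at 1)"
    by (simp add: H_def)
qed

lemma summable_alt_tri_deriv: "(\<lambda>j. alt_tri_theta q j * real_of_int j) summable_on UNIV"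
proof (rule summable_on_if_abs_le)
  show "(\<lambda>j. 1 / q * (\<bar>real_of_int j\<bar> * q ^ nat \<bar>j\<bar>)) summable_on UNIV"
    using q by (intro summable_on_cmult_right summable_on_int_arith_geometric) auto
  show "\<bar>alt_tri_theta q j * real_of_int j\<bar> \<le> 1 / q * (\<bar>real_of_int j\<bar> * q ^ nat \<bar>j\<bar>)" for j
    using mult_right_mono[OF tri_theta_bound[OF q, of j], of "\<bar>real_of_int j\<bar>"]
    by (simp add: abs_mult abs_alt_tri_theta[OF q] mult_ac)
qed

text \<open>Jacobi's cube identity. Two of the three factors come from the products in the
  derivative, the third from the limit \<open>1 / qprod q q\<close> of the coefficients.\<close>

lemma infsum_alt_tri_deriv: "(\<Sum>\<^sub>\<infinity>j. alt_tri_theta q j * real_of_int j) = - (qprod q q ^ 3)"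
proof -
  have E: "qprod q q \<noteq> 0" using qprod_pos[OF q, of q] q by simp
  have "(\<lambda>n. \<Sum>j = - int n..int n. cqbinom q n j * (alt_tri_theta q j * real_of_int j))
      \<longlonglongrightarrow> (\<Sum>\<^sub>\<infinity>j. alt_tri_theta q j * real_of_int j) / qprod q q"
    by (rule cqbinom_tannery[OF q summable_alt_tri_deriv])
  then have "(\<lambda>n. \<Sum>j = - int (Suc n)..int (Suc n). cqbinom q (Suc n) j * (alt_tri_theta q j * real_of_int j))
      \<longlonglongrightarrow> (\<Sum>\<^sub>\<infinity>j. alt_tri_theta q j * real_of_int j) / qprod q q"
    by (rule LIMSEQ_Suc)
  moreover have "(\<Sum>j = - int (Suc n)..int (Suc n). cqbinom q (Suc n) j * (alt_tri_theta q j * real_of_int j))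
      = - (qfac q n * qfac q (Suc n))" for n
  proof -
    have "(\<Prod>k\<in>{1..<Suc n}. 1 - q ^ k) = qfac q n"
      unfolding qfac_def by (rule prod.reindex_bij_witness[of _ Suc "\<lambda>k. k - 1"]) (auto simp flip: power_Suc)
    then show ?thesis using derivative_finite_triple_product[of "Suc n"] by (simp only: qfac_def)
  qed
  moreover have "(\<lambda>n. - (qfac q n * qfac q (Suc n))) \<longlonglongrightarrow> - (qprod q q * qprod q q)"
    by (intro tendsto_intros qfac_LIMSEQ[OF q] LIMSEQ_Suc[OF qfac_LIMSEQ[OF q]])
  ultimately have "(\<Sum>\<^sub>\<infinity>j. alt_tri_theta q j * real_of_int j) / qprod q q = - (qprod q q * qprod q q)"
    by (metis (no_types, lifting) LIMSEQ_unique ext)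
  then show ?thesis using E by (simp add: field_simps power3_eq_cube)
qed

text \<open>The value of j(z)/(1 - z) at 1 is - j'(1); in coefficients this is summation by parts
  against \<open>n\<close>.\<close>

lemma infsum_tri_partial: "infsum (tri_partial q) UNIV = (qprod q q) ^ 3"
proof -
  let ?J = "tri_partial q"
  let ?C = "1 / q / (1 - q)"
  have sJ: "(\<lambda>n. ?J n * real_of_int n) summable_on UNIV"
  proof (rule summable_on_if_abs_le)
    show "(\<lambda>j. ?C * (\<bar>real_of_int j\<bar> * q ^ nat \<bar>j\<bar>)) summable_on UNIV"
      using q by (intro summable_on_cmult_right summable_on_int_arith_geometric) auto
    show "\<bar>?J j * real_of_int j\<bar> \<le> ?C * (\<bar>real_of_int j\<bar> * q ^ nat \<bar>j\<bar>)" for j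
      using mult_right_mono[OF tri_partial_bound[OF q, of j], of "\<bar>real_of_int j\<bar>"]
      by (simp add: abs_mult mult_ac)
  qed
  have sJ1: "(\<lambda>n. ?J n * real_of_int (n + 1)) summable_on UNIV"
    using summable_on_add[OF sJ summable_tri_partial[OF q]] by (simp add: algebra_simps)
  have sh: "(\<lambda>n. ?J (n - 1) * real_of_int n) summable_on UNIV"
    using summable_on_int_shift[of "\<lambda>n. ?J n * real_of_int (n + 1)" "- 1"] sJ1 by simp
  have "(\<Sum>\<^sub>\<infinity>j. alt_tri_theta q j * real_of_int j)
      = (\<Sum>\<^sub>\<infinity>j. ?J j * real_of_int j - ?J (j - 1) * real_of_int j)"
    by (intro infsum_cong) (simp flip: tri_partial_diff[OF q] add: algebra_simps)
  also have "\<dots> = (\<Sum>\<^sub>\<infinity>j. ?J j * real_of_int j) - (\<Sum>\<^sub>\<infinity>j. ?J (j - 1) * real_of_int j)"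
    by (rule infsum_diff_real[OF sJ sh])
  also have "(\<Sum>\<^sub>\<infinity>j. ?J (j - 1) * real_of_int j) = (\<Sum>\<^sub>\<infinity>j. ?J j * real_of_int (j + 1))"
    using infsum_int_shift[of "\<lambda>n. ?J n * real_of_int (n + 1)" "- 1"] by simp
  also have "(\<Sum>\<^sub>\<infinity>j. ?J j * real_of_int j) - \<dots> = (\<Sum>\<^sub>\<infinity>j. ?J j * real_of_int j - ?J j * real_of_int (j + 1))"
    by (rule infsum_diff_real[OF sJ sJ1, symmetric])
  also have "\<dots> = - infsum ?J UNIV"
    by (simp add: algebra_simps infsum_uminus)
  finally show ?thesis using infsum_alt_tri_deriv by simp
qed

lemma qprod_double: "qprod q q * qprod (- q) q = qprod (q\<^sup>2) (q\<^sup>2)"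
proof (rule LIMSEQ_unique)
  have q2: "0 < q\<^sup>2" "q\<^sup>2 < 1" using q by (auto simp: power_less_one_iff)
  show "(\<lambda>n. \<Prod>k<n. 1 - q\<^sup>2 * (q\<^sup>2) ^ k) \<longlonglongrightarrow> qprod (q\<^sup>2) (q\<^sup>2)"
    by (rule qprod_LIMSEQ[OF q2])
  have "(\<lambda>n. (\<Prod>k<n. 1 - q * q ^ k) * (\<Prod>k<n. 1 - (- q) * q ^ k)) \<longlonglongrightarrow> qprod q q * qprod (- q) q"
    by (intro tendsto_intros qprod_LIMSEQ[OF q])
  then show "(\<lambda>n. \<Prod>k<n. 1 - q\<^sup>2 * (q\<^sup>2) ^ k) \<longlonglongrightarrow> qprod q q * qprod (- q) q"
    by (simp add: prod.distrib[symmetric] algebra_simps power2_eq_square power_mult_distrib)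
qed

lemma qprod_even_odd: "qprod q q = qprod q (q\<^sup>2) * qprod (q\<^sup>2) (q\<^sup>2)"
proof (rule LIMSEQ_unique)
  have q2: "0 < q\<^sup>2" "q\<^sup>2 < 1" using q by (auto simp: power_less_one_iff)
  show "(\<lambda>n. \<Prod>k<2 * n. 1 - q * q ^ k) \<longlonglongrightarrow> qprod q q"
    using LIMSEQ_subseq_LIMSEQ[OF qprod_LIMSEQ[OF q, of q], of "\<lambda>n. 2 * n"] by (simp add: strict_mono_def o_def)
  have "(\<lambda>n. (\<Prod>k<n. 1 - q * (q\<^sup>2) ^ k) * (\<Prod>k<n. 1 - q\<^sup>2 * (q\<^sup>2) ^ k)) \<longlonglongrightarrow> qprod q (q\<^sup>2) * qprod (q\<^sup>2) (q\<^sup>2)"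
    by (intro tendsto_intros qprod_LIMSEQ[OF q2])
  moreover have "(\<Prod>k<n. 1 - q * (q\<^sup>2) ^ k) * (\<Prod>k<n. 1 - q\<^sup>2 * (q\<^sup>2) ^ k) = (\<Prod>k<2 * n. 1 - q * q ^ k)" for n
  proof (induction n)
    case (Suc n)
    have e: "(q\<^sup>2) ^ n = q ^ (2 * n)" "2 * Suc n = Suc (Suc (2 * n))" by (simp_all add: power_mult)
    show ?case
      unfolding e(2) prod.lessThan_Suc Suc.IH[symmetric] e(1) by (simp add: power2_eq_square mult_ac)
  qed simp
  ultimately show "(\<lambda>n. \<Prod>k<2 * n. 1 - q * q ^ k) \<longlonglongrightarrow> qprod q (q\<^sup>2) * qprod (q\<^sup>2) (q\<^sup>2)" by simp
qed


text \<open>The triple product with base \<open>q\<^sup>2\<close> at \<open>z = q\<close>, where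
  both variable factors become \<open>qprod q (q\<^sup>2)\<close>. Euler's identity then makes this
  the inverse of \<open>qprod (- q) q\<close>.\<close>

lemma gauss_theta_product:
  "(\<Sum>\<^sub>\<infinity>n. square_theta q n * (- 1) powi n) = qprod q q / qprod (- q) q"
proof -
  have q2: "0 < q\<^sup>2" "q\<^sup>2 < 1" using q by (auto simp: power_less_one_iff)
  have e: "alt_tri_theta (q\<^sup>2) j * q powi j = square_theta q j * (- 1) powi j" for j
  proof -
    have "(q\<^sup>2) powi m = q powi (2 * m)" for m
      by (simp add: power_int_mult)
    then have "(q\<^sup>2) powi (j * (j - 1) div 2) = q powi (2 * (j * (j - 1) div 2))" .
    also have "2 * (j * (j - 1) div 2) = j * (j - 1)"
      by (intro dvd_mult_div_cancel) simp
    finally have "(q\<^sup>2) powi (j * (j - 1) div 2) * q powi j = q powi (j\<^sup>2)"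
      using powi_mult[OF q, of "j * (j - 1)" j] by (simp add: power2_eq_square algebra_simps)
    then show ?thesis
      by (simp add: alt_tri_theta_def tri_theta_def square_theta_def mult_ac)
  qed
  note s = summable_alt_square_theta[OF q]
  have "(\<Sum>\<^sub>\<infinity>j. alt_tri_theta (q\<^sup>2) j * q powi j) = qprod (q\<^sup>2) (q\<^sup>2) * qprod q (q\<^sup>2) * qprod (q\<^sup>2 / q) (q\<^sup>2)"
    by (rule jacobi_triple_product[OF q2]) (use q s in \<open>simp_all add: e\<close>)
  moreover have "q\<^sup>2 / q = q" by (simp add: power2_eq_square)
  ultimately have "(\<Sum>\<^sub>\<infinity>n. square_theta q n * (- 1) powi n) = qprod q q * qprod q (q\<^sup>2)"
    unfolding e qprod_even_odd by (simp add: mult_ac)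
  moreover have "qprod q (q\<^sup>2) * qprod (- q) q = 1"
    using qprod_even_odd qprod_double qprod_pos[OF q2, of "q\<^sup>2"] q2
    by (smt (verit) mult.assoc mult.commute mult_cancel_right1 mult.right_neutral)
  moreover have "qprod (- q) q \<noteq> 0" using qprod_pos[OF q, of "- q"] q by simp
  ultimately show ?thesis by (simp add: field_simps)
qed

theorem D_zero_eq_theta_cube: "D_seq q 0 = (\<Sum>\<^sub>\<infinity>n. square_theta q n * (- 1) powi n) ^ 3"
proof -
  define E Q where "E = qprod q q" "Q = qprod (- q) q"
  have nz: "E \<noteq> 0" "Q \<noteq> 0"
    using qprod_pos[OF q, of q] qprod_pos[OF q, of "- q"] q by (auto simp: E_Q_def)
  have "D_seq q 0 * (E / Q) * (2 * E * Q\<^sup>2)\<^sup>2 = 4 * (E ^ 3)\<^sup>2"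
    using D_zero_relation[OF q] unfolding gauss_theta_product infsum_tri_theta infsum_tri_partial E_Q_def .
  then have "D_seq q 0 = (E / Q) ^ 3"
    using nz by (simp add: field_simps power2_eq_square power3_eq_cube)
  then show ?thesis unfolding gauss_theta_product by (simp add: E_Q_def)
qed

end

section \<open>Comparison of coefficients\<close>

lemma has_sum_imp_power_sums:
  fixes c :: "'a \<Rightarrow> real" and e :: "'a \<Rightarrow> nat"
  assumes "((\<lambda>i. c i * q ^ e i) has_sum S) I" and fin: "\<And>m. finite {i \<in> I. e i = m}"
  shows "(\<lambda>m. (\<Sum>i | i \<in> I \<and> e i = m. c i) * q ^ m) sums S"
proof -
  have "((\<lambda>x. c (snd x) * q ^ fst x) has_sum S) (Sigma UNIV (\<lambda>m. {i \<in> I. e i = m}))"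
    using assms(1)
    by (subst has_sum_reindex_bij_witness[of _ "\<lambda>i. (e i, i)" snd I "\<lambda>i. c i * q ^ e i" _ S S]) auto
  then have "((\<lambda>m. \<Sum>i\<in>{i \<in> I. e i = m}. c i * q ^ m) has_sum S) UNIV"
    by (rule has_sum_SigmaD) (use fin in \<open>auto intro!: has_sum_finite\<close>)
  then have "((\<lambda>m. (\<Sum>i | i \<in> I \<and> e i = m. c i) * q ^ m) has_sum S) UNIV"
    by (simp add: sum_distrib_right)
  then show ?thesis by (rule has_sum_imp_sums)
qed

text \<open>Once the lower coefficients vanish, division by \<open>q ^ m\<close> leaves a continuous
  function whose limit at 0 from the right is \<open>c m\<close>; positive real \<open>q\<close> are
  enough for that.\<close>

lemma power_series_zero_on_unit_interval:
  fixes c :: "nat \<Rightarrow> real"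
  assumes "\<And>q. 0 < q \<Longrightarrow> q < 1 \<Longrightarrow> (\<lambda>m. c m * q ^ m) sums 0"
  shows "c m = 0"
proof (induction m rule: less_induct)
  case (less m)
  have s: "(\<lambda>k. c (k + m) * q ^ k) sums 0" if "0 < q" "q < 1" for q
  proof -
    have "(\<lambda>k. c (k + m) * q ^ (k + m)) sums (0 - (\<Sum>k<m. c k * q ^ k))"
      by (rule sums_split_initial_segment[OF assms[OF that]])
    then have "(\<lambda>k. c (k + m) * q ^ (k + m)) sums 0" using less by simp
    from sums_mult[OF this, of "1 / q ^ m"] that show ?thesis by (simp add: power_add)
  qed
  have "isCont (\<lambda>q. \<Sum>k. c (k + m) * q ^ k) 0"
    by (rule isCont_powser[of _ "1/2"]) (use s[of "1/2"] sums_summable in auto)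
  then have "(\<lambda>q. \<Sum>k. c (k + m) * q ^ k) \<midarrow>0\<rightarrow> c m" by (simp add: isCont_def powser_zero)
  then have "((\<lambda>q. \<Sum>k. c (k + m) * q ^ k) \<longlongrightarrow> c m) (at_right 0)"
    by (rule filterlim_at_split[THEN iffD1, THEN conjunct2])
  moreover have "eventually (\<lambda>q. (\<Sum>k. c (k + m) * q ^ k) = 0) (at_right (0::real))"
    unfolding eventually_at_right_field
    by (intro exI[of _ 1]) (use s in \<open>auto simp: sums_iff\<close>)
  ultimately have "((\<lambda>q. 0 :: real) \<longlongrightarrow> c m) (at_right (0::real))"
    by (rule Lim_transform_eventually)
  from tendsto_unique[OF _ this tendsto_const] show ?case by simp
qed

lemma power_series_unique_on_unit_interval:
  fixes c d :: "nat \<Rightarrow> real"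
  assumes "\<And>q. 0 < q \<Longrightarrow> q < 1 \<Longrightarrow> \<exists>S. (\<lambda>m. c m * q ^ m) sums S \<and> (\<lambda>m. d m * q ^ m) sums S"
  shows "c m = d m"
proof -
  have "c m - d m = 0"
  proof (rule power_series_zero_on_unit_interval[of "\<lambda>m. c m - d m"])
    fix q :: real assume "0 < q" "q < 1"
    from assms[OF this] obtain S where "(\<lambda>m. c m * q ^ m) sums S" "(\<lambda>m. d m * q ^ m) sums S" by blast
    from sums_diff[OF this] show "(\<lambda>m. (c m - d m) * q ^ m) sums 0" by (simp add: left_diff_distrib)
  qed
  then show ?thesis by simp
qed

section \<open>Sums over triples and the constant term of F g\<close>

type_synonym itriple = "int \<times> int \<times> int"

fun e2 :: "itriple \<Rightarrow> int" where "e2 (a, b, c) = a * b + b * c + c * a"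

fun tsign :: "itriple \<Rightarrow> real" where "tsign (a, b, c) = (- 1) powi (a + b + c)"

definition pos_triples :: "itriple set" where
  "pos_triples = {(a, b, c). a > 0 \<and> b > 0 \<and> c > 0}"

definition rim_triples :: "itriple set" where
  "rim_triples = {(a, b, c). a > 0 \<and> b > 0 \<and> c = 0}"

text \<open>The last three conditions allow at most one zero entry, which keeps \<open>e2\<close>
  positive and its fibres finite.\<close>

definition nonneg_triples :: "itriple set" where
  "nonneg_triples = {(a, b, c). a \<ge> 0 \<and> b \<ge> 0 \<and> c \<ge> 0
      \<and> (a > 0 \<or> b > 0) \<and> (b > 0 \<or> c > 0) \<and> (a > 0 \<or> c > 0)}"

lemma triples_subset: "pos_triples \<subseteq> nonneg_triples" "rim_triples \<subseteq> nonneg_triples"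
  by (auto simp: pos_triples_def rim_triples_def nonneg_triples_def)

text \<open>For positive integers x + y is at most 2xy; this is applied to the pairs of nonzero
  entries. The linear bound serves both summability and finiteness of the fibres.\<close>

lemma e2_ge: "(a, b, c) \<in> nonneg_triples \<Longrightarrow> a + b + c \<le> 2 * e2 (a, b, c)"
proof -
  assume "(a, b, c) \<in> nonneg_triples"
  then have h: "a \<ge> 0" "b \<ge> 0" "c \<ge> 0" "a > 0 \<or> b > 0" "b > 0 \<or> c > 0" "a > 0 \<or> c > 0"
    by (auto simp: nonneg_triples_def)
  have two: "x + y \<le> 2 * (x * y)" if "x > 0" "y > 0" for x y :: int
  proof -
    have "0 \<le> x * (y - 1) + y * (x - 1)" using that by (intro add_nonneg_nonneg mult_nonneg_nonneg) auto
    moreover have "\<dots> = 2 * (x * y) - (x + y)" by (simp add: algebra_simps)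
    ultimately show ?thesis by linarith
  qed
  consider "a > 0" "b > 0" "c > 0" | "a = 0" | "b = 0" | "c = 0" using h by linarith
  then show ?thesis
  proof cases
    case 1
    then show ?thesis using two[of a b] two[of b c] two[of c a] by simp
  qed (use h two[of b c] two[of c a] two[of a b] in auto)
qed

definition tfam :: "real \<Rightarrow> itriple \<Rightarrow> real" where "tfam q t = tsign t * q powi e2 t"

context
  fixes q :: real
  assumes q: "0 < q" "q < 1"
begin

lemma summable_tfam: "tfam q summable_on nonneg_triples"
proof -
  \<comment> \<open>The square root absorbs the factor 2 in \<open>e2_ge\<close>, so that
    \<open>q powi e2 t\<close> is at most \<open>s powi (a + b + c)\<close>.\<close>
  define s where "s = sqrt q"
  have s: "0 < s" "s < 1" "s ^ 2 = q" using q by (auto simp: s_def real_less_lsqrt)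
  let ?g = "\<lambda>n::int. s ^ nat \<bar>n\<bar>"
  have g: "?g summable_on UNIV"
    by (rule summable_on_int_geometric[of s _ 1]) (use s in auto)
  have "(\<lambda>(n, k). ?g n * (case k of (k, l) \<Rightarrow> ?g k * ?g l)) summable_on UNIV \<times> (UNIV \<times> UNIV)"
    by (rule summable_on_Times_mult[OF g summable_on_Times_mult[OF g g]])
  then have "(\<lambda>(n, k). ?g n * (case k of (k, l) \<Rightarrow> ?g k * ?g l)) summable_on nonneg_triples"
    by (rule summable_on_subset_banach) auto
  then show ?thesis
  proof (rule summable_on_if_abs_le)
    fix t assume t: "t \<in> nonneg_triples"
    obtain a b c where abc: "t = (a, b, c)" by (cases t) auto
    have nn: "a \<ge> 0" "b \<ge> 0" "c \<ge> 0" using t abc by (auto simp: nonneg_triples_def)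
    have le: "a + b + c \<le> 2 * e2 t" using e2_ge[of a b c] t abc by simp
    have "q powi e2 t = (s powi 2) powi e2 t" using s by simp
    also have "\<dots> = s powi (2 * e2 t)" by (rule power_int_mult[symmetric])
    also have "\<dots> \<le> s powi (a + b + c)" using le s by (intro power_int_decreasing) auto
    also have "\<dots> = ?g a * (?g b * ?g c)"
      using nn s by (simp add: power_int_def nat_add_distrib power_add)
    finally have "q powi e2 t \<le> ?g a * (?g b * ?g c)" .
    moreover have "\<bar>tfam q t\<bar> = q powi e2 t"
      using q by (simp add: tfam_def abs_mult abc powi_minus_one_odd_even)
    ultimately show "\<bar>tfam q t\<bar> \<le> (case t of (n, k) \<Rightarrow> ?g n * (case k of (k, l) \<Rightarrow> ?g k * ?g l))"
      by (simp add: abc)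
  qed
qed

lemma infsum_nonneg_triples:
  "infsum (tfam q) nonneg_triples = infsum (tfam q) pos_triples + 3 * infsum (tfam q) rim_triples"
proof -
  let ?A = "{(a, b, c). a = 0 \<and> b > 0 \<and> c > 0} :: itriple set"
  let ?B = "{(a, b, c). a > 0 \<and> b = 0 \<and> c > 0} :: itriple set"
  have N: "nonneg_triples = pos_triples \<union> (rim_triples \<union> (?A \<union> ?B))"
    by (auto simp: pos_triples_def rim_triples_def nonneg_triples_def)
  have sub: "tfam q summable_on X" if "X \<subseteq> nonneg_triples" for X
    by (rule summable_on_subset_banach[OF summable_tfam that])
  have U: "infsum (tfam q) (X \<union> Y) = infsum (tfam q) X + infsum (tfam q) Y"
    if "X \<inter> Y = {}" "X \<union> Y \<subseteq> nonneg_triples" for X Y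
    by (intro infsum_Un_disjoint sub) (use that in auto)
  have "infsum (tfam q) nonneg_triples = infsum (tfam q) pos_triples + infsum (tfam q) (rim_triples \<union> (?A \<union> ?B))"
    unfolding N by (rule U) (unfold N, auto simp: pos_triples_def rim_triples_def)
  moreover have "infsum (tfam q) (rim_triples \<union> (?A \<union> ?B)) = infsum (tfam q) rim_triples + infsum (tfam q) (?A \<union> ?B)"
    by (rule U) (unfold N, auto simp: rim_triples_def)
  moreover have "infsum (tfam q) (?A \<union> ?B) = infsum (tfam q) ?A + infsum (tfam q) ?B"
    by (rule U) (unfold N, auto)
  moreover have "infsum (tfam q) ?A = infsum (tfam q) rim_triples"
    by (rule infsum_reindex_bij_witness[of _ "\<lambda>(a, b, c). (c, a, b)" "\<lambda>(a, b, c). (b, c, a)"])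
      (auto simp: rim_triples_def tfam_def ac_simps)
  moreover have "infsum (tfam q) ?B = infsum (tfam q) rim_triples"
    by (rule infsum_reindex_bij_witness[of _ "\<lambda>(a, b, c). (b, c, a)" "\<lambda>(a, b, c). (c, a, b)"])
      (auto simp: rim_triples_def tfam_def ac_simps)
  ultimately show ?thesis by linarith
qed

lemma has_sum_alternating_geometric:
  assumes "n > 0"
  shows "((\<lambda>m. (- 1) powi m * q powi (n * m)) has_sum - (q powi n / (1 + q powi n))) {0<..}"
    and "((\<lambda>m. (- 1) powi m * q powi (n * \<bar>m\<bar>)) has_sum (1 - q powi n) / (1 + q powi n)) UNIV"
proof -
  define x where "x = q powi n"
  have x: "0 < x" "x < 1"
    using q assms power_int_strict_decreasing[of 0 n q] by (auto simp: x_def)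
  have e: "(- 1) powi m * q powi (n * m) = (- x) powi m" for m
    using power_int_mult_distrib[of "- 1" "q powi n" m] by (simp add: x_def power_int_mult)
  have "((\<lambda>m::nat. (- x) ^ m) has_sum (- x / (1 - (- x)))) {1..}"
    by (rule has_sum_geometric_from_1) (use x in simp)
  also have "?this \<longleftrightarrow> ((\<lambda>m::int. (- x) powi m) has_sum (- (x / (1 + x)))) {0<..}"
    by (rule has_sum_reindex_bij_witness[of _ nat int]) auto
  finally have p: "((\<lambda>m::int. (- x) powi m) has_sum (- (x / (1 + x)))) {0<..}" .
  then show "((\<lambda>m. (- 1) powi m * q powi (n * m)) has_sum - (q powi n / (1 + q powi n))) {0<..}"
    unfolding e by (simp add: x_def)
  have A: "((\<lambda>m. (- 1) powi m * q powi (n * \<bar>m\<bar>)) has_sum - (x / (1 + x))) {0<..}"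
    using p by (subst has_sum_cong[where g = "\<lambda>m. (- x) powi m"]) (auto simp: e)
  have B: "((\<lambda>m. (- 1) powi m * q powi (n * \<bar>m\<bar>)) has_sum - (x / (1 + x))) {..<0}"
    by (subst has_sum_reindex_bij_witness[of _ uminus uminus "{0<..}" "\<lambda>m. (- 1) powi m * q powi (n * \<bar>m\<bar>)" _ _ "- (x / (1 + x))"])
      (use A in \<open>auto simp: powi_minus_one_odd_even\<close>)
  have C: "((\<lambda>m. (- 1) powi m * q powi (n * \<bar>m\<bar>)) has_sum 1) {0}"
    using has_sum_finite[of "{0}" "\<lambda>m. (- 1) powi m * q powi (n * \<bar>m\<bar>)"] by simp
  have "((\<lambda>m. (- 1) powi m * q powi (n * \<bar>m\<bar>)) has_sum (- (x / (1 + x)) + (- (x / (1 + x)) + 1))) ({0<..} \<union> ({..<0} \<union> {0}))"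
    by (intro has_sum_Un_disjoint A B C) auto
  moreover have "{0<..} \<union> ({..<0} \<union> {0}) = (UNIV :: int set)" by auto
  moreover have "- (x / (1 + x)) + (- (x / (1 + x)) + 1) = (1 - x) / (1 + x)" using x by (simp add: field_simps)
  ultimately show "((\<lambda>m. (- 1) powi m * q powi (n * \<bar>m\<bar>)) has_sum (1 - q powi n) / (1 + q powi n)) UNIV"
    unfolding x_def by simp
qed

end

context
  fixes q :: real
  assumes q: "0 < q" "q < 1"
begin

lemma summable_tfam_subset: "X \<subseteq> nonneg_triples \<Longrightarrow> tfam q summable_on X"
  by (rule summable_on_subset_banach[OF summable_tfam[OF q]])

lemma rim_sum:
  "(\<lambda>n. (- 1) powi n * - (q powi n / (1 + q powi n))) summable_on {0<..}"
  "infsum (tfam q) rim_triples = (\<Sum>\<^sub>\<infinity>n\<in>{0<..}. (- 1) powi n * - (q powi n / (1 + q powi n)))"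
proof -
  let ?f = "\<lambda>(n, m). (- 1) powi n * ((- 1) powi m * q powi (n * m))"
  have pow: "(- 1 :: real) powi (a + b) = (- 1) powi a * (- 1) powi b" for a b :: int
    by (simp add: power_int_add)
  have s: "?f summable_on {0<..} \<times> {0<..}"
    by (subst summable_on_reindex_bij_witness[of _ "\<lambda>(a, b, c). (a, b)" "\<lambda>(a, b). (a, b, 0)" rim_triples "tfam q"])
      (use summable_tfam_subset[OF triples_subset(2)] in \<open>auto simp: rim_triples_def tfam_def pow\<close>)
  have e: "infsum ?f ({0<..} \<times> {0<..}) = infsum (tfam q) rim_triples"
    by (rule infsum_reindex_bij_witness[of _ "\<lambda>(a, b, c). (a, b)" "\<lambda>(a, b). (a, b, 0)"])
      (auto simp: rim_triples_def tfam_def pow)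
  have inner: "(\<Sum>\<^sub>\<infinity>m\<in>{0<..}. ?f (n, m)) = (- 1) powi n * - (q powi n / (1 + q powi n))" if "n > 0" for n
    using infsumI[OF has_sum_alternating_geometric(1)[OF q that]] by (simp add: infsum_cmult_right')
  show "(\<lambda>n. (- 1) powi n * - (q powi n / (1 + q powi n))) summable_on {0<..}"
    using summable_on_Sigma_banach[OF s] inner
    by (subst summable_on_cong[where g = "\<lambda>n. \<Sum>\<^sub>\<infinity>m\<in>{0<..}. ?f (n, m)"]) auto
  show "infsum (tfam q) rim_triples = (\<Sum>\<^sub>\<infinity>n\<in>{0<..}. (- 1) powi n * - (q powi n / (1 + q powi n)))"
    unfolding e[symmetric] infsum_Sigma_banach[OF s, symmetric]
    by (rule infsum_cong) (use inner in auto)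
qed

text \<open>The substitution \<open>n = min a b + c\<close>, \<open>k = b - a\<close>,
  \<open>c = \<bar>j\<bar>\<close> turns \<open>e2 (a, b, c)\<close> into n^2 - j^2 + n|k|. Summing
  over \<open>k\<close> and \<open>j\<close> gives the rational factor and
  \<open>- F_seq q (- n)\<close>. Nonzero \<open>j\<close> of either sign yields each positive
  triple once, and \<open>j = 0\<close> yields the rim, whence the weights 2 and 1.\<close>

lemma hecke_sum:
  "(\<lambda>n. - F_seq q (- n) * ((1 - q powi n) / (1 + q powi n))) summable_on {0<..}"
  "(\<Sum>\<^sub>\<infinity>n\<in>{0<..}. - F_seq q (- n) * ((1 - q powi n) / (1 + q powi n)))
     = 2 * infsum (tfam q) pos_triples + infsum (tfam q) rim_triples"
proof -
  let ?u = "\<lambda>n j. (- 1) powi j * q powi (n\<^sup>2 - j\<^sup>2)"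
  let ?v = "\<lambda>n k. (- 1) powi k * q powi (n * \<bar>k\<bar>)"
  let ?f = "\<lambda>(n, j, k). ?u n j * ?v n k"
  let ?X = "Sigma {0<..} (\<lambda>n::int. {- n<..<n} \<times> (UNIV :: int set))"
  let ?Xp = "{(n, j, k). (n, j, k) \<in> ?X \<and> j \<ge> 0}"
  let ?Xn = "{(n, j, k). (n, j, k) \<in> ?X \<and> j < 0}"
  have X: "?X = ?Xp \<union> ?Xn" by auto
  have key: "tfam q (n + max 0 (- k) - c, n + max 0 k - c, c) = ?u n j * ?v n k"
    if "c = j \<or> c = - j" for n j k c
  proof -
    have "e2 (n + max 0 (- k) - c, n + max 0 k - c, c) = n\<^sup>2 - j\<^sup>2 + n * \<bar>k\<bar>"
      using that by (cases "k \<ge> 0") (auto simp: max_def algebra_simps power2_eq_square)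
    moreover have "even (n + max 0 (- k) - c + (n + max 0 k - c) + c) \<longleftrightarrow> even (j + k)"
      using that by (cases "k \<ge> 0") (auto simp: max_def)
    ultimately show ?thesis
      by (simp add: tfam_def powi_mult[OF q, symmetric] powi_minus_one_odd_even)
  qed
  have P: "tfam q summable_on (pos_triples \<union> rim_triples)" "tfam q summable_on pos_triples"
    using triples_subset by (auto intro!: summable_tfam_subset)
  have bp: "bij_betw (\<lambda>(n, j, k). (n + max 0 (- k) - j, n + max 0 k - j, j)) ?Xp (pos_triples \<union> rim_triples)"
    by (rule bij_betwI[of _ _ _ "\<lambda>(a, b, c). (min a b + c, c, b - a)"])
      (auto simp: pos_triples_def rim_triples_def max_def min_def split: if_splits)
  have bn: "bij_betw (\<lambda>(n, j, k). (n + max 0 (- k) + j, n + max 0 k + j, - j)) ?Xn pos_triples"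
    by (rule bij_betwI[of _ _ _ "\<lambda>(a, b, c). (min a b + c, - c, b - a)"])
      (auto simp: pos_triples_def rim_triples_def max_def min_def split: if_splits)
  have kp: "tfam q (case x of (n, j, k) \<Rightarrow> (n + max 0 (- k) - j, n + max 0 k - j, j)) = ?f x" for x
    using key[of "fst (snd x)" "fst (snd x)" "fst x" "snd (snd x)"] by (simp add: case_prod_unfold)
  have kn: "tfam q (case x of (n, j, k) \<Rightarrow> (n + max 0 (- k) + j, n + max 0 k + j, - j)) = ?f x" for x
    using key[of "- fst (snd x)" "fst (snd x)" "fst x" "snd (snd x)"] by (simp add: case_prod_unfold)
  have sp: "?f summable_on ?Xp" "infsum ?f ?Xp = infsum (tfam q) (pos_triples \<union> rim_triples)"
    using summable_on_reindex_bij_betw[OF bp, of "tfam q"] infsum_reindex_bij_betw[OF bp, of "tfam q"] P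
    unfolding kp by auto
  have sn: "?f summable_on ?Xn" "infsum ?f ?Xn = infsum (tfam q) pos_triples"
    using summable_on_reindex_bij_betw[OF bn, of "tfam q"] infsum_reindex_bij_betw[OF bn, of "tfam q"] P
    unfolding kn by auto
  have s: "?f summable_on ?X"
    by (rule subst[OF X[symmetric], of "(summable_on) ?f"], rule summable_on_union[OF sp(1) sn(1)])
  have "infsum ?f ?X = infsum ?f (?Xp \<union> ?Xn)" by (rule arg_cong[OF X])
  also have "\<dots> = infsum ?f ?Xp + infsum ?f ?Xn"
    by (rule infsum_Un_disjoint[OF sp(1) sn(1)]) auto
  also have "\<dots> = 2 * infsum (tfam q) pos_triples + infsum (tfam q) rim_triples"
  proof -
    have "infsum (tfam q) (pos_triples \<union> rim_triples) = infsum (tfam q) pos_triples + infsum (tfam q) rim_triples"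
      using triples_subset
      by (intro infsum_Un_disjoint summable_tfam_subset) (auto simp: pos_triples_def rim_triples_def)
    then show ?thesis unfolding sp(2) sn(2) by simp
  qed
  finally have tot: "infsum ?f ?X = 2 * infsum (tfam q) pos_triples + infsum (tfam q) rim_triples" .
  have inner: "(\<Sum>\<^sub>\<infinity>jk\<in>{- n<..<n} \<times> UNIV. ?f (n, jk)) = - F_seq q (- n) * ((1 - q powi n) / (1 + q powi n))"
    if n: "n > 0" for n
  proof -
    have "(\<Sum>\<^sub>\<infinity>jk\<in>{- n<..<n} \<times> UNIV. ?f (n, jk)) = infsum (?u n) {- n<..<n} * infsum (?v n) UNIV"
      using infsum_Times_mult[of "?u n" "{- n<..<n}" "?v n" UNIV]
        has_sum_imp_summable[OF has_sum_alternating_geometric(2)[OF q n]]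
      by simp
    also have "infsum (?v n) UNIV = (1 - q powi n) / (1 + q powi n)"
      by (rule infsumI[OF has_sum_alternating_geometric(2)[OF q n]])
    also have "infsum (?u n) {- n<..<n} = - F_seq q (- n)"
    proof -
      have "{- n<..<n} = {- int (nat (n - 1))..int (nat (n - 1))}" using n by auto
      moreover have "q powi (n\<^sup>2 - j\<^sup>2) = q powi (n\<^sup>2) * q powi (- (j\<^sup>2))" for j
        unfolding powi_mult[OF q] by simp
      moreover have "nat (- (- n) - 1) = nat (n - 1)" by simp
      ultimately show ?thesis
        using n by (simp add: F_seq_def inv_theta_sum_def sum_distrib_left mult_ac)
    qed
    finally show ?thesis .
  qed
  show "(\<lambda>n. - F_seq q (- n) * ((1 - q powi n) / (1 + q powi n))) summable_on {0<..}"
    using summable_on_Sigma_banach[OF s] inner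
    by (subst summable_on_cong[where g = "\<lambda>n. \<Sum>\<^sub>\<infinity>jk\<in>{- n<..<n} \<times> UNIV. ?f (n, jk)"]) auto
  show "(\<Sum>\<^sub>\<infinity>n\<in>{0<..}. - F_seq q (- n) * ((1 - q powi n) / (1 + q powi n)))
     = 2 * infsum (tfam q) pos_triples + infsum (tfam q) rim_triples"
    unfolding tot[symmetric] infsum_Sigma_banach[OF s, symmetric]
    by (rule infsum_cong) (use inner in auto)
qed

text \<open>Pairing \<open>n\<close> with \<open>- n\<close> in the constant term, the reflections
  express everything through \<open>F_seq q (- n)\<close> and \<open>q powi n\<close>. With R and P
  for the sums over rim and positive triples this gives 1 - 4R - 2(2P + R), and the nonnegative
  triples contribute P + 3R.\<close>

lemma D_zero_triples:
  "D_seq q 0 = 1 - 2 * (infsum (tfam q) nonneg_triples + infsum (tfam q) pos_triples)"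
proof -
  let ?h = "\<lambda>n. F_seq q n * g_seq q (- n)"
  have s: "?h summable_on UNIV" using summable_F_g[OF q, of 0] by simp
  have sub: "?h summable_on A" for A by (rule summable_on_subset_banach[OF s]) simp
  have r: "(\<lambda>n. ?h (- n)) summable_on {0<..}"
    by (subst summable_on_reindex_bij_witness[of _ uminus uminus "{..<0}" ?h]) (use sub in auto)
  have "D_seq q 0 = infsum ?h UNIV" by (simp add: D_seq_def conv_def)
  also have "(UNIV :: int set) = {0<..} \<union> ({..<0} \<union> {0})" by auto
  also have "infsum ?h \<dots> = infsum ?h {0<..} + (infsum ?h {..<0} + infsum ?h {0})"
    by (subst infsum_Un_disjoint[OF sub sub], force, subst infsum_Un_disjoint[OF sub sub]) auto
  also have "infsum ?h {..<0} = infsum (\<lambda>n. ?h (- n)) {0<..}"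
    by (rule infsum_reindex_bij_witness[of _ uminus uminus]) auto
  also have "infsum ?h {0} = 1"
    using F_reflect[OF q, of 0] by (simp add: g_seq_def)
  also have "infsum ?h {0<..} + (infsum (\<lambda>n. ?h (- n)) {0<..} + 1) = 1 + infsum (\<lambda>n. ?h n + ?h (- n)) {0<..}"
    by (subst infsum_add[OF sub r]) simp
  also have "infsum (\<lambda>n. ?h n + ?h (- n)) {0<..}
      = (\<Sum>\<^sub>\<infinity>n\<in>{0<..}. (- 4) * ((- 1) powi n * - (q powi n / (1 + q powi n)))
           + (- 2) * (- F_seq q (- n) * ((1 - q powi n) / (1 + q powi n))))"
  proof (rule infsum_cong)
    fix n :: int
    define x where "x = q powi n"
    have x: "x > 0" "1 + x \<noteq> 0" using q by (auto simp: x_def add_pos_pos less_imp_neq[symmetric])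
    have F: "F_seq q n = 2 * (- 1) powi n - F_seq q (- n)" using F_reflect[OF q, of n] by simp
    have g: "g_seq q n = 2 / (1 + x)" by (simp add: g_seq_def x_def)
    have g': "g_seq q (- n) = 2 * x / (1 + x)" using g_reflect[OF q, of n] x unfolding g by (simp add: field_simps)
    show "?h n + ?h (- n) = (- 4) * ((- 1) powi n * - (q powi n / (1 + q powi n)))
           + (- 2) * (- F_seq q (- n) * ((1 - q powi n) / (1 + q powi n)))"
      unfolding F minus_minus g g' x_def[symmetric] using x(2)
      by (simp add: divide_simps) (simp add: algebra_simps)
  qed
  also have "\<dots> = - 4 * (\<Sum>\<^sub>\<infinity>n\<in>{0<..}. (- 1) powi n * - (q powi n / (1 + q powi n)))
      + (- 2) * (\<Sum>\<^sub>\<infinity>n\<in>{0<..}. - F_seq q (- n) * ((1 - q powi n) / (1 + q powi n)))"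
    unfolding infsum_cmult_right'[symmetric]
    by (intro infsum_add summable_on_cmult_right rim_sum(1) hecke_sum(1))
  also have "\<dots> = - 4 * infsum (tfam q) rim_triples
      + (- 2) * (2 * infsum (tfam q) pos_triples + infsum (tfam q) rim_triples)"
    by (simp only: rim_sum(2) hecke_sum(2))
  finally show ?thesis unfolding infsum_nonneg_triples[OF q] by simp
qed

lemma theta_cube_has_sum:
  "((\<lambda>(x, y, z). (- 1) powi (x + y + z) * q powi (x\<^sup>2 + y\<^sup>2 + z\<^sup>2)) has_sum
     (\<Sum>\<^sub>\<infinity>n. square_theta q n * (- 1) powi n) ^ 3) UNIV"
proof -
  let ?t = "\<lambda>n. square_theta q n * (- 1) powi n"
  note t = summable_alt_square_theta[OF q]
  have s2: "(\<lambda>(n, k). ?t n * ?t k) summable_on UNIV \<times> UNIV" by (rule summable_on_Times_mult[OF t t])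
  have "((\<lambda>(n, m). ?t n * (case m of (n, k) \<Rightarrow> ?t n * ?t k)) has_sum (infsum ?t UNIV * (infsum ?t UNIV * infsum ?t UNIV)))
      (UNIV \<times> (UNIV \<times> UNIV))"
    using has_sum_infsum[OF summable_on_Times_mult[OF t s2]]
    unfolding infsum_Times_mult[OF t s2] infsum_Times_mult[OF t t] .
  moreover have "(\<lambda>(n, m). ?t n * (case m of (n, k) \<Rightarrow> ?t n * ?t k))
      = (\<lambda>(x, y, z). (- 1) powi (x + y + z) * q powi (x\<^sup>2 + y\<^sup>2 + z\<^sup>2))"
    by (rule ext) (auto simp: square_theta_def powi_mult[OF q, symmetric] power_int_add split: prod.splits)
  ultimately show ?thesis by (simp only: power3_eq_cube mult.assoc UNIV_Times_UNIV)
qed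

end

section \<open>Passage from generating functions to coefficients\<close>

lemma finite_sum_three_squares: "finite {(x::int, y::int, z::int). x\<^sup>2 + y\<^sup>2 + z\<^sup>2 = int n}"
proof (rule finite_subset)
  show "{(x, y, z). x\<^sup>2 + y\<^sup>2 + z\<^sup>2 = int n} \<subseteq> {- int n..int n} \<times> {- int n..int n} \<times> {- int n..int n}"
  proof
    fix t assume "t \<in> {(x::int, y::int, z::int). x\<^sup>2 + y\<^sup>2 + z\<^sup>2 = int n}"
    then obtain x y z where t: "t = (x, y, z)" "x\<^sup>2 + y\<^sup>2 + z\<^sup>2 = int n" by auto
    then have "\<bar>x\<bar> \<le> int n" "\<bar>y\<bar> \<le> int n" "\<bar>z\<bar> \<le> int n"
      using abs_le_square_int[of x] abs_le_square_int[of y] abs_le_square_int[of z] zero_le_power2[of x] zero_le_power2[of y] zero_le_power2[of z] by linarith+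
    then show "t \<in> {- int n..int n} \<times> {- int n..int n} \<times> {- int n..int n}" using t by auto
  qed
qed simp

lemma finite_nonneg_triples: "finite {t \<in> nonneg_triples. e2 t = int n}"
proof (rule finite_subset)
  show "{t \<in> nonneg_triples. e2 t = int n} \<subseteq> {0..2 * int n} \<times> {0..2 * int n} \<times> {0..2 * int n}"
  proof
    fix t assume t: "t \<in> {t \<in> nonneg_triples. e2 t = int n}"
    obtain a b c where abc: "t = (a, b, c)" by (cases t) auto
    have "a + b + c \<le> 2 * int n" using e2_ge[of a b c] t abc by simp
    then show "t \<in> {0..2 * int n} \<times> {0..2 * int n} \<times> {0..2 * int n}"
      using t abc by (auto simp: nonneg_triples_def)
  qed
qed simp

lemma finite_pos_triples: "finite {t \<in> pos_triples. e2 t = int n}"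
  by (rule finite_subset[OF _ finite_nonneg_triples[of n]]) (use triples_subset in auto)

lemma e2_nonneg: "t \<in> nonneg_triples \<Longrightarrow> e2 t \<ge> 0"
  by (cases t) (auto simp: nonneg_triples_def)

lemma tfam_sums:
  assumes q: "0 < q" "q < 1" and X: "X \<subseteq> nonneg_triples"
  shows "(\<lambda>m. (\<Sum>t | t \<in> X \<and> e2 t = int m. tsign t) * q ^ m) sums infsum (tfam q) X"
proof -
  have i: "nat (e2 t) = m \<longleftrightarrow> e2 t = int m" if "t \<in> X" for t m
    using e2_nonneg[of t] X that by auto
  have sets: "{t \<in> X. nat (e2 t) = m} = {t \<in> X. e2 t = int m}" for m using i by auto
  have "(tfam q has_sum infsum (tfam q) X) X"
    by (rule has_sum_infsum[OF summable_tfam_subset[OF q X]])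
  then have "((\<lambda>t. tsign t * q ^ nat (e2 t)) has_sum infsum (tfam q) X) X"
    using X e2_nonneg
    by (subst has_sum_cong[where g = "tfam q"]) (auto simp: tfam_def power_int_def dest!: subsetD)
  from has_sum_imp_power_sums[OF this] show ?thesis
    unfolding sets using X by (auto intro: finite_subset[OF _ finite_nonneg_triples])
qed

theorem theta_cube_coefficient:
  assumes "n > 0"
  shows "(\<Sum>(x, y, z) | x\<^sup>2 + y\<^sup>2 + z\<^sup>2 = int n. (- 1) powi (x + y + z))
    = - 2 * ((\<Sum>t | t \<in> nonneg_triples \<and> e2 t = int n. tsign t) + (\<Sum>t | t \<in> pos_triples \<and> e2 t = int n. tsign t))"
proof -
  let ?N = "\<lambda>m. \<Sum>t | t \<in> nonneg_triples \<and> e2 t = int m. tsign t"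
  let ?P = "\<lambda>m. \<Sum>t | t \<in> pos_triples \<and> e2 t = int m. tsign t"
  let ?c = "\<lambda>m. \<Sum>(x, y, z) | x\<^sup>2 + y\<^sup>2 + z\<^sup>2 = int m. (- 1) powi (x + y + z) :: real"
  let ?d = "\<lambda>m. (if m = 0 then 1 else 0) - 2 * (?N m + ?P m)"
  have "?c n = ?d n"
  proof (rule power_series_unique_on_unit_interval)
    fix q :: real assume q: "0 < q" "q < 1"
    let ?S = "(\<Sum>\<^sub>\<infinity>n. square_theta q n * (- 1) powi n) ^ 3"
    let ?e = "\<lambda>(x, y, z). nat (x\<^sup>2 + y\<^sup>2 + z\<^sup>2)"
    let ?s = "\<lambda>(x, y, z). (- 1) powi (x + y + z) :: real"
    have hs: "((\<lambda>t. ?s t * q ^ ?e t) has_sum ?S) UNIV"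
      using theta_cube_has_sum[OF q] by (simp add: case_prod_unfold power_int_def)
    have sets: "{t \<in> UNIV. ?e t = m} = {(x, y, z). x\<^sup>2 + y\<^sup>2 + z\<^sup>2 = int m}" for m
      by (auto simp: nat_eq_iff)
    have fin: "finite {t \<in> UNIV. ?e t = m}" for m
      unfolding sets by (rule finite_sum_three_squares)
    have c: "(\<lambda>m. ?c m * q ^ m) sums ?S"
      using has_sum_imp_power_sums[OF hs fin] unfolding sets .
    have "(\<lambda>m. (?N m + ?P m) * q ^ m) sums (infsum (tfam q) nonneg_triples + infsum (tfam q) pos_triples)"
      unfolding distrib_right by (intro sums_add tfam_sums q triples_subset order_refl)
    moreover have "(\<lambda>m. (if m = 0 then 1 else 0) * q ^ m) sums 1"
      using sums_single[of 0 "\<lambda>m. q ^ m"] by (simp add: if_distrib[of "\<lambda>x. x * _"] cong: if_cong)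
    ultimately have "(\<lambda>m. (if m = 0 then 1 else 0) * q ^ m - 2 * ((?N m + ?P m) * q ^ m))
        sums (1 - 2 * (infsum (tfam q) nonneg_triples + infsum (tfam q) pos_triples))"
      by (intro sums_diff sums_mult)
    also have "1 - 2 * (infsum (tfam q) nonneg_triples + infsum (tfam q) pos_triples) = ?S"
      using D_zero_triples[OF q] D_zero_eq_theta_cube[OF q] by simp
    finally have "(\<lambda>m. ?d m * q ^ m) sums ?S" by (simp only: left_diff_distrib mult.assoc)
    with c show "\<exists>S. (\<lambda>m. ?c m * q ^ m) sums S \<and> (\<lambda>m. ?d m * q ^ m) sums S" by blast
  qed
  with assms show ?thesis by simp
qed

lemma qpochhammer_inf_of_real:
  assumes q: "0 < q" "q < 1"
  shows "qpochhammer_inf (of_real x) (of_real q) = of_real (qprod x q)"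
proof -
  have "summable (\<lambda>k. norm (- (of_real x * of_real q ^ k) :: complex))"
    using q by (simp add: norm_mult norm_power summable_mult)
  then have "abs_convergent_prod (\<lambda>k. 1 + - (of_real x * of_real q ^ k) :: complex)"
    by (intro summable_imp_abs_convergent_prod) simp
  then have c: "convergent_prod (\<lambda>k. 1 - of_real x * of_real q ^ k :: complex)"
    using abs_convergent_prod_imp_convergent_prod by fastforce
  have "(\<lambda>n. \<Prod>k<n. 1 - of_real x * of_real q ^ k :: complex) \<longlonglongrightarrow> qpochhammer_inf (of_real x) (of_real q)"
    using convergent_prod_LIMSEQ[OF c] unfolding qpochhammer_inf_def LIMSEQ_lessThan_iff_atMost .
  moreover have "(\<lambda>n. of_real (\<Prod>k<n. 1 - x * q ^ k) :: complex) \<longlonglongrightarrow> of_real (qprod x q)"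
    by (intro tendsto_of_real qprod_LIMSEQ q)
  ultimately show ?thesis by (intro LIMSEQ_unique) auto
qed

text \<open>With u = y + z and v = y - z, the exponent 2(y^2 + z^2) of the squared factor becomes
  u^2 + v^2 and the sign of y + z becomes that of u. The image is cut out by the parity of u -
  v.\<close>

lemma theta_mixed_has_sum:
  assumes q: "0 < q" "q < 1"
  shows "((\<lambda>(x, u, v). (- 1) powi (x + u) * q powi (x\<^sup>2 + u\<^sup>2 + v\<^sup>2)) has_sum
     (\<Sum>\<^sub>\<infinity>n. square_theta q n * (- 1) powi n) * (\<Sum>\<^sub>\<infinity>n. square_theta (q\<^sup>2) n * (- 1) powi n)\<^sup>2)
     {(x, u, v). even (u - v)}"
proof -
  have q2: "0 < q\<^sup>2" "q\<^sup>2 < 1" using q by (auto simp: power_less_one_iff)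
  let ?t = "\<lambda>q n. square_theta q n * (- 1) powi n"
  note t1 = summable_alt_square_theta[OF q] and t2 = summable_alt_square_theta[OF q2]
  have s2: "(\<lambda>(n, k). ?t (q\<^sup>2) n * ?t (q\<^sup>2) k) summable_on UNIV \<times> UNIV" by (rule summable_on_Times_mult[OF t2 t2])
  have "((\<lambda>(n, m). ?t q n * (case m of (n, k) \<Rightarrow> ?t (q\<^sup>2) n * ?t (q\<^sup>2) k)) has_sum
      (infsum (?t q) UNIV * (infsum (?t (q\<^sup>2)) UNIV * infsum (?t (q\<^sup>2)) UNIV))) (UNIV \<times> (UNIV \<times> UNIV))"
    using has_sum_infsum[OF summable_on_Times_mult[OF t1 s2]]
    unfolding infsum_Times_mult[OF t1 s2] infsum_Times_mult[OF t2 t2] .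
  moreover have "(\<lambda>(n, m). ?t q n * (case m of (n, k) \<Rightarrow> ?t (q\<^sup>2) n * ?t (q\<^sup>2) k))
      = (\<lambda>(x, y, z). (- 1) powi (x + y + z) * q powi (x\<^sup>2 + 2 * (y\<^sup>2 + z\<^sup>2)))"
  proof -
    have "(q\<^sup>2) powi m = q powi (2 * m)" for m by (simp add: power_int_mult)
    then show ?thesis
      by (intro ext) (auto simp: square_theta_def powi_mult[OF q, symmetric] power_int_add distrib_left split: prod.splits)
  qed
  ultimately have "((\<lambda>(x, y, z). (- 1) powi (x + y + z) * q powi (x\<^sup>2 + 2 * (y\<^sup>2 + z\<^sup>2))) has_sum
      (infsum (?t q) UNIV * (infsum (?t (q\<^sup>2)) UNIV)\<^sup>2)) UNIV"
    by (simp only: power2_eq_square UNIV_Times_UNIV)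
  moreover have b: "bij_betw (\<lambda>(x, y, z). (x, y + z, y - z)) UNIV ({(x, u, v). even (u - v)} :: itriple set)"
  proof (rule bij_betw_imageI)
    show "inj_on (\<lambda>(x, y, z). (x, y + z, y - z)) (UNIV :: itriple set)"
      by (auto simp: inj_on_def)
    show "range (\<lambda>(x, y, z). (x, y + z, y - z)) = ({(x, u, v). even (u - v)} :: itriple set)"
    proof (intro subset_antisym subsetI)
      fix t :: itriple assume "t \<in> {(x, u, v). even (u - v)}"
      then obtain x u v where t: "t = (x, u, v)" "even (u - v)" by auto
      from t(2) obtain k where "u - v = 2 * k" by (elim evenE)
      then have "t = (\<lambda>(x, y, z). (x, y + z, y - z)) (x, v + k, k)" using t(1) by simp
      then show "t \<in> range (\<lambda>(x, y, z). (x, y + z, y - z))" by blast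
    qed auto
  qed
  moreover have "(case (case t of (x, y, z) \<Rightarrow> (x, y + z, y - z)) of
        (x, u, v) \<Rightarrow> (- 1) powi (x + u) * q powi (x\<^sup>2 + u\<^sup>2 + v\<^sup>2))
      = (case t of (x, y, z) \<Rightarrow> (- 1) powi (x + y + z) * q powi (x\<^sup>2 + 2 * (y\<^sup>2 + z\<^sup>2)))" for t
    by (cases t) (simp add: power2_eq_square algebra_simps)
  ultimately show ?thesis
    unfolding has_sum_reindex_bij_betw[OF b, symmetric] by (simp only:)
qed

theorem a_eq_signed_count:
  fixes a :: "nat \<Rightarrow> int"
  assumes a_gen: "\<And>q::complex. norm q < 1 \<Longrightarrow>
      (\<lambda>m. of_int (a m) * q ^ m) sums
        (qpochhammer_inf q q / qpochhammer_inf (- q) q *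
         (qpochhammer_inf (q\<^sup>2) (q\<^sup>2) / qpochhammer_inf (- (q\<^sup>2)) (q\<^sup>2))\<^sup>2)"
  shows "real_of_int (a n) = (\<Sum>(x, u, v) | even (u - v) \<and> x\<^sup>2 + u\<^sup>2 + v\<^sup>2 = int n. (- 1) powi (x + u))"
proof -
  let ?c = "\<lambda>m. \<Sum>(x, u, v) | even (u - v) \<and> x\<^sup>2 + u\<^sup>2 + v\<^sup>2 = int m. (- 1) powi (x + u) :: real"
  show ?thesis
  proof (rule power_series_unique_on_unit_interval[of "\<lambda>n. real_of_int (a n)" ?c])
    fix q :: real assume q: "0 < q" "q < 1"
    have q2: "0 < q\<^sup>2" "q\<^sup>2 < 1" using q by (auto simp: power_less_one_iff)
    let ?S = "(\<Sum>\<^sub>\<infinity>n. square_theta q n * (- 1) powi n) * (\<Sum>\<^sub>\<infinity>n. square_theta (q\<^sup>2) n * (- 1) powi n)\<^sup>2"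
    have S: "?S = qprod q q / qprod (- q) q * (qprod (q\<^sup>2) (q\<^sup>2) / qprod (- (q\<^sup>2)) (q\<^sup>2))\<^sup>2"
      by (simp only: gauss_theta_product[OF q] gauss_theta_product[OF q2])
    have "(\<lambda>m. complex_of_real (real_of_int (a m) * q ^ m)) sums complex_of_real ?S"
      using a_gen[of "of_real q"] q qpochhammer_inf_of_real[OF q, of q] qpochhammer_inf_of_real[OF q, of "- q"]
        qpochhammer_inf_of_real[OF q2, of "q\<^sup>2"] qpochhammer_inf_of_real[OF q2, of "- (q\<^sup>2)"]
      unfolding S by simp
    then have A: "(\<lambda>m. real_of_int (a m) * q ^ m) sums ?S" by (simp only: sums_of_real_iff)
    let ?e = "\<lambda>(x, u, v). nat (x\<^sup>2 + u\<^sup>2 + v\<^sup>2)"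
    let ?s = "\<lambda>(x, u, v). (- 1) powi (x + u) :: real"
    let ?I = "{(x, u, v). even (u - v)} :: itriple set"
    have hs: "((\<lambda>t. ?s t * q ^ ?e t) has_sum ?S) ?I"
      using theta_mixed_has_sum[OF q] by (simp add: case_prod_unfold power_int_def)
    have sets: "{t \<in> ?I. ?e t = m} = {(x, u, v). even (u - v) \<and> x\<^sup>2 + u\<^sup>2 + v\<^sup>2 = int m}" for m
      by (auto simp: nat_eq_iff)
    have fin: "finite {t \<in> ?I. ?e t = m}" for m
      unfolding sets by (rule finite_subset[OF _ finite_sum_three_squares[of m]]) auto
    have C: "(\<lambda>m. ?c m * q ^ m) sums ?S"
      using has_sum_imp_power_sums[OF hs fin] unfolding sets .
    from A C show "\<exists>S. (\<lambda>m. real_of_int (a m) * q ^ m) sums S \<and> (\<lambda>m. ?c m * q ^ m) sums S" by blast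
  qed
qed

section \<open>Obtuse forms and class numbers\<close>

definition bqf_act :: "bqf \<Rightarrow> int \<Rightarrow> int \<Rightarrow> int \<Rightarrow> int \<Rightarrow> bqf" where
  "bqf_act f \<alpha> \<beta> \<gamma> \<delta> = (case f of (a, b, c) \<Rightarrow>
     (a * \<alpha>\<^sup>2 + b * \<alpha> * \<gamma> + c * \<gamma>\<^sup>2, 2 * a * \<alpha> * \<beta> + b * (\<alpha> * \<delta> + \<beta> * \<gamma>) + 2 * c * \<gamma> * \<delta>,
      a * \<beta>\<^sup>2 + b * \<beta> * \<delta> + c * \<delta>\<^sup>2))"

lemma bqf_eval_act:
  "bqf_eval (bqf_act f \<alpha> \<beta> \<gamma> \<delta>) x y = bqf_eval f (\<alpha> * x + \<beta> * y) (\<gamma> * x + \<delta> * y)"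
  by (cases f) (simp add: bqf_act_def power2_eq_square algebra_simps)

lemma bqf_eqI: "(\<And>x y. bqf_eval f x y = bqf_eval g x y) \<Longrightarrow> f = g"
proof (cases f, cases g)
  fix a b c a' b' c' assume e: "\<And>x y. bqf_eval f x y = bqf_eval g x y" and f: "f = (a, b, c)" "g = (a', b', c')"
  show ?thesis using e[of 1 0] e[of 0 1] e[of 1 1] f by simp
qed

lemma SL2_equiv_iff: "bqf_SL2_equiv f g \<longleftrightarrow> (\<exists>\<alpha> \<beta> \<gamma> \<delta>. \<alpha> * \<delta> - \<beta> * \<gamma> = 1 \<and> g = bqf_act f \<alpha> \<beta> \<gamma> \<delta>)"
  unfolding bqf_SL2_equiv_def bqf_eval_act[symmetric] using bqf_eqI by blast

lemma bqf_act_act: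
  "bqf_act (bqf_act f \<alpha> \<beta> \<gamma> \<delta>) \<alpha>' \<beta>' \<gamma>' \<delta>'
    = bqf_act f (\<alpha> * \<alpha>' + \<beta> * \<gamma>') (\<alpha> * \<beta>' + \<beta> * \<delta>') (\<gamma> * \<alpha>' + \<delta> * \<gamma>') (\<gamma> * \<beta>' + \<delta> * \<delta>')"
  by (rule bqf_eqI) (simp add: bqf_eval_act algebra_simps)

lemma bqf_act_id: "bqf_act f 1 0 0 1 = f"
  by (cases f) (simp add: bqf_act_def)

lemma SL2_equiv_refl: "bqf_SL2_equiv f f"
  unfolding SL2_equiv_iff by (intro exI[of _ 1] exI[of _ 0]) (simp add: bqf_act_id)

lemma SL2_equiv_sym: "bqf_SL2_equiv f g \<Longrightarrow> bqf_SL2_equiv g f"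
proof -
  assume "bqf_SL2_equiv f g"
  then obtain \<alpha> \<beta> \<gamma> \<delta> where d: "\<alpha> * \<delta> - \<beta> * \<gamma> = 1" and g: "g = bqf_act f \<alpha> \<beta> \<gamma> \<delta>"
    unfolding SL2_equiv_iff by blast
  have "\<delta> * \<alpha> - (- \<beta>) * (- \<gamma>) = 1" using d by (simp add: algebra_simps)
  moreover have "bqf_act g \<delta> (- \<beta>) (- \<gamma>) \<alpha> = f"
  proof -
    have "bqf_act g \<delta> (- \<beta>) (- \<gamma>) \<alpha> = bqf_act f 1 0 0 1"
      unfolding g bqf_act_act using d by (simp add: algebra_simps)
    then show ?thesis by (simp add: bqf_act_id)
  qed
  ultimately show ?thesis unfolding SL2_equiv_iff by metis
qed

lemma SL2_equiv_trans: "bqf_SL2_equiv f g \<Longrightarrow> bqf_SL2_equiv g h \<Longrightarrow> bqf_SL2_equiv f h"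
proof -
  assume "bqf_SL2_equiv f g" "bqf_SL2_equiv g h"
  then obtain \<alpha> \<beta> \<gamma> \<delta> \<alpha>' \<beta>' \<gamma>' \<delta>' where d: "\<alpha> * \<delta> - \<beta> * \<gamma> = 1" "\<alpha>' * \<delta>' - \<beta>' * \<gamma>' = 1"
    and g: "g = bqf_act f \<alpha> \<beta> \<gamma> \<delta>" "h = bqf_act g \<alpha>' \<beta>' \<gamma>' \<delta>'"
    unfolding SL2_equiv_iff by blast
  have "(\<alpha> * \<alpha>' + \<beta> * \<gamma>') * (\<gamma> * \<beta>' + \<delta> * \<delta>') - (\<alpha> * \<beta>' + \<beta> * \<delta>') * (\<gamma> * \<alpha>' + \<delta> * \<gamma>')
      = (\<alpha> * \<delta> - \<beta> * \<gamma>) * (\<alpha>' * \<delta>' - \<beta>' * \<gamma>')"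
    by (simp add: algebra_simps)
  then show ?thesis unfolding SL2_equiv_iff g bqf_act_act using d by auto
qed

lemma act_in_posdef_forms:
  assumes "f \<in> posdef_forms N" "\<alpha> * \<delta> - \<beta> * \<gamma> = 1"
  shows "bqf_act f \<alpha> \<beta> \<gamma> \<delta> \<in> posdef_forms N"
proof -
  obtain a b c where f: "f = (a, b, c)" by (cases f)
  have "bqf_discr (bqf_act f \<alpha> \<beta> \<gamma> \<delta>) = (\<alpha> * \<delta> - \<beta> * \<gamma>)\<^sup>2 * bqf_discr f"
    by (simp add: f bqf_act_def power2_eq_square algebra_simps)
  moreover have "bqf_posdef (bqf_act f \<alpha> \<beta> \<gamma> \<delta>)"
    unfolding bqf_posdef_def bqf_eval_act
  proof (intro allI impI)
    fix x y :: int assume xy: "(x, y) \<noteq> (0, 0)"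
    have "(\<alpha> * x + \<beta> * y, \<gamma> * x + \<delta> * y) \<noteq> (0, 0)"
    proof
      assume "(\<alpha> * x + \<beta> * y, \<gamma> * x + \<delta> * y) = (0, 0)"
      then have z: "\<alpha> * x + \<beta> * y = 0" "\<gamma> * x + \<delta> * y = 0" by auto
      have "(\<alpha> * \<delta> - \<beta> * \<gamma>) * x = \<delta> * (\<alpha> * x + \<beta> * y) - \<beta> * (\<gamma> * x + \<delta> * y)"
        "(\<alpha> * \<delta> - \<beta> * \<gamma>) * y = \<alpha> * (\<gamma> * x + \<delta> * y) - \<gamma> * (\<alpha> * x + \<beta> * y)"
        by (simp_all add: algebra_simps)
      then show False using xy unfolding z assms(2) by simp
    qed
    then show "0 < bqf_eval f (\<alpha> * x + \<beta> * y) (\<gamma> * x + \<delta> * y)"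
      using assms(1) by (simp add: posdef_forms_def bqf_posdef_def)
  qed
  ultimately show ?thesis using assms by (simp add: posdef_forms_def)
qed

definition form_rel :: "nat \<Rightarrow> (bqf \<times> bqf) set" where
  "form_rel N = {(f, g). f \<in> posdef_forms N \<and> g \<in> posdef_forms N \<and> bqf_SL2_equiv f g}"

lemma equiv_form_rel: "equiv (posdef_forms N) (form_rel N)"
  by (intro equivI)
    (auto simp: form_rel_def refl_on_def sym_on_def trans_on_def intro: SL2_equiv_refl SL2_equiv_sym SL2_equiv_trans)

text \<open>Selling parameters: \<open>2 f(x, y) = A (x - y)\<^sup>2 + B y\<^sup>2 + C x\<^sup>2\<close>, with \<open>- discr f = AB + BC + CA\<close>.
  They are all nonnegative iff the superbase \<open>(1,0), (0,1), (-1,-1)\<close> is obtuse.\<close>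

definition bqf_params :: "bqf \<Rightarrow> itriple" where
  "bqf_params f = (case f of (a, b, c) \<Rightarrow> (- b, 2 * c + b, 2 * a + b))"

definition obtuse_forms :: "nat \<Rightarrow> bqf set" where
  "obtuse_forms N = {f \<in> posdef_forms N. case bqf_params f of (A, B, C) \<Rightarrow> A \<ge> 0 \<and> B \<ge> 0 \<and> C \<ge> 0}"

text \<open>Selling reduction. The measure is f(1,0) + f(0,1) + f(1,1), which is positive; a
  negative parameter allows a substitution that lowers it by twice the absolute value of that
  parameter.\<close>

lemma exists_obtuse_form:
  "f \<in> posdef_forms N \<Longrightarrow> \<exists>g \<in> obtuse_forms N. bqf_SL2_equiv f g"
proof (induction "nat (case f of (a, b, c) \<Rightarrow> 2 * a + 2 * c + b)" arbitrary: f rule: less_induct)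
  case less
  obtain a b c where f: "f = (a, b, c)" by (cases f)
  have pd: "bqf_posdef f" using less.prems by (simp add: posdef_forms_def)
  have step: ?case
    if d: "\<alpha> * \<delta> - \<beta> * \<gamma> = 1" and lt: "(case bqf_act f \<alpha> \<beta> \<gamma> \<delta> of (a, b, c) \<Rightarrow> 2 * a + 2 * c + b) < 2 * a + 2 * c + b"
    for \<alpha> \<beta> \<gamma> \<delta>
  proof -
    let ?g = "bqf_act f \<alpha> \<beta> \<gamma> \<delta>"
    have g: "?g \<in> posdef_forms N" by (rule act_in_posdef_forms[OF less.prems d])
    have "(0::int) < (case h of (a, b, c) \<Rightarrow> 2 * a + 2 * c + b)" if h: "h \<in> posdef_forms N" for h
    proof -
      obtain a b c where abc: "h = (a, b, c)" by (cases h)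
      have pos: "bqf_eval h x y > 0" if "(x, y) \<noteq> (0, 0)" for x y
        using h that by (simp add: posdef_forms_def bqf_posdef_def)
      show ?thesis using pos[of 1 0] pos[of 0 1] pos[of 1 1] by (simp add: abc)
    qed
    from this[OF less.prems] this[OF g] lt
    have "nat (case ?g of (a, b, c) \<Rightarrow> 2 * a + 2 * c + b) < nat (case f of (a, b, c) \<Rightarrow> 2 * a + 2 * c + b)"
      by (simp add: f)
    from less.hyps[OF this g] obtain h where h: "h \<in> obtuse_forms N" "bqf_SL2_equiv ?g h" by blast
    have "bqf_SL2_equiv f ?g" unfolding SL2_equiv_iff using d by blast
    with h show ?thesis using SL2_equiv_trans by blast
  qed
  consider "b > 0" | "2 * a + b < 0" | "2 * c + b < 0" | "b \<le> 0" "2 * a + b \<ge> 0" "2 * c + b \<ge> 0" by linarith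
  then show ?case
  proof cases
    \<comment> \<open>The three substitutions replace f(x, y) by f(-y, x), f(x + y, y) and f(x, x +
      y).\<close>
    case 1 then show ?thesis by (intro step[of 0 0 "- 1" 1]) (simp_all add: f bqf_act_def)
  next
    case 2 then show ?thesis by (intro step[of 1 1 1 0]) (simp_all add: f bqf_act_def)
  next
    case 3 then show ?thesis by (intro step[of 1 1 0 1]) (simp_all add: f bqf_act_def)
  next
    case 4
    then have "f \<in> obtuse_forms N" using less.prems by (simp add: obtuse_forms_def bqf_params_def f)
    then show ?thesis using SL2_equiv_refl by blast
  qed
qed

section \<open>Uniqueness of the obtuse superbase\<close>

definition hexnorm :: "int \<Rightarrow> int \<Rightarrow> int" where "hexnorm u v = u\<^sup>2 + u * v + v\<^sup>2"

lemma hexnorm_four: "4 * hexnorm u v = (2 * u + v)\<^sup>2 + 3 * v\<^sup>2" "4 * hexnorm u v = (2 * v + u)\<^sup>2 + 3 * u\<^sup>2"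
  by (simp_all add: hexnorm_def power2_eq_square algebra_simps)

lemma hexnorm_ge_one: "(u, v) \<noteq> (0, 0) \<Longrightarrow> hexnorm u v \<ge> 1"
proof -
  assume "(u, v) \<noteq> (0, 0)"
  then have "u\<^sup>2 > 0 \<or> v\<^sup>2 > 0" by auto
  then show ?thesis
    using hexnorm_four[of u v] zero_le_power2[of "2 * u + v"] zero_le_power2[of "2 * v + u"]
      zero_le_power2[of u] zero_le_power2[of v] by linarith
qed

lemma hexnorm_one: assumes "hexnorm u v = 1" shows "u \<in> {- 1, 0, 1}" "v \<in> {- 1, 0, 1}"
proof -
  have small: "x \<in> {- 1, 0, 1}" if "3 * x\<^sup>2 \<le> 4" for x :: int
  proof -
    have "x\<^sup>2 < 2\<^sup>2" using that by simp
    then have "\<bar>x\<bar> < 2" using power2_less_imp_less[of "\<bar>x\<bar>" 2] by simp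
    then show ?thesis by auto
  qed
  show "u \<in> {- 1, 0, 1}" "v \<in> {- 1, 0, 1}"
    by (intro small; use hexnorm_four[of u v] assms zero_le_power2[of "2 * u + v"] zero_le_power2[of "2 * v + u"] in linarith)+
qed

definition param_sum :: "bqf \<Rightarrow> int" where
  "param_sum f = (case f of (a, b, c) \<Rightarrow> 2 * a + 2 * c + b)"

text \<open>\<open>param_sum\<close> adds the values of the form at the two columns of the matrix
  and at their sum. A linear form with values u, v on the columns contributes u^2 + v^2 + (u + v)^2,
  twice \<open>hexnorm u v\<close>, and Selling's formula has three such squares for twice the
  form.\<close>

lemma param_sum_act:
  assumes "bqf_params f = (A, B, C)"
  shows "param_sum (bqf_act f \<alpha> \<beta> \<gamma> \<delta>)
     = A * hexnorm (\<alpha> - \<gamma>) (\<beta> - \<delta>) + B * hexnorm \<gamma> \<delta> + C * hexnorm \<alpha> \<beta>" "param_sum f = A + B + C"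
  using assms by (cases f; auto simp: bqf_params_def param_sum_def bqf_act_def hexnorm_def power2_eq_square algebra_simps)+

text \<open>An obtuse superbase minimises the sum of its three values of \<open>f\<close>; the equality case leaves only
  finitely many matrices between two obtuse forms.\<close>

lemma param_sum_act_ge:
  assumes "bqf_params f = (A, B, C)" "A \<ge> 0" "B \<ge> 0" "C \<ge> 0" and d: "\<alpha> * \<delta> - \<beta> * \<gamma> = 1"
  shows "param_sum f \<le> param_sum (bqf_act f \<alpha> \<beta> \<gamma> \<delta>)"
    and "param_sum f = param_sum (bqf_act f \<alpha> \<beta> \<gamma> \<delta>) \<Longrightarrow>
      (A > 0 \<longrightarrow> hexnorm (\<alpha> - \<gamma>) (\<beta> - \<delta>) = 1) \<and> (B > 0 \<longrightarrow> hexnorm \<gamma> \<delta> = 1) \<and> (C > 0 \<longrightarrow> hexnorm \<alpha> \<beta> = 1)"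
proof -
  have h: "hexnorm (\<alpha> - \<gamma>) (\<beta> - \<delta>) \<ge> 1" "hexnorm \<gamma> \<delta> \<ge> 1" "hexnorm \<alpha> \<beta> \<ge> 1"
    using d by (auto intro!: hexnorm_ge_one)
  have m: "A \<le> A * hexnorm (\<alpha> - \<gamma>) (\<beta> - \<delta>)" "B \<le> B * hexnorm \<gamma> \<delta>" "C \<le> C * hexnorm \<alpha> \<beta>"
    using mult_left_mono[OF h(1) assms(2)] mult_left_mono[OF h(2) assms(3)] mult_left_mono[OF h(3) assms(4)] by auto
  then show "param_sum f \<le> param_sum (bqf_act f \<alpha> \<beta> \<gamma> \<delta>)"
    unfolding param_sum_act[OF assms(1)] by linarith
  assume "param_sum f = param_sum (bqf_act f \<alpha> \<beta> \<gamma> \<delta>)"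
  then have "A = A * hexnorm (\<alpha> - \<gamma>) (\<beta> - \<delta>)" "B = B * hexnorm \<gamma> \<delta>" "C = C * hexnorm \<alpha> \<beta>"
    using m unfolding param_sum_act[OF assms(1)] by linarith+
  then show "(A > 0 \<longrightarrow> hexnorm (\<alpha> - \<gamma>) (\<beta> - \<delta>) = 1) \<and> (B > 0 \<longrightarrow> hexnorm \<gamma> \<delta> = 1) \<and> (C > 0 \<longrightarrow> hexnorm \<alpha> \<beta> = 1)"
    by auto
qed

lemma obtuse_equiv_param_sum:
  assumes "f \<in> obtuse_forms N" "g \<in> obtuse_forms N" "bqf_SL2_equiv f g"
  shows "param_sum f = param_sum g"
proof -
  have le: "param_sum f \<le> param_sum g" if "f \<in> obtuse_forms N" "bqf_SL2_equiv f g" for f g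
  proof -
    obtain A B C where p: "bqf_params f = (A, B, C)" by (cases "bqf_params f")
    show ?thesis using that param_sum_act_ge(1)[OF p] p unfolding SL2_equiv_iff obtuse_forms_def by auto
  qed
  show ?thesis using le[OF assms(1,3)] le[OF assms(2) SL2_equiv_sym[OF assms(3)]] by simp
qed

definition rotations :: "itriple \<Rightarrow> itriple set" where
  "rotations t = (case t of (A, B, C) \<Rightarrow> {(A, B, C), (B, C, A), (C, A, B)})"

definition arrangements :: "itriple \<Rightarrow> itriple set" where
  "arrangements t = (case t of (A, B, C) \<Rightarrow> {(A, B, C), (B, C, A), (C, A, B), (B, A, C), (A, C, B), (C, B, A)})"

text \<open>Equality in \<open>param_sum_act_ge\<close> makes all three norms 1, which leaves
  finitely many matrices to check. Those of determinant 1 permute the superbase cyclically, up to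
  sign.\<close>

lemma params_equiv_strict:
  assumes f: "f \<in> obtuse_forms N" and g: "g \<in> obtuse_forms N" and e: "bqf_SL2_equiv f g"
    and p: "bqf_params f = (A, B, C)" "A > 0" "B > 0" "C > 0"
  shows "bqf_params g \<in> rotations (A, B, C)"
proof -
  obtain \<alpha> \<beta> \<gamma> \<delta> where d: "\<alpha> * \<delta> - \<beta> * \<gamma> = 1" and gf: "g = bqf_act f \<alpha> \<beta> \<gamma> \<delta>"
    using e unfolding SL2_equiv_iff by blast
  have h: "hexnorm (\<alpha> - \<gamma>) (\<beta> - \<delta>) = 1" "hexnorm \<gamma> \<delta> = 1" "hexnorm \<alpha> \<beta> = 1"
    using param_sum_act_ge(2)[OF p(1) _ _ _ d] p obtuse_equiv_param_sum[OF f g e] unfolding gf by auto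
  obtain a b c where abc: "f = (a, b, c)" by (cases f)
  then have A: "A = - b" "B = 2 * c + b" "C = 2 * a + b" using p(1) by (auto simp: bqf_params_def)
  note c = hexnorm_one[OF h(2)] hexnorm_one[OF h(3)]
  show ?thesis
    using c h d unfolding gf abc A
    by (elim insertE emptyE) (simp_all add: bqf_act_def bqf_params_def rotations_def hexnorm_def)
qed

text \<open>A vanishing first parameter leaves one norm unconstrained and admits further matrices.
  These realise the transpositions too, because \<open>b = 0\<close> makes the form invariant under
  a change of sign of y.\<close>

lemma params_equiv_zero_first:
  assumes f: "f \<in> obtuse_forms N" and g: "g \<in> obtuse_forms N" and e: "bqf_SL2_equiv f g"
    and p: "bqf_params f = (0, B, C)" "B > 0" "C > 0"
  shows "bqf_params g \<in> arrangements (0, B, C)"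
proof -
  obtain \<alpha> \<beta> \<gamma> \<delta> where d: "\<alpha> * \<delta> - \<beta> * \<gamma> = 1" and gf: "g = bqf_act f \<alpha> \<beta> \<gamma> \<delta>"
    using e unfolding SL2_equiv_iff by blast
  have h: "hexnorm \<gamma> \<delta> = 1" "hexnorm \<alpha> \<beta> = 1"
    using param_sum_act_ge(2)[OF p(1) _ _ _ d] p obtuse_equiv_param_sum[OF f g e] unfolding gf by auto
  obtain a b c where abc: "f = (a, b, c)" by (cases f)
  then have A: "b = 0" "B = 2 * c" "C = 2 * a" using p(1) by (auto simp: bqf_params_def)
  note c = hexnorm_one[OF h(1)] hexnorm_one[OF h(2)]
  have "bqf_params g \<in> arrangements (0, B, C) \<or> fst (bqf_params g) < 0 \<or> fst (snd (bqf_params g)) < 0 \<or> snd (snd (bqf_params g)) < 0"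
    using c h d p(2,3) unfolding gf abc A
    by (elim insertE emptyE) (simp_all add: bqf_act_def bqf_params_def arrangements_def hexnorm_def)
  then show ?thesis using g by (auto simp: obtuse_forms_def)
qed

lemma bqf_params_inj: "bqf_params f = bqf_params g \<Longrightarrow> f = g"
  by (cases f, cases g) (auto simp: bqf_params_def)

lemma obtuse_rotate:
  assumes f: "f \<in> obtuse_forms N" and p: "bqf_params f = (A, B, C)"
  shows "\<exists>g \<in> obtuse_forms N. bqf_SL2_equiv f g \<and> bqf_params g = (B, C, A)"
proof -
  \<comment> \<open>This matrix sends (1,0) to (0,1) and (0,1) to (-1,-1), a cyclic rotation of the
    superbase.\<close>
  let ?g = "bqf_act f 0 (- 1) 1 (- 1)"
  have d: "0 * (- 1) - (- 1) * 1 = (1::int)" by simp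
  have "bqf_params ?g = (B, C, A)" using p by (cases f) (auto simp: bqf_params_def bqf_act_def)
  moreover have "?g \<in> posdef_forms N" using f by (intro act_in_posdef_forms[OF _ d]) (simp add: obtuse_forms_def)
  moreover have "bqf_SL2_equiv f ?g" unfolding SL2_equiv_iff using d by blast
  ultimately show ?thesis using f p by (intro bexI[of _ ?g]) (simp_all add: obtuse_forms_def)
qed

lemma obtuse_swap:
  assumes f: "f \<in> obtuse_forms N" and p: "bqf_params f = (0, B, C)"
  shows "\<exists>g \<in> obtuse_forms N. bqf_SL2_equiv f g \<and> bqf_params g = (0, C, B)"
proof -
  \<comment> \<open>A quarter turn, which exchanges the outer coefficients and negates the middle
    one, here 0.\<close>
  let ?g = "bqf_act f 0 (- 1) 1 0"
  have d: "0 * 0 - (- 1) * 1 = (1::int)" by simp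
  have "bqf_params ?g = (0, C, B)" using p by (cases f) (auto simp: bqf_params_def bqf_act_def)
  moreover have "?g \<in> posdef_forms N" using f by (intro act_in_posdef_forms[OF _ d]) (simp add: obtuse_forms_def)
  moreover have "bqf_SL2_equiv f ?g" unfolding SL2_equiv_iff using d by blast
  ultimately show ?thesis using f p by (intro bexI[of _ ?g]) (simp_all add: obtuse_forms_def)
qed

section \<open>Obtuse forms in one class and its weight\<close>

definition obtuse_class :: "nat \<Rightarrow> bqf \<Rightarrow> bqf set" where
  "obtuse_class N f = {g \<in> obtuse_forms N. bqf_SL2_equiv f g}"

definition strict_obtuse_forms :: "nat \<Rightarrow> bqf set" where
  "strict_obtuse_forms N = {f \<in> obtuse_forms N. bqf_params f \<in> pos_triples}"

lemma params_obtuse_class_strict: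
  assumes f: "f \<in> obtuse_forms N" and p: "bqf_params f = (A, B, C)" "A > 0" "B > 0" "C > 0"
  shows "bqf_params ` obtuse_class N f = rotations (A, B, C)"
proof (intro subset_antisym subsetI)
  fix t assume "t \<in> rotations (A, B, C)"
  obtain g where g: "g \<in> obtuse_forms N" "bqf_SL2_equiv f g" "bqf_params g = (B, C, A)"
    using obtuse_rotate[OF f p(1)] by blast
  obtain h where h: "h \<in> obtuse_forms N" "bqf_SL2_equiv g h" "bqf_params h = (C, A, B)"
    using obtuse_rotate[OF g(1,3)] by blast
  have "bqf_SL2_equiv f h" using g(2) h(2) by (rule SL2_equiv_trans)
  then have "{f, g, h} \<subseteq> obtuse_class N f" using f g h SL2_equiv_refl by (simp add: obtuse_class_def)
  then have "bqf_params ` {f, g, h} \<subseteq> bqf_params ` obtuse_class N f" by (rule image_mono)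
  then show "t \<in> bqf_params ` obtuse_class N f"
    using \<open>t \<in> rotations (A, B, C)\<close> p(1) g(3) h(3) by (auto simp: rotations_def)
qed (use params_equiv_strict[OF f _ _ p] in \<open>auto simp: obtuse_class_def\<close>)

lemma params_obtuse_class_zero:
  assumes f: "f \<in> obtuse_forms N" and p: "bqf_params f = (0, B, C)" "B > 0" "C > 0"
  shows "bqf_params ` obtuse_class N f = arrangements (0, B, C)"
proof (intro subset_antisym subsetI)
  fix t assume t: "t \<in> arrangements (0, B, C)"
  have three: "rotations (0, X, Y) \<subseteq> bqf_params ` obtuse_class N f"
    if g0: "g0 \<in> obtuse_class N f" "bqf_params g0 = (0, X, Y)" for g0 X Y
  proof -
    have g: "g0 \<in> obtuse_forms N" "bqf_SL2_equiv f g0" using g0 by (auto simp: obtuse_class_def)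
    obtain g1 where g1: "g1 \<in> obtuse_forms N" "bqf_SL2_equiv g0 g1" "bqf_params g1 = (X, Y, 0)"
      using obtuse_rotate[OF g(1) g0(2)] by blast
    obtain g2 where g2: "g2 \<in> obtuse_forms N" "bqf_SL2_equiv g1 g2" "bqf_params g2 = (Y, 0, X)"
      using obtuse_rotate[OF g1(1,3)] by blast
    have "bqf_SL2_equiv f g1" using g(2) g1(2) by (rule SL2_equiv_trans)
    moreover from this have "bqf_SL2_equiv f g2" using g2(2) by (rule SL2_equiv_trans)
    ultimately have "{g0, g1, g2} \<subseteq> obtuse_class N f" using g g1 g2 by (simp add: obtuse_class_def)
    then have "bqf_params ` {g0, g1, g2} \<subseteq> bqf_params ` obtuse_class N f" by (rule image_mono)
    then show ?thesis using g0(2) g1(3) g2(3) by (auto simp: rotations_def)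
  qed
  have "f \<in> obtuse_class N f" using f SL2_equiv_refl by (simp add: obtuse_class_def)
  note r1 = three[OF this p(1)]
  obtain g where "g \<in> obtuse_class N f" "bqf_params g = (0, C, B)"
    using obtuse_swap[OF f p(1)] by (auto simp: obtuse_class_def)
  note r2 = three[OF this]
  show "t \<in> bqf_params ` obtuse_class N f"
    using t r1 r2 by (auto simp: arrangements_def rotations_def)
qed (use params_equiv_zero_first[OF f _ _ p] in \<open>auto simp: obtuse_class_def\<close>)

lemma card_params_image: "card (bqf_params ` X) = card X"
  by (rule card_image) (use bqf_params_inj in \<open>auto simp: inj_on_def\<close>)

lemma posdef_first_pos: "(a, b, c) \<in> posdef_forms N \<Longrightarrow> a > 0"
proof -
  assume "(a, b, c) \<in> posdef_forms N"
  then have "\<forall>x y. (x, y) \<noteq> (0, 0) \<longrightarrow> bqf_eval (a, b, c) x y > 0"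
    by (simp add: posdef_forms_def bqf_posdef_def)
  from this[rule_format, of 1 0] show ?thesis by simp
qed

lemma square_form_in_class:
  assumes "(a, 0, a) \<in> form_rel N `` {f}"
  shows "(a, 0, a) \<in> obtuse_class N f" "a > 0"
proof -
  show "a > 0" using assms posdef_first_pos[of a 0 a N] by (auto simp: form_rel_def)
  then show "(a, 0, a) \<in> obtuse_class N f"
    using assms by (auto simp: form_rel_def obtuse_class_def obtuse_forms_def bqf_params_def)
qed

lemma hexagonal_forms_equiv: "bqf_SL2_equiv (a, a, a) (a, - a, a)"
  unfolding SL2_equiv_iff by (rule exI[of _ 0], rule exI[of _ "- 1"], rule exI[of _ 1], rule exI[of _ 0]) (simp add: bqf_act_def)

text \<open>The form \<open>(a, a, a)\<close> has the negative parameter \<open>- a\<close> and is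
  not obtuse; \<open>(a, - a, a)\<close>, with three equal parameters, represents its class among
  the obtuse forms.\<close>

lemma hexagonal_form_in_class:
  assumes "(a, a, a) \<in> form_rel N `` {f}"
  shows "(a, - a, a) \<in> obtuse_class N f" "a > 0"
proof -
  show a: "a > 0" using assms posdef_first_pos[of a a a N] by (auto simp: form_rel_def)
  have "bqf_act (a, a, a) 0 (- 1) 1 0 \<in> posdef_forms N"
    by (rule act_in_posdef_forms) (use assms in \<open>auto simp: form_rel_def\<close>)
  then have "(a, - a, a) \<in> posdef_forms N" by (simp add: bqf_act_def)
  moreover have "bqf_SL2_equiv f (a, - a, a)"
    using assms SL2_equiv_trans[OF _ hexagonal_forms_equiv, of f a] by (simp add: form_rel_def)
  ultimately show "(a, - a, a) \<in> obtuse_class N f"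
    using a by (auto simp: obtuse_class_def obtuse_forms_def bqf_params_def)
qed

lemma class_weight_strict:
  assumes f: "f \<in> obtuse_forms N" and p: "bqf_params f = (A, B, C)" "A > 0" "B > 0" "C > 0"
  shows "class_weight (form_rel N `` {f}) = (if A = B \<and> B = C then 1 / 3 else 1)"
proof -
  note im = params_obtuse_class_strict[OF f p]
  have 1: "(a, 0, a) \<notin> form_rel N `` {f}" for a
  proof
    assume "(a, 0, a) \<in> form_rel N `` {f}"
    from square_form_in_class[OF this] have "bqf_params (a, 0, a) \<in> rotations (A, B, C)"
      unfolding im[symmetric] by blast
    then show False using p by (auto simp: rotations_def bqf_params_def)
  qed
  have 2: "(\<exists>a. (a, a, a) \<in> form_rel N `` {f}) \<longleftrightarrow> A = B \<and> B = C"
  proof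
    assume "\<exists>a. (a, a, a) \<in> form_rel N `` {f}"
    then obtain a where "(a, a, a) \<in> form_rel N `` {f}" by blast
    from hexagonal_form_in_class[OF this] have "bqf_params (a, - a, a) \<in> rotations (A, B, C)"
      unfolding im[symmetric] by blast
    then show "A = B \<and> B = C" by (auto simp: rotations_def bqf_params_def)
  next
    assume "A = B \<and> B = C"
    then have fA: "f = (A, - A, A)" using p(1) by (cases f) (auto simp: bqf_params_def)
    have fS: "f \<in> posdef_forms N" using f by (simp add: obtuse_forms_def)
    then have "bqf_act f 0 (- 1) 1 0 \<in> posdef_forms N" by (rule act_in_posdef_forms) simp
    then have "(A, A, A) \<in> posdef_forms N" by (simp add: fA bqf_act_def)
    then have "(A, A, A) \<in> form_rel N `` {f}"
      using fS SL2_equiv_sym[OF hexagonal_forms_equiv[of A]] by (simp add: form_rel_def fA)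
    then show "\<exists>a. (a, a, a) \<in> form_rel N `` {f}" by blast
  qed
  show ?thesis using 1 2 by (simp add: class_weight_def)
qed

lemma class_weight_zero:
  assumes f: "f \<in> obtuse_forms N" and p: "bqf_params f = (0, B, C)" "B > 0" "C > 0"
  shows "class_weight (form_rel N `` {f}) = (if B = C then 1 / 2 else 1)"
proof -
  note im = params_obtuse_class_zero[OF f p]
  have 1: "(\<exists>a. (a, 0, a) \<in> form_rel N `` {f}) \<longleftrightarrow> B = C"
  proof
    assume "\<exists>a. (a, 0, a) \<in> form_rel N `` {f}"
    then obtain a where "(a, 0, a) \<in> form_rel N `` {f}" by blast
    from square_form_in_class[OF this] have "bqf_params (a, 0, a) \<in> arrangements (0, B, C)" "a > 0"
      unfolding im[symmetric] by blast+
    then show "B = C" using p by (auto simp: arrangements_def bqf_params_def)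
  next
    assume "B = C"
    then obtain a where "f = (a, 0, a)" using p(1) by (cases f) (auto simp: bqf_params_def)
    then show "\<exists>a. (a, 0, a) \<in> form_rel N `` {f}"
      using f SL2_equiv_refl by (auto simp: form_rel_def obtuse_forms_def)
  qed
  have 2: "(a, a, a) \<notin> form_rel N `` {f}" for a
  proof
    assume "(a, a, a) \<in> form_rel N `` {f}"
    from hexagonal_form_in_class[OF this] have "bqf_params (a, - a, a) \<in> arrangements (0, B, C)" "a > 0"
      unfolding im[symmetric] by blast+
    then show False using p by (auto simp: arrangements_def bqf_params_def)
  qed
  show ?thesis using 1 2 by (simp add: class_weight_def)
qed

lemma e2_params: "f \<in> posdef_forms N \<Longrightarrow> e2 (bqf_params f) = int N"
  by (cases f) (auto simp: posdef_forms_def bqf_params_def power2_eq_square algebra_simps)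

text \<open>Positive parameters: 3 + 3 forms, or 1 + 1 if all are equal, where the weight is 1/3.
  One zero parameter: 6 + 0 forms, or 3 + 0 if the other two are equal, where the weight is 1/2.
  Counting strict forms twice is what makes these cases uniform.\<close>

lemma six_class_weight:
  assumes "N > 0" and f: "f \<in> obtuse_forms N"
  shows "6 * class_weight (form_rel N `` {f})
     = of_nat (card (obtuse_class N f) + card (obtuse_class N f \<inter> strict_obtuse_forms N))"
proof -
  have strict_im: "bqf_params ` (obtuse_class N f \<inter> strict_obtuse_forms N) = bqf_params ` obtuse_class N f \<inter> pos_triples" for f
    by (auto simp: strict_obtuse_forms_def obtuse_class_def)
  have cards: "card (obtuse_class N f) = card (bqf_params ` obtuse_class N f)"
    "card (obtuse_class N f \<inter> strict_obtuse_forms N) = card (bqf_params ` obtuse_class N f \<inter> pos_triples)" for f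
    by (simp_all only: card_params_image strict_im[symmetric])
  have zero: "6 * class_weight (form_rel N `` {f})
     = of_nat (card (obtuse_class N f) + card (obtuse_class N f \<inter> strict_obtuse_forms N))"
    if f: "f \<in> obtuse_forms N" and p: "bqf_params f = (0, B, C)" for f B C
  proof -
    have "B * C = int N" "B \<ge> 0" "C \<ge> 0" using f p e2_params[of f N] by (auto simp: obtuse_forms_def)
    moreover from this(1) have "B \<noteq> 0" "C \<noteq> 0" using assms(1) by auto
    ultimately have BC: "B > 0" "C > 0" by linarith+
    have "arrangements (0, B, C) \<inter> pos_triples = {}" by (auto simp: arrangements_def pos_triples_def)
    moreover have "card (arrangements (0, B, C)) = (if B = C then 3 else 6)"
      using BC by (simp add: arrangements_def card_insert_if)
    ultimately show ?thesis
      unfolding class_weight_zero[OF f p BC] cards params_obtuse_class_zero[OF f p BC] by simp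
  qed
  have transfer: "form_rel N `` {f} = form_rel N `` {g} \<and> obtuse_class N f = obtuse_class N g"
    if "f \<in> obtuse_forms N" "g \<in> obtuse_forms N" "bqf_SL2_equiv f g" for f g
  proof
    show "form_rel N `` {f} = form_rel N `` {g}"
      by (rule equiv_class_eq[OF equiv_form_rel]) (use that in \<open>simp add: form_rel_def obtuse_forms_def\<close>)
    have "bqf_SL2_equiv f h \<longleftrightarrow> bqf_SL2_equiv g h" for h
      using that(3) SL2_equiv_trans SL2_equiv_sym by blast
    then show "obtuse_class N f = obtuse_class N g" by (simp add: obtuse_class_def)
  qed
  obtain A B C where p: "bqf_params f = (A, B, C)" by (cases "bqf_params f")
  have nn: "A \<ge> 0" "B \<ge> 0" "C \<ge> 0" using f p by (auto simp: obtuse_forms_def)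
  obtain g where g: "g \<in> obtuse_forms N" "bqf_SL2_equiv f g" "bqf_params g = (B, C, A)"
    using obtuse_rotate[OF f p] by blast
  obtain h where h: "h \<in> obtuse_forms N" "bqf_SL2_equiv g h" "bqf_params h = (C, A, B)"
    using obtuse_rotate[OF g(1,3)] by blast
  consider "A = 0" | "B = 0" | "C = 0" | "A > 0" "B > 0" "C > 0" using nn by linarith
  then show ?thesis
  proof cases
    case 1 then show ?thesis using zero[OF f] p by simp
  next
    case 2 then show ?thesis using zero[OF g(1)] g(3) transfer[OF f g(1,2)] by simp
  next
    case 3 then show ?thesis
      using zero[OF h(1)] h(3) transfer[OF f h(1) SL2_equiv_trans[OF g(2) h(2)]] by simp
  next
    case 4
    have "rotations (A, B, C) \<inter> pos_triples = rotations (A, B, C)"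
      using 4 by (auto simp: rotations_def pos_triples_def)
    moreover have "card (rotations (A, B, C)) = (if A = B \<and> B = C then 1 else 3)"
    proof (cases "A = B \<and> B = C")
      case False
      then have "(A, B, C) \<noteq> (B, C, A)" "(B, C, A) \<noteq> (C, A, B)" "(A, B, C) \<noteq> (C, A, B)" by blast+
      then show ?thesis using False
        by (simp only: rotations_def prod.case card_insert_if finite.intros insert_iff empty_iff if_False simp_thms) simp
    qed (simp add: rotations_def)
    ultimately show ?thesis
      unfolding class_weight_strict[OF f p 4] cards params_obtuse_class_strict[OF f p 4] by simp
  qed
qed

section \<open>Forms as triples of equal parity\<close>

definition same_parity :: "itriple \<Rightarrow> bool" where
  "same_parity t = (case t of (A, B, C) \<Rightarrow> even (A - B) \<and> even (B - C))"

text \<open>Equal parity is what makes the outer coefficients (A + C)/2 and (A + B)/2 integral.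
  Positive definiteness follows from Selling's sum of squares, since at most one parameter
  vanishes.\<close>

lemma bij_params:
  assumes "N > 0"
  shows "bij_betw bqf_params (obtuse_forms N) {t \<in> nonneg_triples. e2 t = int N \<and> same_parity t}"
proof (rule bij_betw_imageI)
  show "inj_on bqf_params (obtuse_forms N)" using bqf_params_inj by (auto simp: inj_on_def)
  show "bqf_params ` obtuse_forms N = {t \<in> nonneg_triples. e2 t = int N \<and> same_parity t}"
  proof (intro subset_antisym subsetI)
    fix t assume "t \<in> bqf_params ` obtuse_forms N"
    then obtain f where f: "f \<in> obtuse_forms N" "t = bqf_params f" by blast
    have e: "e2 t = int N" using f e2_params by (simp add: obtuse_forms_def)
    obtain A B C where t: "t = (A, B, C)" by (cases t)
    have "A \<ge> 0" "B \<ge> 0" "C \<ge> 0" using f t by (auto simp: obtuse_forms_def)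
    moreover have "A > 0 \<or> B > 0" "B > 0 \<or> C > 0" "A > 0 \<or> C > 0"
    proof -
      have "\<not> (A = 0 \<and> B = 0)" "\<not> (B = 0 \<and> C = 0)" "\<not> (A = 0 \<and> C = 0)"
        using e \<open>N > 0\<close> t by auto
      then show "A > 0 \<or> B > 0" "B > 0 \<or> C > 0" "A > 0 \<or> C > 0"
        using calculation by linarith+
    qed
    moreover have "same_parity t" using f(2) by (cases f) (auto simp: bqf_params_def same_parity_def)
    ultimately show "t \<in> {t \<in> nonneg_triples. e2 t = int N \<and> same_parity t}" using e by (simp add: t nonneg_triples_def)
  next
    fix t assume t: "t \<in> {t \<in> nonneg_triples. e2 t = int N \<and> same_parity t}"
    obtain A B C where abc: "t = (A, B, C)" by (cases t)
    have ev: "even (A + C)" "even (A + B)" using t by (auto simp: abc same_parity_def)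
    obtain a where a: "A + C = 2 * a" using ev(1) by (elim evenE)
    obtain c where c: "A + B = 2 * c" using ev(2) by (elim evenE)
    note ac = a c
    have A: "B = 2 * c - A" "C = 2 * a - A" using ac by auto
    let ?f = "(a, - A, c)"
    have p: "bqf_params ?f = t" by (simp add: bqf_params_def abc A)
    have nn: "A \<ge> 0" "B \<ge> 0" "C \<ge> 0" "A > 0 \<or> B > 0" "B > 0 \<or> C > 0" "A > 0 \<or> C > 0"
      using t by (auto simp: abc nonneg_triples_def)
    have "bqf_posdef ?f"
      unfolding bqf_posdef_def
    proof (intro allI impI)
      fix x y :: int assume xy: "(x, y) \<noteq> (0, 0)"
      have "2 * bqf_eval ?f x y = A * (x - y)\<^sup>2 + B * y\<^sup>2 + C * x\<^sup>2"
        unfolding A by (simp add: power2_eq_square algebra_simps)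
      moreover have "0 < A * (x - y)\<^sup>2 + B * y\<^sup>2 + C * x\<^sup>2"
      proof -
        have n: "0 \<le> A * (x - y)\<^sup>2" "0 \<le> B * y\<^sup>2" "0 \<le> C * x\<^sup>2" using nn by auto
        have "A * (x - y)\<^sup>2 > 0 \<or> B * y\<^sup>2 > 0 \<or> C * x\<^sup>2 > 0"
          using nn xy by (cases "x = 0"; cases "y = 0") (auto simp: zero_less_mult_iff)
        with n show ?thesis by linarith
      qed
      ultimately show "0 < bqf_eval ?f x y" by linarith
    qed
    moreover have "bqf_discr ?f = - int N"
      using t unfolding abc A by (auto simp: power2_eq_square algebra_simps)
    ultimately have "?f \<in> obtuse_forms N"
      using nn p by (simp add: obtuse_forms_def posdef_forms_def abc)
    then show "t \<in> bqf_params ` obtuse_forms N" using p by blast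
  qed
qed

lemma finite_obtuse_forms: "N > 0 \<Longrightarrow> finite (obtuse_forms N)"
proof -
  assume "N > 0"
  have "finite {t \<in> nonneg_triples. e2 t = int N \<and> same_parity t}"
    by (rule finite_subset[OF _ finite_nonneg_triples[of N]]) auto
  then show ?thesis using bij_betw_finite[OF bij_params[OF \<open>N > 0\<close>]] by blast
qed

text \<open>The obtuse forms in a given class are a fibre of the class map. Summing
  \<open>six_class_weight\<close> over the classes therefore counts every obtuse form once and every
  strict one once more.\<close>

lemma six_hurwitz_obtuse:
  assumes "N > 0" "N mod 4 = 0 \<or> N mod 4 = 3"
  shows "6 * hurwitz_class_number N = of_nat (card (obtuse_forms N) + card (strict_obtuse_forms N))"
proof -
  let ?cl = "\<lambda>f. form_rel N `` {f}"
  have fin: "finite (obtuse_forms N)" by (rule finite_obtuse_forms[OF assms(1)])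
  have sub: "strict_obtuse_forms N \<subseteq> obtuse_forms N" by (auto simp: strict_obtuse_forms_def)
  have Q: "form_classes N = ?cl ` obtuse_forms N"
  proof (intro subset_antisym subsetI)
    fix C assume "C \<in> form_classes N"
    then obtain f where f: "f \<in> posdef_forms N" "C = ?cl f"
      by (auto simp: form_classes_def form_rel_def quotient_def)
    obtain g where g: "g \<in> obtuse_forms N" "bqf_SL2_equiv f g" using exists_obtuse_form[OF f(1)] by blast
    have "?cl f = ?cl g"
      by (rule equiv_class_eq[OF equiv_form_rel]) (use f g in \<open>simp add: form_rel_def obtuse_forms_def\<close>)
    then show "C \<in> ?cl ` obtuse_forms N" using f g by blast
  next
    fix C assume "C \<in> ?cl ` obtuse_forms N"
    then show "C \<in> form_classes N"
      by (auto simp: form_classes_def form_rel_def quotient_def obtuse_forms_def)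
  qed
  have fib: "{g \<in> X. ?cl g = ?cl f} = obtuse_class N f \<inter> X" if "f \<in> obtuse_forms N" "X \<subseteq> obtuse_forms N" for f X
  proof -
    have "?cl g = ?cl f \<longleftrightarrow> bqf_SL2_equiv f g" if "g \<in> X" for g
      using eq_equiv_class_iff[OF equiv_form_rel[of N], of f g] that \<open>f \<in> obtuse_forms N\<close> \<open>X \<subseteq> obtuse_forms N\<close>
      by (auto simp: form_rel_def obtuse_forms_def)
    then show ?thesis using that by (auto simp: obtuse_class_def)
  qed
  have group: "(\<Sum>C\<in>form_classes N. card {g \<in> X. ?cl g = C}) = card X" if "X \<subseteq> obtuse_forms N" for X
    unfolding Q card_eq_sum
    by (rule sum.group) (use that fin finite_subset[OF that fin] in auto)
  have "6 * class_weight C = of_nat (card {g \<in> obtuse_forms N. ?cl g = C} + card {g \<in> strict_obtuse_forms N. ?cl g = C})"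
    if C: "C \<in> form_classes N" for C
  proof -
    obtain f where f: "f \<in> obtuse_forms N" "C = ?cl f" using C unfolding Q by blast
    have "obtuse_class N f \<inter> obtuse_forms N = obtuse_class N f" by (auto simp: obtuse_class_def)
    then show ?thesis
      unfolding f(2) fib[OF f(1) order_refl] fib[OF f(1) sub] using six_class_weight[OF assms(1) f(1)] by simp
  qed
  then have "6 * (\<Sum>C\<in>form_classes N. class_weight C)
      = of_nat ((\<Sum>C\<in>form_classes N. card {g \<in> obtuse_forms N. ?cl g = C})
              + (\<Sum>C\<in>form_classes N. card {g \<in> strict_obtuse_forms N. ?cl g = C}))"
    by (simp add: sum_distrib_left sum.distrib)
  then show ?thesis
    using assms by (auto simp: hurwitz_class_number_def group[OF order_refl] group[OF sub])
qed

theorem six_hurwitz: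
  assumes "N > 0" "N mod 4 = 0 \<or> N mod 4 = 3"
  shows "6 * hurwitz_class_number N
     = of_nat (card {t \<in> nonneg_triples. e2 t = int N \<and> same_parity t}
             + card {t \<in> pos_triples. e2 t = int N \<and> same_parity t})"
proof -
  note b = bij_params[OF assms(1)]
  have "bqf_params ` strict_obtuse_forms N = bqf_params ` obtuse_forms N \<inter> pos_triples"
    by (auto simp: strict_obtuse_forms_def)
  also have "\<dots> = {t \<in> pos_triples. e2 t = int N \<and> same_parity t}"
    unfolding bij_betw_imp_surj_on[OF b] using triples_subset by auto
  finally have "card {t \<in> pos_triples. e2 t = int N \<and> same_parity t} = card (strict_obtuse_forms N)"
    by (metis card_params_image)
  with bij_betw_same_card[OF b] show ?thesis using six_hurwitz_obtuse[OF assms] by simp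
qed

section \<open>Parity analysis\<close>

text \<open>Three odd entries would make \<open>e2\<close> odd. Halving then relates H(4n) to all
  triples of value \<open>n\<close>, whatever their parities.\<close>

lemma same_parity_even:
  assumes "e2 t = int (4 * n)" "same_parity t"
  shows "\<exists>a b c. t = (2 * a, 2 * b, 2 * c)"
proof -
  obtain A B C where t: "t = (A, B, C)" by (cases t)
  have "even (A * B + B * C + C * A)" using assms(1) by (simp add: t)
  then have "even A" "even B" "even C" using assms(2) by (auto simp: t same_parity_def)
  then show ?thesis unfolding t by (elim evenE) blast
qed

lemma card_double_triples:
  assumes X: "\<And>a b c. (2 * a, 2 * b, 2 * c) \<in> X \<longleftrightarrow> (a, b, c) \<in> X"
  shows "card {t \<in> X. e2 t = int (4 * n) \<and> same_parity t} = card {t \<in> X. e2 t = int n}"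
proof -
  let ?d = "\<lambda>(a::int, b::int, c::int). (2 * a, 2 * b, 2 * c)"
  have "bij_betw ?d {t \<in> X. e2 t = int n} {t \<in> X. e2 t = int (4 * n) \<and> same_parity t}"
  proof (rule bij_betw_imageI)
    show "inj_on ?d {t \<in> X. e2 t = int n}" by (auto simp: inj_on_def)
    show "?d ` {t \<in> X. e2 t = int n} = {t \<in> X. e2 t = int (4 * n) \<and> same_parity t}"
    proof (intro subset_antisym subsetI)
      fix t assume t: "t \<in> {t \<in> X. e2 t = int (4 * n) \<and> same_parity t}"
      then obtain a b c where abc: "t = (2 * a, 2 * b, 2 * c)" using same_parity_even by blast
      then have "(a, b, c) \<in> {t \<in> X. e2 t = int n}" using t X by auto
      then show "t \<in> ?d ` {t \<in> X. e2 t = int n}" unfolding abc by force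
    qed (auto simp: X same_parity_def)
  qed
  then show ?thesis by (simp add: bij_betw_same_card)
qed

lemma six_hurwitz_four_times:
  assumes "n > 0"
  shows "6 * hurwitz_class_number (4 * n)
     = of_nat (card {t \<in> nonneg_triples. e2 t = int n} + card {t \<in> pos_triples. e2 t = int n})"
  using six_hurwitz[of "4 * n"] assms
    card_double_triples[of nonneg_triples n] card_double_triples[of pos_triples n]
  by (simp add: nonneg_triples_def pos_triples_def)

definition odd_triples :: "nat \<Rightarrow> itriple set" where
  "odd_triples n = {(a, b, c). odd a \<and> odd b \<and> odd c \<and> a > 0 \<and> b > 0 \<and> c > 0 \<and> a * b + b * c + c * a = int n}"

text \<open>Odd \<open>n\<close> forces entries of equal parity to be odd, hence nonzero, so both
  counts in \<open>six_hurwitz\<close> are the same.\<close>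

lemma three_hurwitz_odd:
  assumes "n mod 8 = 3"
  shows "3 * hurwitz_class_number n = of_nat (card (odd_triples n))"
proof -
  have n: "n > 0" "n mod 4 = 3" "odd n" using assms by presburger+
  have "t \<in> odd_triples n" if "t \<in> nonneg_triples" "e2 t = int n" "same_parity t" for t
  proof -
    obtain A B C where t: "t = (A, B, C)" by (cases t)
    have "odd (A * B + B * C + C * A)" using that(2) n(3) by (simp add: t)
    then have o: "odd A" "odd B" "odd C" using that(3) by (auto simp: t same_parity_def)
    then have "A \<noteq> 0" "B \<noteq> 0" "C \<noteq> 0" by auto
    then show ?thesis using that o by (auto simp: t odd_triples_def nonneg_triples_def)
  qed
  moreover have "t \<in> pos_triples \<and> e2 t = int n \<and> same_parity t" if "t \<in> odd_triples n" for t
    using that by (auto simp: odd_triples_def pos_triples_def same_parity_def)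
  ultimately have "{t \<in> nonneg_triples. e2 t = int n \<and> same_parity t} = odd_triples n"
    "{t \<in> pos_triples. e2 t = int n \<and> same_parity t} = odd_triples n"
    using triples_subset by blast+
  then show ?thesis using six_hurwitz[of n] n by simp
qed

section \<open>Congruences modulo 4 and 8\<close>

lemma mod_eq_of_eq_add_mult:
  fixes x r m k :: int
  assumes "x = r + m * k" "0 \<le> r" "r < m"
  shows "x mod m = r"
  using assms by simp

lemma square_mod_four: "(x::int)\<^sup>2 mod 4 = (if even x then 0 else 1)"
proof (cases "even x")
  case True
  then obtain k where "x = 2 * k" by (elim evenE)
  then have "x\<^sup>2 = 4 * k\<^sup>2" by (simp add: power2_eq_square)
  then show ?thesis using True by simp
next
  case False
  then obtain k where k: "x = 2 * k + 1" by (elim oddE)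
  have "x\<^sup>2 = 1 + 4 * (k\<^sup>2 + k)" unfolding k by (simp add: power2_eq_square algebra_simps)
  then have "x\<^sup>2 mod 4 = 1" by (rule mod_eq_of_eq_add_mult) simp_all
  then show ?thesis using False by simp
qed

lemma odd_square_mod_eight: "odd (x::int) \<Longrightarrow> x\<^sup>2 mod 8 = 1"
proof -
  assume "odd x"
  then obtain k where k: "x = 2 * k + 1" by (elim oddE)
  obtain j where j: "k * (k + 1) = 2 * j" by (elim evenE[of "k * (k + 1)", rotated]) simp
  have "x\<^sup>2 = 1 + 4 * (k * (k + 1))" unfolding k by (simp add: power2_eq_square algebra_simps)
  then have "x\<^sup>2 = 1 + 8 * j" unfolding j by simp
  then show ?thesis by (rule mod_eq_of_eq_add_mult) simp_all
qed

lemma e2_three_odd: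
  assumes "odd (a::int)" "odd b" "odd c"
  shows "(a * b + b * c + c * a) mod 4 = 3"
proof -
  from assms obtain i j k where "a = 2 * i + 1" "b = 2 * j + 1" "c = 2 * k + 1" by (elim oddE) blast
  then have "a * b + b * c + c * a = 3 + 4 * (i * j + j * k + k * i + i + j + k)" by (simp add: algebra_simps)
  then show ?thesis by (rule mod_eq_of_eq_add_mult) simp_all
qed

text \<open>Three even entries give 0 and three odd ones 3 modulo 4, so the parities are mixed. Two
  odd entries give an odd value and an even sum, one odd entry an even value and an odd sum.\<close>

lemma e2_parity:
  assumes "n mod 4 = 1 \<or> n mod 4 = 2" "a * b + b * c + c * a = int n"
  shows "even (a + b + c) \<longleftrightarrow> odd n"
proof -
  have m: "int n mod 4 = 1 \<or> int n mod 4 = 2" using assms(1) by presburger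
  have par: "even (int n) \<longleftrightarrow> int n mod 4 = 2" using m by presburger
  have e4: "int n mod 4 = 0" if ev: "even a" "even b" "even c"
  proof -
    from ev obtain i j k where "a = 2 * i" "b = 2 * j" "c = 2 * k" by (elim evenE) blast
    then have "int n = 4 * (i * j + j * k + k * i)" using assms(2) by (simp add: algebra_simps)
    then show ?thesis by simp
  qed
  have "\<not> (odd a \<and> odd b \<and> odd c)"
  proof
    assume "odd a \<and> odd b \<and> odd c"
    then have "(a * b + b * c + c * a) mod 4 = 3" by (intro e2_three_odd) auto
    then show False using m unfolding assms(2) by simp
  qed
  moreover have "\<not> (even a \<and> even b \<and> even c)" using e4 m by auto
  moreover have "even (a * b + b * c + c * a) \<longleftrightarrow> even n" using assms(2) by simp
  ultimately show ?thesis by auto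
qed

lemma signed_r3: "(\<Sum>(x, y, z) | x\<^sup>2 + y\<^sup>2 + z\<^sup>2 = int n. (- 1) powi (x + y + z) :: real) = (- 1) ^ n * of_nat (r3 n)"
proof -
  have "(\<Sum>(x, y, z) | x\<^sup>2 + y\<^sup>2 + z\<^sup>2 = int n. (- 1) powi (x + y + z) :: real)
      = (\<Sum>t | case t of (x, y, z) \<Rightarrow> x\<^sup>2 + y\<^sup>2 + z\<^sup>2 = int n. (- 1) ^ n)"
  proof (rule sum.cong)
    fix t assume "t \<in> {(x, y, z). x\<^sup>2 + y\<^sup>2 + z\<^sup>2 = int n}"
    then obtain x y z where t: "t = (x, y, z)" "x\<^sup>2 + y\<^sup>2 + z\<^sup>2 = int n" by auto
    have "even (x\<^sup>2 + y\<^sup>2 + z\<^sup>2) \<longleftrightarrow> even (x + y + z)" by auto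
    then have "even (x + y + z) \<longleftrightarrow> even n" unfolding t(2) by simp
    then show "(case t of (x, y, z) \<Rightarrow> ((- 1) powi (x + y + z) :: real)) = (- 1) ^ n"
      by (simp add: t(1) powi_minus_one_odd_even del: even_add)
  qed simp
  then show ?thesis by (simp add: r3_def)
qed

text \<open>By \<open>e2_parity\<close> every triple has the sign opposite to that of the
  three-square side. This cancels the minus in \<open>theta_cube_coefficient\<close> and turns both
  sides into plain counts.\<close>

lemma r3_eq_twelve_hurwitz:
  assumes "n mod 4 = 1 \<or> n mod 4 = 2"
  shows "of_nat (r3 n) = 12 * hurwitz_class_number (4 * n)"
proof -
  have n: "n > 0" using assms by (cases n) auto
  let ?A = "\<lambda>X. {t \<in> X. e2 t = int n}"
  have "tsign t = - ((- 1) ^ n)" if "e2 t = int n" for t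
  proof -
    obtain a b c where t: "t = (a, b, c)" by (cases t)
    show ?thesis using e2_parity[OF assms, of a b c] that
      by (simp add: t powi_minus_one_odd_even del: even_add)
  qed
  then have s: "(\<Sum>t | t \<in> X \<and> e2 t = int n. tsign t) = - ((- 1) ^ n) * real (card (?A X))" for X
    by (subst sum.cong[OF refl, of _ _ "\<lambda>_. - ((- 1) ^ n)"]) auto
  have "(- 1) ^ n * real (r3 n) = (- 1) ^ n * (2 * (real (card (?A nonneg_triples)) + real (card (?A pos_triples))))"
    using theta_cube_coefficient[OF n] unfolding signed_r3 s by (simp add: algebra_simps)
  then have "real (r3 n) = 2 * (real (card (?A nonneg_triples)) + real (card (?A pos_triples)))" by simp
  then have "real (r3 n) = real (2 * (card (?A nonneg_triples) + card (?A pos_triples)))" by simp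
  then have "r3 n = 2 * (card (?A nonneg_triples) + card (?A pos_triples))" by (simp only: of_nat_eq_iff)
  then show ?thesis using six_hurwitz_four_times[OF n] by simp
qed

section \<open>Comparison of parity types for \<open>n\<close> congruent to 3 modulo 8\<close>

definition folded_triples :: "nat \<Rightarrow> itriple set" where
  "folded_triples n = {(p, q, r). even p \<and> odd q \<and> odd r \<and> q > 0 \<and> r > 0 \<and> \<bar>p\<bar> * (q + r) + q * r = int n}"

text \<open>Three odd values would give 7 modulo 8. In the application \<open>p\<close> is half the
  difference of two entries, taken absolutely, and must serve as the even entry of a folded
  triple.\<close>

lemma half_difference_even:
  assumes "n mod 8 = 3" "odd (A::int)" "odd m" "2 * A * m + 2 * A * p + m * m + 2 * p * m = int n"
  shows "even p"
proof (rule ccontr)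
  assume "odd p"
  with assms obtain a k l where e: "A = 2 * a + 1" "m = 2 * k + 1" "p = 2 * l + 1" by (elim oddE) blast
  obtain j where j: "k * (k + 1) = 2 * j" by (elim evenE[of "k * (k + 1)", rotated]) simp
  have "int n = 4 * (k * (k + 1)) + 8 * (l * (a + k + 1) + a * k + a + k) + 7"
    unfolding assms(4)[symmetric] e by (simp add: algebra_simps)
  then have "int n = 7 + 8 * (j + l * (a + k + 1) + a * k + a + k)" unfolding j by simp
  then have "int n mod 8 = 7" by (rule mod_eq_of_eq_add_mult) simp_all
  then show False using assms(1) by presburger
qed

text \<open>Geometrically, an index-two sublattice of a lattice with obtuse superbase \<open>(A, B, C)\<close> has obtuse
  superbase \<open>(|B - C| / 2, 2 A + min B C, min B C)\<close>.\<close>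

lemma card_odd_triples_eq:
  assumes "n mod 8 = 3"
  shows "card (odd_triples n) = card {(p, q, r) \<in> folded_triples n. q > r}"
proof -
  let ?f = "\<lambda>(A, B, C). ((B - C) div 2, 2 * A + min B C, min B C)"
  \<comment> \<open>The sign of \<open>p\<close> records which of \<open>B\<close> and
    \<open>C\<close> is the larger, and \<open>q - r\<close> is \<open>2 * A\<close>.\<close>
  let ?g = "\<lambda>(p, q, r). ((q - r) div 2, r + 2 * max 0 p, r + 2 * max 0 (- p))"
  have "bij_betw ?f (odd_triples n) {(p, q, r) \<in> folded_triples n. q > r}"
  proof (rule bij_betwI[of _ _ _ ?g])
    show "?f \<in> odd_triples n \<rightarrow> {(p, q, r) \<in> folded_triples n. q > r}"
    proof
      fix t assume t: "t \<in> odd_triples n"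
      obtain A B C where abc: "t = (A, B, C)" by (cases t)
      have h: "odd A" "odd B" "odd C" "A > 0" "B > 0" "C > 0" "A * B + B * C + C * A = int n"
        using t by (auto simp: odd_triples_def abc)
      obtain d where d: "B - C = 2 * d" using h by (elim evenE[of "B - C", rotated]) simp
      define m where "m = min B C"
      have m: "odd m" "m > 0" using h by (auto simp: m_def min_def)
      have BC: "B = m + 2 * \<bar>d\<bar> \<and> C = m \<or> B = m \<and> C = m + 2 * \<bar>d\<bar>" using d by (auto simp: m_def min_def)
      then have e: "2 * A * m + 2 * A * \<bar>d\<bar> + m * m + 2 * \<bar>d\<bar> * m = int n"
        unfolding h(7)[symmetric] by (auto simp: algebra_simps)
      have "even \<bar>d\<bar>" by (rule half_difference_even[OF assms h(1) m(1) e])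
      then show "?f t \<in> {(p, q, r) \<in> folded_triples n. q > r}"
        using h m e by (auto simp: abc d folded_triples_def m_def[symmetric] algebra_simps)
    qed
    show "?g \<in> {(p, q, r) \<in> folded_triples n. q > r} \<rightarrow> odd_triples n"
    proof
      fix t assume t: "t \<in> {(p, q, r) \<in> folded_triples n. q > r}"
      obtain p q r where pqr: "t = (p, q, r)" by (cases t)
      have h: "even p" "odd q" "odd r" "q > 0" "r > 0" "\<bar>p\<bar> * (q + r) + q * r = int n" "q > r"
        using t by (auto simp: folded_triples_def pqr)
      obtain a where a: "q - r = 2 * a" using h by (elim evenE[of "q - r", rotated]) simp
      have q: "q = r + 2 * a" using a by simp
      \<comment> \<open>With \<open>a\<close> even, the entries \<open>q\<close> and
        \<open>r\<close> would agree modulo 4 and the value would be 1 modulo 4.\<close>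
      have "odd a"
      proof
        assume "even a"
        then obtain i where i: "a = 2 * i" by (elim evenE)
        obtain k where k: "r = 2 * k + 1" using h(3) by (elim oddE)
        obtain l where l: "\<bar>p\<bar> = 2 * l" using h(1) by (elim evenE[of "\<bar>p\<bar>", rotated]) simp
        have "int n = 1 + 4 * (l * (r + a) + k * k + k + i * r)"
          unfolding h(6)[symmetric] q l i k by (simp add: algebra_simps)
        then have "int n mod 4 = 1" by (rule mod_eq_of_eq_add_mult) simp_all
        then show False using assms by presburger
      qed
      moreover have "a * (r + 2 * max 0 p) + (r + 2 * max 0 p) * (r + 2 * max 0 (- p)) + (r + 2 * max 0 (- p)) * a = int n"
        unfolding h(6)[symmetric] q by (cases "p \<ge> 0") (auto simp: max_def algebra_simps)
      ultimately show "?g t \<in> odd_triples n"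
        using h a by (auto simp: pqr odd_triples_def)
    qed
    show "?g (?f t) = t" if t: "t \<in> odd_triples n" for t
    proof -
      obtain A B C where abc: "t = (A, B, C)" by (cases t)
      have "even (B - C)" using t by (auto simp: odd_triples_def abc)
      then obtain d where "B = C + 2 * d" by (metis add_diff_cancel_left' diff_add_cancel evenE add.commute)
      then show ?thesis by (auto simp: abc max_def min_def)
    qed
    show "?f (?g t) = t" if t: "t \<in> {(p, q, r) \<in> folded_triples n. q > r}" for t
    proof -
      obtain p q r where pqr: "t = (p, q, r)" by (cases t)
      have "even (q - r)" using t by (auto simp: folded_triples_def pqr)
      then obtain a where "q = r + 2 * a" by (metis add_diff_cancel_left' diff_add_cancel evenE add.commute)
      then show ?thesis by (auto simp: pqr max_def min_def)
    qed
  qed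
  then show ?thesis by (rule bij_betw_same_card)
qed

definition rotate_triple :: "itriple \<Rightarrow> itriple" where
  "rotate_triple t = (case t of (a, b, c) \<Rightarrow> (b, c, a))"

text \<open>The conditions on \<open>t\<close> and on its two rotates partition \<open>X\<close>,
  and rotation permutes the three parts.\<close>

lemma card_exactly_one_rotation:
  assumes fin: "finite X" and inv: "\<And>t. t \<in> X \<Longrightarrow> rotate_triple t \<in> X"
    and one: "\<And>t. t \<in> X \<Longrightarrow> P t \<or> P (rotate_triple t) \<or> P (rotate_triple (rotate_triple t))"
    and disj: "\<And>t. t \<in> X \<Longrightarrow> P t \<Longrightarrow> \<not> P (rotate_triple t)"
  shows "card X = 3 * card {t \<in> X. P t}"
proof -
  let ?r = rotate_triple
  have r3: "?r (?r (?r t)) = t" for t by (cases t) (simp add: rotate_triple_def)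
  have shift: "card {t \<in> X. Q (?r t)} = card {t \<in> X. Q t}" for Q
  proof (rule bij_betw_same_card)
    show "bij_betw ?r {t \<in> X. Q (?r t)} {t \<in> X. Q t}"
      by (rule bij_betwI[of _ _ _ "\<lambda>t. ?r (?r t)"]) (auto simp: r3 inv)
  qed
  have "X = {t \<in> X. P t} \<union> ({t \<in> X. P (?r t)} \<union> {t \<in> X. P (?r (?r t))})"
    using one by blast
  then have "card X = card ({t \<in> X. P t} \<union> ({t \<in> X. P (?r t)} \<union> {t \<in> X. P (?r (?r t))}))" by simp
  also have "\<dots> = card {t \<in> X. P t} + (card {t \<in> X. P (?r t)} + card {t \<in> X. P (?r (?r t))})"
  proof -
    have "{t \<in> X. P (?r t)} \<inter> {t \<in> X. P (?r (?r t))} = {}" using disj inv by blast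
    moreover have "\<not> P t" if "t \<in> X" "P (?r (?r t))" for t
      using disj[of "?r (?r t)"] inv that by (simp add: r3)
    then have "{t \<in> X. P t} \<inter> ({t \<in> X. P (?r t)} \<union> {t \<in> X. P (?r (?r t))}) = {}" using disj by blast
    ultimately show ?thesis using fin by (simp add: card_Un_disjoint)
  qed
  finally show ?thesis using shift[of P] shift[of "\<lambda>t. P (?r t)"] by simp
qed

text \<open>Equality of \<open>q\<close> and \<open>r\<close> would give 1 modulo 4, so their
  exchange pairs the halves \<open>q > r\<close> and \<open>q < r\<close>, each as large as
  \<open>odd_triples n\<close>. Splitting by the sign of \<open>p\<close> instead shows that folded
  triples merge the nonnegative and the positive triples with even first entry.\<close>

lemma card_folded_triples:
  assumes "n mod 8 = 3"
  shows "card (folded_triples n) = 2 * card (odd_triples n)"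
    and "card (folded_triples n) = card {(p, q, r). even p \<and> odd q \<and> odd r \<and> p \<ge> 0 \<and> q > 0 \<and> r > 0 \<and> e2 (p, q, r) = int n}
           + card {(p, q, r). even p \<and> odd q \<and> odd r \<and> p > 0 \<and> q > 0 \<and> r > 0 \<and> e2 (p, q, r) = int n}"
proof -
  let ?A = "{(p, q, r). even p \<and> odd q \<and> odd r \<and> p \<ge> 0 \<and> q > 0 \<and> r > 0 \<and> e2 (p, q, r) = int n}"
  let ?B = "{(p, q, r). even p \<and> odd q \<and> odd r \<and> p > 0 \<and> q > 0 \<and> r > 0 \<and> e2 (p, q, r) = int n}"
  let ?B' = "{(p, q, r) \<in> folded_triples n. p < 0}"
  have fA: "finite ?A" by (rule finite_subset[OF _ finite_nonneg_triples[of n]]) (auto simp: nonneg_triples_def)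
  have fB: "finite ?B" by (rule finite_subset[OF _ fA]) auto
  have b: "bij_betw (\<lambda>(p, q, r). (- p, q, r)) ?B ?B'"
    by (rule bij_betwI[of _ _ _ "\<lambda>(p, q, r). (- p, q, r)"]) (auto simp: folded_triples_def algebra_simps)
  have fB': "finite ?B'" using bij_betw_finite[OF b] fB by simp
  have F: "folded_triples n = ?A \<union> ?B'" by (auto simp: folded_triples_def algebra_simps)
  have "card (folded_triples n) = card (?A \<union> ?B')" by (rule arg_cong[OF F])
  also have "\<dots> = card ?A + card ?B'" by (rule card_Un_disjoint[OF fA fB']) auto
  finally show "card (folded_triples n) = card ?A + card ?B" by (simp only: bij_betw_same_card[OF b])
  have fin: "finite (folded_triples n)" by (rule finite_subset[OF equalityD1[OF F]]) (rule finite_UnI[OF fA fB'])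
  let ?G = "{(p, q, r) \<in> folded_triples n. q > r}" and ?L = "{(p, q, r) \<in> folded_triples n. q < r}"
  have "q \<noteq> r" if "(p, q, r) \<in> folded_triples n" for p q r
  proof
    assume "q = r"
    with that have h: "even \<bar>p\<bar>" "odd q" "\<bar>p\<bar> * (q + q) + q * q = int n" by (auto simp: folded_triples_def)
    obtain l where l: "\<bar>p\<bar> = 2 * l" using h(1) by (elim evenE)
    obtain k where k: "q = 2 * k + 1" using h(2) by (elim oddE)
    have "int n = 1 + 4 * (l * (2 * k + 1) + k * k + k)" unfolding h(3)[symmetric] l k by (simp add: algebra_simps)
    then have "int n mod 4 = 1" by (rule mod_eq_of_eq_add_mult) simp_all
    then show False using assms by presburger
  qed
  then have GL: "folded_triples n = ?G \<union> ?L" by fastforce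
  have "card (folded_triples n) = card (?G \<union> ?L)" by (rule arg_cong[OF GL])
  also have "\<dots> = card ?G + card ?L"
    by (rule card_Un_disjoint) (auto intro: finite_subset[OF _ fin])
  also have "card ?L = card ?G"
  proof (rule bij_betw_same_card)
    show "bij_betw (\<lambda>(p, q, r). (p, r, q)) ?L ?G"
      by (rule bij_betwI[of _ _ _ "\<lambda>(p, q, r). (p, r, q)"]) (auto simp: folded_triples_def algebra_simps)
  qed
  finally show "card (folded_triples n) = 2 * card (odd_triples n)"
    by (simp add: card_odd_triples_eq[OF assms])
qed

lemma mixed_parity:
  assumes "odd n" and t: "(a, b, c) \<in> nonneg_triples" "e2 (a, b, c) = int n" "(a, b, c) \<notin> odd_triples n"
  shows "(even a \<and> odd b \<and> odd c) \<or> (odd a \<and> even b \<and> odd c) \<or> (odd a \<and> odd b \<and> even c)"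
proof -
  have "odd (a * b + b * c + c * a)" using t(2) \<open>odd n\<close> by simp
  moreover have "\<not> (odd a \<and> odd b \<and> odd c)"
  proof
    assume o: "odd a \<and> odd b \<and> odd c"
    then have "a \<noteq> 0" "b \<noteq> 0" "c \<noteq> 0" by auto
    then show False using t o by (auto simp: nonneg_triples_def odd_triples_def)
  qed
  ultimately show ?thesis by auto
qed

text \<open>Such triples have exactly one even entry. Rotating it to the front accounts for a factor
  3, and \<open>card_folded_triples\<close> for a factor 2.\<close>

lemma card_mixed_triples:
  assumes "n mod 8 = 3"
  shows "card {t \<in> nonneg_triples. e2 t = int n \<and> t \<notin> odd_triples n}
       + card {t \<in> pos_triples. e2 t = int n \<and> t \<notin> odd_triples n} = 6 * card (odd_triples n)"
proof -
  let ?P = "\<lambda>t::itriple. case t of (a, b, c) \<Rightarrow> even a"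
  have "odd n" using assms by presburger
  note parity = mixed_parity[OF \<open>odd n\<close>]
  have three: "card {t \<in> X. e2 t = int n \<and> t \<notin> odd_triples n}
      = 3 * card {t \<in> {t \<in> X. e2 t = int n \<and> t \<notin> odd_triples n}. ?P t}"
    if X: "X \<subseteq> nonneg_triples" "\<And>t. t \<in> X \<Longrightarrow> rotate_triple t \<in> X" for X
  proof (rule card_exactly_one_rotation)
    show "finite {t \<in> X. e2 t = int n \<and> t \<notin> odd_triples n}"
      by (rule finite_subset[OF _ finite_nonneg_triples[of n]]) (use X in auto)
  next
    fix t assume "t \<in> {t \<in> X. e2 t = int n \<and> t \<notin> odd_triples n}"
    then show "rotate_triple t \<in> {t \<in> X. e2 t = int n \<and> t \<notin> odd_triples n}"
      using X(2)[of t] by (cases t) (auto simp: rotate_triple_def odd_triples_def algebra_simps)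
  next
    fix t assume t: "t \<in> {t \<in> X. e2 t = int n \<and> t \<notin> odd_triples n}"
    obtain a b c where abc: "t = (a, b, c)" by (cases t)
    have "(even a \<and> odd b \<and> odd c) \<or> (odd a \<and> even b \<and> odd c) \<or> (odd a \<and> odd b \<and> even c)"
      using t X(1) by (intro parity) (auto simp: abc)
    then show "?P t \<or> ?P (rotate_triple t) \<or> ?P (rotate_triple (rotate_triple t))"
      and "?P t \<Longrightarrow> \<not> ?P (rotate_triple t)"
      by (auto simp: abc rotate_triple_def)
  qed
  have A: "{t \<in> {t \<in> nonneg_triples. e2 t = int n \<and> t \<notin> odd_triples n}. ?P t}
      = {(p, q, r). even p \<and> odd q \<and> odd r \<and> p \<ge> 0 \<and> q > 0 \<and> r > 0 \<and> e2 (p, q, r) = int n}" (is "?L = ?R")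
  proof (intro subset_antisym subsetI)
    fix t assume t: "t \<in> ?L"
    obtain a b c where abc: "t = (a, b, c)" by (cases t)
    have "odd b" "odd c" using t parity[of a b c] by (auto simp: abc)
    moreover from this have "b \<noteq> 0" "c \<noteq> 0" by auto
    ultimately show "t \<in> ?R" using t by (auto simp: abc nonneg_triples_def)
  qed (auto simp: nonneg_triples_def odd_triples_def)
  have B: "{t \<in> {t \<in> pos_triples. e2 t = int n \<and> t \<notin> odd_triples n}. ?P t}
      = {(p, q, r). even p \<and> odd q \<and> odd r \<and> p > 0 \<and> q > 0 \<and> r > 0 \<and> e2 (p, q, r) = int n}" (is "?L = ?R")
  proof (intro subset_antisym subsetI)
    fix t assume t: "t \<in> ?L"
    obtain a b c where abc: "t = (a, b, c)" by (cases t)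
    have "odd b" "odd c" using t parity[of a b c] triples_subset by (auto simp: abc)
    then show "t \<in> ?R" using t by (auto simp: abc pos_triples_def)
  qed (auto simp: pos_triples_def odd_triples_def)
  have "card {t \<in> nonneg_triples. e2 t = int n \<and> t \<notin> odd_triples n}
       + card {t \<in> pos_triples. e2 t = int n \<and> t \<notin> odd_triples n} = 3 * card (folded_triples n)"
    unfolding card_folded_triples(2)[OF assms] A[symmetric] B[symmetric]
    by (subst three, force, force simp: nonneg_triples_def rotate_triple_def,
        subst three, use triples_subset in force, force simp: pos_triples_def rotate_triple_def) simp
  then show ?thesis using card_folded_triples(1)[OF assms] by simp
qed

text \<open>All-odd triples have sign -1 and the others +1. Let o be the number of all-odd ones:
  over nonnegative and positive triples together the two types number 2o and 6o. The theta identity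
  yields 2(6o - 2o) and the class number 6o + 2o, both equal to 8o.\<close>

lemma r3_and_hurwitz_three_mod_eight:
  assumes "n mod 8 = 3"
  shows "r3 n = 8 * card (odd_triples n)" "6 * hurwitz_class_number (4 * n) = of_nat (8 * card (odd_triples n))"
proof -
  have n: "n > 0" "odd n" using assms by presburger+
  let ?O = "odd_triples n"
  let ?M = "\<lambda>X. {t \<in> X. e2 t = int n \<and> t \<notin> ?O}"
  have Osub: "?O \<subseteq> {t \<in> pos_triples. e2 t = int n}" by (auto simp: odd_triples_def pos_triples_def)
  have fO: "finite ?O" by (rule finite_subset[OF Osub finite_pos_triples])
  have split: "{t \<in> X. e2 t = int n} = ?O \<union> ?M X" if "pos_triples \<subseteq> X" for X using Osub that by blast
  have fM: "finite (?M X)" if "X \<subseteq> nonneg_triples" for X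
    by (rule finite_subset[OF _ finite_nonneg_triples[of n]]) (use that in auto)
  have c: "card {t \<in> X. e2 t = int n} = card ?O + card (?M X)" if "pos_triples \<subseteq> X" "X \<subseteq> nonneg_triples" for X
    unfolding split[OF that(1)] using fO fM[OF that(2)] by (intro card_Un_disjoint) auto
  show "6 * hurwitz_class_number (4 * n) = of_nat (8 * card ?O)"
    using six_hurwitz_four_times[OF n(1)] c[of nonneg_triples] c[of pos_triples] triples_subset
      card_mixed_triples[OF assms] by (simp flip: of_nat_add)
  have tO: "tsign t = - 1" if "t \<in> ?O" for t
    using that by (cases t) (auto simp: odd_triples_def powi_minus_one_odd_even)
  have tM: "tsign t = 1" if "t \<in> ?M X" "X \<subseteq> nonneg_triples" for t X
  proof -
    obtain a b c where t: "t = (a, b, c)" by (cases t)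
    have "even (a + b + c)"
      using mixed_parity[OF n(2), of a b c] that by (auto simp: t)
    then show ?thesis by (simp add: t powi_minus_one_odd_even del: even_add)
  qed
  have s: "(\<Sum>t | t \<in> X \<and> e2 t = int n. tsign t) = real (card (?M X)) - real (card ?O)"
    if X: "pos_triples \<subseteq> X" "X \<subseteq> nonneg_triples" for X
  proof -
    have "(\<Sum>t | t \<in> X \<and> e2 t = int n. tsign t) = (\<Sum>t\<in>?O. tsign t) + (\<Sum>t\<in>?M X. tsign t)"
      unfolding split[OF X(1)] using fO fM[OF X(2)] by (intro sum.union_disjoint) auto
    also have "(\<Sum>t\<in>?O. tsign t) = (\<Sum>t\<in>?O. - 1)" by (rule sum.cong) (use tO in auto)
    also have "(\<Sum>t\<in>?M X. tsign t) = (\<Sum>t\<in>?M X. 1)" by (rule sum.cong) (use tM X(2) in auto)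
    finally show ?thesis by simp
  qed
  have "- real (r3 n) = - 2 * (real (card (?M nonneg_triples)) + real (card (?M pos_triples)) - 2 * real (card ?O))"
    using theta_cube_coefficient[OF n(1)] s[of nonneg_triples] s[of pos_triples] triples_subset n(2)
    unfolding signed_r3 by simp
  moreover have "real (card (?M nonneg_triples)) + real (card (?M pos_triples)) = 6 * real (card ?O)"
    using card_mixed_triples[OF assms] by (simp flip: of_nat_add)
  ultimately have "real (r3 n) = real (8 * card ?O)" by simp
  then show "r3 n = 8 * card ?O" by (simp only: of_nat_eq_iff)
qed

section \<open>Three squares modulo 4 and 8\<close>

lemma square_sum_mod_four:
  assumes "x\<^sup>2 + y\<^sup>2 + z\<^sup>2 = int n"
  shows "int n mod 4 = ((if even x then 0 else 1) + (if even y then 0 else 1) + (if even z then 0 else 1)) mod 4"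
proof -
  have "int n mod 4 = (x\<^sup>2 mod 4 + y\<^sup>2 mod 4 + z\<^sup>2 mod 4) mod 4"
  proof -
    have "(A + B + C) mod 4 = (A mod 4 + B mod 4 + C mod 4) mod 4" for A B C :: int by presburger
    then show ?thesis unfolding assms[symmetric] .
  qed
  then show ?thesis by (simp only: square_mod_four)
qed

lemma r3_zero_seven_mod_eight:
  assumes "n mod 8 = 7"
  shows "{(x, y, z). x\<^sup>2 + y\<^sup>2 + z\<^sup>2 = int n} = {}"
proof (intro equals0I)
  fix t assume "t \<in> {(x, y, z). x\<^sup>2 + y\<^sup>2 + z\<^sup>2 = int n}"
  then obtain x y z where e: "x\<^sup>2 + y\<^sup>2 + z\<^sup>2 = int n" by auto
  have n: "int n mod 4 = 3" "int n mod 8 = 7" using assms by presburger+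
  have "odd x" "odd y" "odd z" using square_sum_mod_four[OF e] n(1) by (auto split: if_splits)
  then have "x\<^sup>2 mod 8 = 1" "y\<^sup>2 mod 8 = 1" "z\<^sup>2 mod 8 = 1" by (auto intro: odd_square_mod_eight)
  then show False using e n(2) by presburger
qed

lemma r3_four_times:
  assumes "n mod 4 = 0"
  shows "r3 n = r3 (n div 4)"
proof -
  obtain m where m: "n = 4 * m" using assms by (metis mod_eq_0_iff_dvd dvdE)
  let ?d = "\<lambda>(a::int, b::int, c::int). (2 * a, 2 * b, 2 * c)"
  have "bij_betw ?d {(x, y, z). x\<^sup>2 + y\<^sup>2 + z\<^sup>2 = int m} {(x, y, z). x\<^sup>2 + y\<^sup>2 + z\<^sup>2 = int n}"
  proof (rule bij_betw_imageI)
    show "inj_on ?d {(x, y, z). x\<^sup>2 + y\<^sup>2 + z\<^sup>2 = int m}" by (auto simp: inj_on_def)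
    show "?d ` {(x, y, z). x\<^sup>2 + y\<^sup>2 + z\<^sup>2 = int m} = {(x, y, z). x\<^sup>2 + y\<^sup>2 + z\<^sup>2 = int n}"
    proof (intro subset_antisym subsetI)
      fix t assume "t \<in> {(x, y, z). x\<^sup>2 + y\<^sup>2 + z\<^sup>2 = int n}"
      then obtain x y z where t: "t = (x, y, z)" "x\<^sup>2 + y\<^sup>2 + z\<^sup>2 = int n" by auto
      have "even x" "even y" "even z" using square_sum_mod_four[OF t(2)] by (auto simp: m split: if_splits)
      then obtain a b c where abc: "x = 2 * a" "y = 2 * b" "z = 2 * c" by (elim evenE) blast
      then have "a\<^sup>2 + b\<^sup>2 + c\<^sup>2 = int m" using t(2) m by (simp add: power2_eq_square)
      then show "t \<in> ?d ` {(x, y, z). x\<^sup>2 + y\<^sup>2 + z\<^sup>2 = int m}" unfolding t(1) abc by force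
    qed (auto simp: m power2_eq_square)
  qed
  from bij_betw_same_card[OF this] show ?thesis by (simp add: r3_def m)
qed

text \<open>The three entries cannot all have the same parity, so exactly one of the three cyclic
  pairs agrees modulo 2.\<close>

lemma r3_three_times:
  assumes "n mod 4 = 1 \<or> n mod 4 = 2"
  shows "r3 n = 3 * card {(x, u, v). even (u - v) \<and> x\<^sup>2 + u\<^sup>2 + v\<^sup>2 = int n}"
proof -
  let ?R = "{(x, y, z). x\<^sup>2 + y\<^sup>2 + z\<^sup>2 = int n}"
  let ?P = "\<lambda>t::itriple. case t of (x, u, v) \<Rightarrow> even (u - v)"
  have m: "int n mod 4 = 1 \<or> int n mod 4 = 2" using assms by presburger
  have "card ?R = 3 * card {t \<in> ?R. ?P t}"
  proof (rule card_exactly_one_rotation[OF finite_sum_three_squares])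
    fix t assume "t \<in> ?R"
    then obtain x y z where t: "t = (x, y, z)" "x\<^sup>2 + y\<^sup>2 + z\<^sup>2 = int n" by auto
    show "rotate_triple t \<in> ?R" using t by (simp add: rotate_triple_def)
    have "\<not> (even x \<and> even y \<and> even z)" "\<not> (odd x \<and> odd y \<and> odd z)"
      using square_sum_mod_four[OF t(2)] m by (auto split: if_splits)
    then show "?P t \<or> ?P (rotate_triple t) \<or> ?P (rotate_triple (rotate_triple t))"
      and "?P t \<Longrightarrow> \<not> ?P (rotate_triple t)"
      by (auto simp: t(1) rotate_triple_def)
  qed
  moreover have "{t \<in> ?R. ?P t} = {(x, u, v). even (u - v) \<and> x\<^sup>2 + u\<^sup>2 + v\<^sup>2 = int n}" by auto
  ultimately show ?thesis by (simp add: r3_def)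
qed

lemma signed_count_eq:
  assumes "\<And>x u v. x\<^sup>2 + u\<^sup>2 + v\<^sup>2 = int n \<Longrightarrow> even (u - v) \<Longrightarrow> (- 1 :: real) powi (x + u) = s"
  shows "(\<Sum>(x, u, v) | even (u - v) \<and> x\<^sup>2 + u\<^sup>2 + v\<^sup>2 = int n. (- 1) powi (x + u))
     = s * real (card {(x, u, v). even (u - v) \<and> x\<^sup>2 + u\<^sup>2 + v\<^sup>2 = int n})"
proof -
  let ?E = "{(x, u, v). even (u - v) \<and> x\<^sup>2 + u\<^sup>2 + v\<^sup>2 = int n}"
  have "(\<Sum>(x, u, v) | even (u - v) \<and> x\<^sup>2 + u\<^sup>2 + v\<^sup>2 = int n. (- 1 :: real) powi (x + u)) = (\<Sum>t\<in>?E. s)"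
    by (rule sum.cong) (use assms in auto)
  then show ?thesis by simp
qed

theorem theorem1p7:
  fixes a :: "nat \<Rightarrow> int" and n :: nat
  assumes a_gen: "\<And>q::complex. norm q < 1 \<Longrightarrow>
      (\<lambda>m. of_int (a m) * q ^ m) sums
        (qpochhammer_inf q q / qpochhammer_inf (- q) q *
         (qpochhammer_inf (q\<^sup>2) (q\<^sup>2) / qpochhammer_inf (- (q\<^sup>2)) (q\<^sup>2))\<^sup>2)"
    and n_pos: "n > 0"
  shows "(n mod 8 \<in> {1, 2, 5, 6} \<longrightarrow>
            of_int (a n) = - 4 * hurwitz_class_number (4 * n)) \<and>
         (n mod 8 = 3 \<longrightarrow>
            of_int (a n) = 6 * hurwitz_class_number (4 * n) \<and>
            6 * hurwitz_class_number (4 * n) = 24 * hurwitz_class_number n) \<and>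
         (n mod 8 = 7 \<longrightarrow> a n = 0) \<and>
         (n mod 4 = 0 \<longrightarrow> a n = int (r3 n) \<and> r3 n = r3 (n div 4))"
proof (intro conjI impI)
  let ?R = "{(x, y, z). x\<^sup>2 + y\<^sup>2 + z\<^sup>2 = int n}"
  let ?E = "{(x, u, v). even (u - v) \<and> x\<^sup>2 + u\<^sup>2 + v\<^sup>2 = int n}"
  have a_sum: "real_of_int (a n) = (\<Sum>(x, u, v) | even (u - v) \<and> x\<^sup>2 + u\<^sup>2 + v\<^sup>2 = int n. (- 1) powi (x + u))"
    by (rule a_eq_signed_count) (rule a_gen)
  \<comment> \<open>Here the three entries always have equal parity: the condition on
    \<open>u - v\<close> is automatic and every sign is +1.\<close>
  have equal: "a n = int (r3 n)" if n: "n mod 4 = 0 \<or> n mod 4 = 3"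
  proof -
    have m: "int n mod 4 = 0 \<or> int n mod 4 = 3" using n by presburger
    have par: "even (u - v) \<and> even (x + u)" if "x\<^sup>2 + u\<^sup>2 + v\<^sup>2 = int n" for x u v
      using square_sum_mod_four[OF that] m by (auto split: if_splits)
    then have "?E = ?R" by auto
    moreover have "real_of_int (a n) = 1 * real (card ?E)"
      unfolding a_sum by (rule signed_count_eq) (use par in \<open>simp add: powi_minus_one_odd_even del: even_add\<close>)
    ultimately have "real_of_int (a n) = real_of_int (int (r3 n))" by (simp add: r3_def)
    then show ?thesis by (simp only: of_int_eq_iff)
  qed
  show "of_int (a n) = - 4 * hurwitz_class_number (4 * n)" if n: "n mod 8 \<in> {1, 2, 5, 6}"
  proof -
    have n4: "n mod 4 = 1 \<or> n mod 4 = 2"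
    proof -
      have "n mod 8 = 1 \<or> n mod 8 = 2 \<or> n mod 8 = 5 \<or> n mod 8 = 6" using n by simp
      then show ?thesis by presburger
    qed
    then have m: "int n mod 4 = 1 \<or> int n mod 4 = 2" by presburger
    \<comment> \<open>Mixed parities together with \<open>even (u - v)\<close> make \<open>x\<close>
      differ from \<open>u\<close> modulo 2, so every sign is -1 and only a third of the
      representations is counted.\<close>
    have "real_of_int (a n) = (- 1) * real (card ?E)"
      unfolding a_sum
    proof (rule signed_count_eq)
      fix x u v :: int assume "x\<^sup>2 + u\<^sup>2 + v\<^sup>2 = int n" "even (u - v)"
      then have "odd (x + u)" using square_sum_mod_four[of x u v n] m by (auto split: if_splits)
      then show "(- 1 :: real) powi (x + u) = - 1" by (simp add: powi_minus_one_odd_even del: even_add odd_add)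
    qed
    then have "real_of_int (a n) = real_of_int (- int (card ?E))" by simp
    then have "a n = - int (card ?E)" by (simp only: of_int_eq_iff)
    moreover have "3 * of_nat (card ?E) = 12 * hurwitz_class_number (4 * n)"
      using r3_eq_twelve_hurwitz[OF n4] r3_three_times[OF n4] by simp
    ultimately show ?thesis by simp
  qed
  {
    assume n: "n mod 8 = 3"
    have "n mod 4 = 3" using n by presburger
    then have "a n = int (8 * card (odd_triples n))"
      using equal r3_and_hurwitz_three_mod_eight(1)[OF n] by simp
    then show "of_int (a n) = 6 * hurwitz_class_number (4 * n)"
      using r3_and_hurwitz_three_mod_eight(2)[OF n] by simp
    show "6 * hurwitz_class_number (4 * n) = 24 * hurwitz_class_number n"
      using r3_and_hurwitz_three_mod_eight(2)[OF n] three_hurwitz_odd[OF n] by simp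
  }
  show "a n = 0" if n: "n mod 8 = 7"
  proof -
    have "n mod 4 = 3" using n by presburger
    then show ?thesis using equal r3_zero_seven_mod_eight[OF n] by (simp add: r3_def)
  qed
  show "a n = int (r3 n)" if "n mod 4 = 0" using equal that by blast
  show "r3 n = r3 (n div 4)" if "n mod 4 = 0" by (rule r3_four_times[OF that])
qed

end
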